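(* Let $p=p(n)\in[0,1]$ be a function of $n$ with $p(n)\leq 1/2$. If \[ \lim_{n\to+\infty}(np-\log n-\log\log n)=+\infty, \] then with high probability a random graph $G\sim\mathcal{G}(n,p)$ is a homomorphic core. Conversely, if \[ \lim_{n\to+\infty}(np-\log n-\log\log n)=-\infty, \] then with high probability $G\sim\mathcal{G}(n,p)$ is not a homomorphic core.
   Context: All graphs are finite, simple, loopless and undirected, and $n$-vertex graphs have vertex set $[n]=\{1,\dots,n\}$. $\log$ is the natural logarithm. $\mathcal{G}(n,p)$ is the Erdős–Rényi random graph: each pair of distinct vertices of $[n]$ is joined by an edge independently with probability $p$. "With high probability" means with probability tending to $1$ as $n\to+\infty$. An endomorphism of a graph $G$ is a map $f:V(G)\to V(G)$ such that $xy\in E(G)$ implies $f(x)f(y)\in E(G)$; an automorphism is a bijection $g:V(G)\to V(G)$ with $xy\in E(G)\iff g(x)g(y)\in E(G)$. A graph $G$ is a homomorphic core if every endomorphism of $G$ is an automorphism. Equivalently, $G$ has no proper retraction, where a proper retraction is an endomorphism $r$ of $G$ with image $r(V(G))=S\neq V(G)$ and $r(s)=s$ for every $s\in S$. *)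

theory Defs
  imports "HOL-Probability.Probability"
begin

text \<open>
  A finite simple graph is given by a vertex set \<open>V\<close> and an edge set \<open>E\<close> whose members are
  two-element subsets of \<open>V\<close>. Since no singleton is an edge, an edge \<open>{f x, f y}\<close> forces
  \<open>f x \<noteq> f y\<close>. Only the values of \<open>f\<close> on \<open>V\<close> matter.
\<close>

definition all_pairs :: "'a set \<Rightarrow> 'a set set" where
  "all_pairs V = {e. e \<subseteq> V \<and> card e = 2}"

definition graph_endomorphism :: "'a set \<Rightarrow> 'a set set \<Rightarrow> ('a \<Rightarrow> 'a) \<Rightarrow> bool" where
  "graph_endomorphism V E f \<longleftrightarrow>
     f \<in> V \<rightarrow> V \<and> (\<forall>x\<in>V. \<forall>y\<in>V. {x, y} \<in> E \<longrightarrow> {f x, f y} \<in> E)"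

definition graph_automorphism :: "'a set \<Rightarrow> 'a set set \<Rightarrow> ('a \<Rightarrow> 'a) \<Rightarrow> bool" where
  "graph_automorphism V E g \<longleftrightarrow>
     bij_betw g V V \<and> (\<forall>x\<in>V. \<forall>y\<in>V. {x, y} \<in> E \<longleftrightarrow> {g x, g y} \<in> E)"

definition homomorphic_core :: "'a set \<Rightarrow> 'a set set \<Rightarrow> bool" where
  "homomorphic_core V E \<longleftrightarrow>
     (\<forall>f. graph_endomorphism V E f \<longrightarrow> graph_automorphism V E f)"

text \<open>The distribution of the edge set of the random graph on the vertex set \<open>{1..n}\<close>.\<close>

definition erdos_renyi :: "nat \<Rightarrow> real \<Rightarrow> nat set set pmf" where
  "erdos_renyi n p =
     map_pmf (\<lambda>X. {e \<in> all_pairs {1..n}. X e})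
       (Pi_pmf (all_pairs {1..n}) False (\<lambda>_. bernoulli_pmf p))"

end

theory Submission
  imports Defs "HOL-Real_Asymp.Real_Asymp"
begin

text \<open>
  Write \<open>D = n p\<close>. Below the threshold a second moment computation produces a vertex of degree at
  most one, and such a vertex can be folded away. Above it, a graph that is not a core has a proper
  retraction \<open>r\<close>; let \<open>T\<close> be the set of vertices it moves.

  Small \<open>T\<close> is impossible: a neighbour of \<open>v \<in> T\<close> outside \<open>T\<close> is a common neighbour of
  \<open>v\<close> and \<open>r v\<close>, so almost all neighbours of \<open>v\<close> lie in \<open>T\<close>, and no small set of vertices
  spans that many edges. The exceptional vertices, whose neighbourhood is almost contained in
  another one, are pairwise far apart; the threshold is exactly what excludes a complete containment.

  Large \<open>T\<close> is excluded by a union bound. A spanning forest of \<open>T\<close>, rooted outside \<open>T\<close>, exists by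
  connectivity; there are about \<open>D ^ card T\<close> forests in expectation, and for each of them only
  \<open>t ^ card T\<close> retractions, where \<open>t = O(D)\<close> bounds the degrees. Since the clique number \<open>q\<close> of the
  image is at most of order \<open>sqrt D\<close>, Turan's argument shows that \<open>r\<close> forbids at least
  \<open>(card T)\<^sup>2 / (2 q) - card T\<close> pairs inside \<open>T\<close>, which costs a factor \<open>exp (- c n sqrt D)\<close>.
\<close>

section \<open>Expectations over random subsets\<close>

text \<open>A union bound over all maps that move T would cost exp (n log n), while Turan's argument
  gains only exp (c n sqrt D), too little when D is of order log n. This forces the forest encoding:
  the edge from a vertex to its parent is paid for by p, so that forest and map together cost O(D^2)
  per moved vertex, in all exp (O(n log D)), and sqrt D wins. The gain is computed after exposing
  the pairs outside T. The image of r lies there, so the target graph with its degree and clique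
  bounds is then fixed, while the pairs meeting T are still independent. The almost dominated
  vertices are treated differently on the two sides of D = 10 log n. For larger D there are none,
  with high probability. For smaller D they may occur, but D is then so small compared with n that
  two vertices share at most two neighbours; hence an almost dominated vertex has low degree, and a
  completely dominated one has degree at most two. The term log log n comes from the expected number
  of vertices of degree one, about n D exp (- D).\<close>

definition rexp :: "'a set \<Rightarrow> real \<Rightarrow> ('a set \<Rightarrow> real) \<Rightarrow> real" where
  "rexp A p F = (\<Sum>E\<in>Pow A. p ^ card E * (1 - p) ^ card (A - E) * F E)"

lemma rexp_cong:
  assumes "\<And>E. E \<subseteq> A \<Longrightarrow> F E = G E"
  shows "rexp A p F = rexp A p G"
  unfolding rexp_def using assms by (intro sum.cong) auto

lemma rexp_mono:
  assumes "0 \<le> p" "p \<le> 1" "\<And>E. E \<subseteq> A \<Longrightarrow> F E \<le> G E"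
  shows "rexp A p F \<le> rexp A p G"
  unfolding rexp_def using assms by (intro sum_mono mult_left_mono) auto

lemma rexp_nonneg:
  assumes "0 \<le> p" "p \<le> 1" "\<And>E. E \<subseteq> A \<Longrightarrow> 0 \<le> F E"
  shows "0 \<le> rexp A p F"
  unfolding rexp_def using assms by (intro sum_nonneg mult_nonneg_nonneg) auto

lemma rexp_cmult: "rexp A p (\<lambda>E. c * F E) = c * rexp A p F"
  unfolding rexp_def by (simp add: sum_distrib_left mult_ac)

lemma rexp_add: "rexp A p (\<lambda>E. F E + G E) = rexp A p F + rexp A p G"
  unfolding rexp_def by (simp add: sum.distrib distrib_left)

lemma rexp_sum: "rexp A p (\<lambda>E. \<Sum>i\<in>I. F i E) = (\<Sum>i\<in>I. rexp A p (F i))"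
  unfolding rexp_def by (subst sum.swap) (simp add: sum_distrib_left)

lemma rexp_empty [simp]: "rexp {} p F = F {}"
  by (simp add: rexp_def)

text \<open>Exposes the single coordinate a, absent with weight 1 - p and present with weight p. The
  inductions over the ground set rest on this recursion.\<close>

lemma rexp_insert:
  assumes "finite A" "a \<notin> A"
  shows "rexp (insert a A) p F = (1 - p) * rexp A p F + p * rexp A p (\<lambda>E. F (insert a E))"
proof -
  have 1: "Pow (insert a A) = Pow A \<union> insert a ` Pow A" by (rule Pow_insert)
  have 2: "Pow A \<inter> insert a ` Pow A = {}" using assms by auto
  have inj: "inj_on (insert a) (Pow A)" using assms by (auto simp: inj_on_def)
  have 3: "(\<Sum>E\<in>Pow A. p ^ card E * (1 - p) ^ card (insert a A - E) * F E)
        = (1 - p) * rexp A p F"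
    unfolding rexp_def sum_distrib_left
  proof (rule sum.cong[OF refl])
    fix E assume E: "E \<in> Pow A"
    have "insert a A - E = insert a (A - E)" using E assms by auto
    then have "card (insert a A - E) = Suc (card (A - E))" using assms by simp
    then show "p ^ card E * (1 - p) ^ card (insert a A - E) * F E =
      (1 - p) * (p ^ card E * (1 - p) ^ card (A - E) * F E)" by simp
  qed
  have 4: "(\<Sum>E\<in>insert a ` Pow A. p ^ card E * (1 - p) ^ card (insert a A - E) * F E)
        = p * rexp A p (\<lambda>E. F (insert a E))"
    unfolding rexp_def sum_distrib_left sum.reindex[OF inj] o_def
  proof (rule sum.cong[OF refl])
    fix E assume E: "E \<in> Pow A"
    have "finite E" "a \<notin> E" using E assms finite_subset by auto
    then have "card (insert a E) = Suc (card E)" by simp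
    moreover have "insert a A - insert a E = A - E" using assms by auto
    ultimately show "p ^ card (insert a E) * (1 - p) ^ card (insert a A - insert a E) * F (insert a E) =
      p * (p ^ card E * (1 - p) ^ card (A - E) * F (insert a E))" by simp
  qed
  show ?thesis
    unfolding rexp_def[of "insert a A"] 1
    by (subst sum.union_disjoint) (use assms 2 3 4 in auto)
qed

lemma rexp_const [simp]: "finite A \<Longrightarrow> rexp A p (\<lambda>_. c) = c"
  by (induction A rule: finite_induct) (auto simp: rexp_insert algebra_simps)

text \<open>Fubini for two independent random sets. Read from left to right it conditions on the
  part in A.\<close>

lemma rexp_Un:
  assumes "finite A" "finite B" "A \<inter> B = {}"
  shows "rexp (A \<union> B) p F = rexp A p (\<lambda>X. rexp B p (\<lambda>Y. F (X \<union> Y)))"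
  using assms(1,3)
proof (induction A arbitrary: F rule: finite_induct)
  case (insert a A)
  have *: "rexp (A \<union> B) p G = rexp A p (\<lambda>X. rexp B p (\<lambda>Y. G (X \<union> Y)))" for G
    by (rule insert.IH) (use insert.prems in auto)
  have "finite (A \<union> B)" "a \<notin> A \<union> B" using insert assms(2) by auto
  then show ?case
    by (simp only: Un_insert_left rexp_insert[OF \<open>finite (A \<union> B)\<close> \<open>a \<notin> A \<union> B\<close>]
        rexp_insert[OF insert.hyps] * )
qed simp

text \<open>The coordinates outside B do not influence the integrand and have total weight
  one.\<close>

lemma rexp_Int:
  assumes "finite A" "B \<subseteq> A"
  shows "rexp A p (\<lambda>E. F (E \<inter> B)) = rexp B p F"
proof -
  have fin: "finite B" "finite (A - B)" using assms finite_subset by auto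
  have "rexp A p (\<lambda>E. F (E \<inter> B)) = rexp (B \<union> (A - B)) p (\<lambda>E. F (E \<inter> B))"
    using assms by (simp add: Un_absorb1)
  also have "\<dots> = rexp B p (\<lambda>X. rexp (A - B) p (\<lambda>Y. F ((X \<union> Y) \<inter> B)))"
    using fin by (subst rexp_Un) auto
  also have "\<dots> = rexp B p (\<lambda>X. rexp (A - B) p (\<lambda>Y. F X))"
  proof (rule rexp_cong, rule rexp_cong)
    fix X Y assume "X \<subseteq> B" "Y \<subseteq> A - B"
    then have "(X \<union> Y) \<inter> B = X" by auto
    then show "F ((X \<union> Y) \<inter> B) = F X" by simp
  qed
  finally show ?thesis using fin by simp
qed

lemma rexp_indep:
  assumes "finite A" "B \<subseteq> A" "C \<subseteq> A" "B \<inter> C = {}"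
  shows "rexp A p (\<lambda>E. F (E \<inter> B) * G (E \<inter> C)) = rexp B p F * rexp C p G"
proof -
  have fin: "finite B" "finite C" using assms by (simp_all add: finite_subset)
  have eq: "(E \<inter> (B \<union> C)) \<inter> B = E \<inter> B" "(E \<inter> (B \<union> C)) \<inter> C = E \<inter> C" for E by auto
  have "rexp A p (\<lambda>E. F (E \<inter> B) * G (E \<inter> C)) = rexp (B \<union> C) p (\<lambda>E. F (E \<inter> B) * G (E \<inter> C))"
    using rexp_Int[of A "B \<union> C" p "\<lambda>E. F (E \<inter> B) * G (E \<inter> C)"] assms by (simp only: eq) auto
  also have "\<dots> = rexp B p (\<lambda>X. rexp C p (\<lambda>Y. F ((X \<union> Y) \<inter> B) * G ((X \<union> Y) \<inter> C)))"
    using fin assms by (subst rexp_Un) auto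
  also have "\<dots> = rexp B p (\<lambda>X. rexp C p (\<lambda>Y. F X * G Y))"
  proof (rule rexp_cong, rule rexp_cong)
    fix X Y assume "X \<subseteq> B" "Y \<subseteq> C"
    then have "(X \<union> Y) \<inter> B = X" "(X \<union> Y) \<inter> C = Y" using assms by auto
    then show "F ((X \<union> Y) \<inter> B) * G ((X \<union> Y) \<inter> C) = F X * G Y" by simp
  qed
  also have "\<dots> = rexp B p F * rexp C p G"
    using rexp_cmult[of B p "rexp C p G" F] by (simp add: rexp_cmult mult.commute)
  finally show ?thesis .
qed

lemma rexp_superset: 
  assumes "finite X"
  shows "rexp X p (\<lambda>E. of_bool (X \<subseteq> E)) = p ^ card X"
proof -
  have "rexp X p (\<lambda>E. of_bool (X \<subseteq> E)) = (\<Sum>E\<in>Pow X. if E = X then p ^ card X else 0)"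
    unfolding rexp_def by (rule sum.cong) (auto simp: of_bool_def)
  then show ?thesis using assms by simp
qed

lemma rexp_disjoint: 
  assumes "finite X"
  shows "rexp X p (\<lambda>E. of_bool (E \<inter> X = {})) = (1 - p) ^ card X"
proof -
  have "rexp X p (\<lambda>E. of_bool (E \<inter> X = {})) = (\<Sum>E\<in>Pow X. if E = {} then (1 - p) ^ card X else 0)"
    unfolding rexp_def by (rule sum.cong) (auto simp: of_bool_def Int_absorb2)
  then show ?thesis using assms by simp
qed

lemma rexp_pattern:
  assumes "finite A" "X \<subseteq> A" "Y \<subseteq> A" "X \<inter> Y = {}"
  shows "rexp A p (\<lambda>E. of_bool (X \<subseteq> E \<and> E \<inter> Y = {})) = p ^ card X * (1 - p) ^ card Y"
proof -
  have "rexp A p (\<lambda>E. of_bool (X \<subseteq> E \<and> E \<inter> Y = {})) =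
        rexp A p (\<lambda>E. of_bool (X \<subseteq> E \<inter> X) * of_bool ((E \<inter> Y) \<inter> Y = {}))"
    by (rule rexp_cong) (auto simp: of_bool_def)
  also have "\<dots> = rexp X p (\<lambda>E. of_bool (X \<subseteq> E)) * rexp Y p (\<lambda>E. of_bool (E \<inter> Y = {}))"
    by (rule rexp_indep[OF assms])
  finally show ?thesis using rexp_superset[of X p] rexp_disjoint[of Y p] assms(1-3)
    by (simp add: finite_subset)
qed

lemma rexp_contains:
  assumes "finite A" "X \<subseteq> A"
  shows "rexp A p (\<lambda>E. of_bool (X \<subseteq> E)) = p ^ card X"
  using rexp_pattern[OF assms, of "{}" p] by simp

text \<open>The generating function of the binomial distribution; at z = 1 / 5 it yields the
  Chernoff bounds for low degrees.\<close>

lemma rexp_power_card: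
  "finite A \<Longrightarrow> rexp A p (\<lambda>E. z ^ card E) = (1 - p + p * z) ^ card A"
proof (induction A rule: finite_induct)
  case (insert a A)
  have "rexp A p (\<lambda>E. z ^ card (insert a E)) = rexp A p (\<lambda>E. z * z ^ card E)"
  proof (rule rexp_cong)
    fix E assume "E \<subseteq> A"
    then have "finite E" "a \<notin> E" using insert finite_subset by auto
    then show "z ^ card (insert a E) = z * z ^ card E" by simp
  qed
  then show ?case using insert by (simp add: rexp_insert rexp_cmult algebra_simps)
qed auto

lemma rexp_union_bound:
  assumes "finite I" "0 \<le> p" "p \<le> 1"
    and "\<And>E. E \<subseteq> A \<Longrightarrow> Q E \<Longrightarrow> \<exists>i\<in>I. R i E"
  shows "rexp A p (\<lambda>E. of_bool (Q E)) \<le> (\<Sum>i\<in>I. rexp A p (\<lambda>E. of_bool (R i E)))"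
proof -
  have "rexp A p (\<lambda>E. of_bool (Q E)) \<le> rexp A p (\<lambda>E. \<Sum>i\<in>I. of_bool (R i E))"
  proof (rule rexp_mono[OF assms(2,3)])
    fix E assume E: "E \<subseteq> A"
    show "of_bool (Q E) \<le> (\<Sum>i\<in>I. of_bool (R i E) :: real)"
    proof (cases "Q E")
      case True
      then obtain i where "i \<in> I" "R i E" using assms(4) E by auto
      then have "of_bool (R i E) \<le> (\<Sum>i\<in>I. of_bool (R i E) :: real)"
        by (intro member_le_sum) (use assms in auto)
      then show ?thesis using \<open>R i E\<close> True by simp
    qed (simp add: sum_nonneg)
  qed
  then show ?thesis by (simp add: rexp_sum)
qed

section \<open>From the probability mass function of the random graph to finite weighted
  sums\<close>

lemma all_pairs_finite [simp]: "finite V \<Longrightarrow> finite (all_pairs V)"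
  unfolding all_pairs_def by (rule finite_subset[of _ "Pow V"]) auto

text \<open>Replaces probabilities by the finite sums \<open>rexp\<close>, for which independence
  and recursion are plain algebra.\<close>

lemma prob_erdos_renyi:
  assumes "0 \<le> p" "p \<le> 1"
  shows "measure_pmf.prob (erdos_renyi n p) {E. Q E} =
    rexp (all_pairs {1..n}) p (\<lambda>E. of_bool (Q E))"
proof -
  define A where "A = all_pairs {1..n}"
  have finA: "finite A" unfolding A_def by simp
  have pmfE: "pmf (erdos_renyi n p) E = p ^ card E * (1 - p) ^ card (A - E)" if E: "E \<subseteq> A" for E
  proof -
    let ?P = "Pi_pmf A False (\<lambda>_. bernoulli_pmf p)"
    have "pmf (erdos_renyi n p) E = measure_pmf.prob ?P ((\<lambda>X. {e \<in> A. X e}) -` {E})"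
      unfolding erdos_renyi_def A_def by (rule pmf_map)
    \<comment> \<open>Other functions X also produce E, namely those that agree with the indicator
      of E on A and differ from it outside. They have mass zero, because \<open>Pi_pmf\<close> takes
      the default value False off A.\<close>
    also have "\<dots> = measure_pmf.prob ?P {\<lambda>e. e \<in> E}"
    proof (rule measure_prob_cong_0)
      fix X assume X: "X \<in> (\<lambda>X. {e \<in> A. X e}) -` {E} - {\<lambda>e. e \<in> E}"
      show "pmf ?P X = 0"
      proof (rule pmf_Pi_outside[OF finA], rule ccontr)
        assume "\<not> (\<exists>x. x \<notin> A \<and> X x \<noteq> False)"
        then have "X = (\<lambda>e. e \<in> E)" using X E by auto
        then show False using X by simp
      qed
    qed (use E in auto)
    also have "\<dots> = pmf ?P (\<lambda>e. e \<in> E)" by (simp add: measure_pmf_single)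
    also have "\<dots> = (\<Prod>e\<in>A. pmf (bernoulli_pmf p) (e \<in> E))"
      using E by (intro pmf_Pi'[OF finA]) auto
    also have "\<dots> = (\<Prod>e\<in>A. if e \<in> E then p else 1 - p)"
      using assms by (intro prod.cong) auto
    also have "\<dots> = p ^ card E * (1 - p) ^ card (A - E)"
    proof -
      have "A \<inter> E = E" "A \<inter> - E = A - E" using E by auto
      then show ?thesis using finA by (simp add: prod.If_cases Collect_neg_eq)
    qed
    finally show ?thesis .
  qed
  have sub: "set_pmf (erdos_renyi n p) \<subseteq> Pow A"
    unfolding erdos_renyi_def A_def by auto
  have "measure_pmf.prob (erdos_renyi n p) {E. Q E} =
        measure_pmf.prob (erdos_renyi n p) {E \<in> Pow A. Q E}"
    by (rule measure_prob_cong_0) (use sub in \<open>auto simp: pmf_eq_0_set_pmf\<close>)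
  also have "\<dots> = (\<Sum>E\<in>{E \<in> Pow A. Q E}. pmf (erdos_renyi n p) E)"
    using finA by (intro measure_measure_pmf_finite) auto
  also have "\<dots> = rexp A p (\<lambda>E. of_bool (Q E))"
    unfolding rexp_def using finA
    by (intro sum.mono_neutral_cong_left) (auto simp: pmfE)
  finally show ?thesis unfolding A_def .
qed

lemma prob_not_erdos_renyi:
  "measure_pmf.prob (erdos_renyi n p) {E. \<not> Q E} =
    1 - measure_pmf.prob (erdos_renyi n p) {E. Q E}"
proof -
  have "{E. \<not> Q E} = space (measure_pmf (erdos_renyi n p)) - {E. Q E}" by auto
  then show ?thesis using measure_pmf.prob_compl[of "{E. Q E}" "erdos_renyi n p"] by simp
qed

section \<open>Retractions and expansion\<close>

definition nbrs :: "'a set set \<Rightarrow> 'a \<Rightarrow> 'a set" where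
  "nbrs E v = {w. {v, w} \<in> E}"

lemma nbrs_commute: "w \<in> nbrs E v \<longleftrightarrow> v \<in> nbrs E w"
  by (simp add: nbrs_def insert_commute)

lemma doubleton_in_all_pairs: "{v, w} \<in> all_pairs V \<longleftrightarrow> v \<in> V \<and> w \<in> V \<and> v \<noteq> w"
  by (auto simp: all_pairs_def card_insert_if)

lemma all_pairsE:
  assumes "e \<in> all_pairs V"
  obtains v w where "e = {v, w}" "v \<in> V" "w \<in> V" "v \<noteq> w"
  using assms by (auto simp: all_pairs_def card_2_iff)

lemma nbrs_subset:
  assumes "E \<subseteq> all_pairs V" shows "nbrs E v \<subseteq> V - {v}"
proof
  fix w assume "w \<in> nbrs E v"
  then have "{v, w} \<in> all_pairs V" using assms by (auto simp: nbrs_def)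
  then show "w \<in> V - {v}" by (auto simp: doubleton_in_all_pairs)
qed

lemma finite_nbrs: "finite V \<Longrightarrow> E \<subseteq> all_pairs V \<Longrightarrow> finite (nbrs E v)"
  using nbrs_subset finite_subset by (metis finite_Diff)

lemma graph_endomorphism_funpow:
  assumes "graph_endomorphism V E f"
  shows "graph_endomorphism V E (f ^^ k)"
proof (induction k)
  case (Suc k)
  then have "(f ^^ k) v \<in> V" if "v \<in> V" for v using that by (auto simp: graph_endomorphism_def)
  then show ?case using Suc assms unfolding graph_endomorphism_def by auto
qed (auto simp: graph_endomorphism_def)

text \<open>An injective endomorphism acts injectively on the finite edge set, hence surjectively.
  Every edge between images is therefore the image of an edge, which by injectivity joins the given
  two vertices.\<close>

lemma bij_graph_endomorphism:
  assumes "finite V" "E \<subseteq> all_pairs V" "graph_endomorphism V E f" "inj_on f V"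
  shows "graph_automorphism V E f"
proof -
  have fV: "f \<in> V \<rightarrow> V" using assms(3) by (simp add: graph_endomorphism_def)
  then have bij: "bij_betw f V V"
    using assms(1,4) endo_inj_surj[of V f] by (simp add: bij_betw_def image_subset_iff_funcset)
  have finE: "finite E" using assms(1,2) finite_subset all_pairs_finite by metis
  have EPow: "E \<subseteq> Pow V" using assms(2) by (auto simp: all_pairs_def)
  have inj: "inj_on ((`) f) E"
    using inj_on_image_Pow[OF assms(4)] EPow inj_on_subset by blast
  have sub: "(`) f ` E \<subseteq> E"
  proof
    fix e' assume "e' \<in> (`) f ` E"
    then obtain e where e: "e \<in> E" "e' = f ` e" by auto
    then obtain v w where "e = {v, w}" "v \<in> V" "w \<in> V" using assms(2) all_pairsE by blast
    then show "e' \<in> E" using e assms(3) by (auto simp: graph_endomorphism_def)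
  qed
  have surj: "(`) f ` E = E" using endo_inj_surj[OF finE sub inj] .
  have "{x, y} \<in> E" if xy: "x \<in> V" "y \<in> V" "{f x, f y} \<in> E" for x y
  proof -
    obtain e where e: "e \<in> E" "f ` e = {f x, f y}" using surj xy(3) by (metis imageE)
    then have "f ` e = f ` {x, y}" by simp
    then have "e = {x, y}"
      using e(1) EPow xy inj_on_image_eq_iff[OF assms(4), of e "{x, y}"] by auto
    then show ?thesis using e by simp
  qed
  then show ?thesis using bij assms(3)
    unfolding graph_automorphism_def graph_endomorphism_def by blast
qed

text \<open>On a finite set the powers of f become periodic, and an exponent that is a multiple of
  the period and lies beyond the preperiod gives an idempotent power. Its moved set is nonempty: a
  positive power equal to the identity would make f injective, hence an automorphism.\<close>

lemma proper_retraction: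
  assumes "finite V" "E \<subseteq> all_pairs V" "\<not> homomorphic_core V E"
  obtains r T where "T \<subseteq> V" "T \<noteq> {}" "r \<in> V \<rightarrow> V - T" "\<And>v. v \<in> V - T \<Longrightarrow> r v = v"
    "graph_endomorphism V E r"
proof -
  obtain f where f: "graph_endomorphism V E f" "\<not> graph_automorphism V E f"
    using assms(3) by (auto simp: homomorphic_core_def)
  then have ninj: "\<not> inj_on f V" using bij_graph_endomorphism assms by metis
  have fk: "f ^^ k \<in> V \<rightarrow> V" for k
    using graph_endomorphism_funpow[OF f(1), of k] by (simp add: graph_endomorphism_def)
  \<comment> \<open>Restriction to V makes the powers elements of a finite set of extensional
    functions, so two of them coincide.\<close>
  define g where "g k = restrict (f ^^ k) V" for k
  have "range g \<subseteq> V \<rightarrow>\<^sub>E V" unfolding g_def using fk by (auto simp: Pi_def)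
  then have "finite (range g)" using assms(1) finite_PiE[of V "\<lambda>_. V"] finite_subset by blast
  then have "\<not> inj g" using finite_imageD by auto
  then obtain i j where ij: "i < j" "g i = g j"
    unfolding inj_def by (metis linorder_neqE_nat)
  define d where "d = j - i"
  have d: "d > 0" "j = i + d" using ij by (auto simp: d_def)
  have per1: "(f ^^ (i + d)) v = (f ^^ i) v" if "v \<in> V" for v
    using ij(2) that unfolding g_def d(2)[symmetric] by (metis restrict_apply')
  have per: "(f ^^ (i + l + m * d)) v = (f ^^ (i + l)) v" if "v \<in> V" for v l m
  proof (induction m)
    case (Suc m)
    have "(f ^^ (i + l + Suc m * d)) v = (f ^^ (l + m * d)) ((f ^^ (i + d)) v)"
      by (subst funpow_add[symmetric, THEN fun_cong, unfolded o_def]) (simp add: algebra_simps)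
    also have "\<dots> = (f ^^ (i + l + m * d)) v" unfolding per1[OF that]
      by (subst funpow_add[symmetric, THEN fun_cong, unfolded o_def]) (simp add: algebra_simps)
    finally show ?case using Suc by simp
  qed simp
  \<comment> \<open>A multiple of the period d that is at least the preperiod i, so the powers k and
    2 k agree on V.\<close>
  define k where "k = (i + 1) * d"
  have "i + 1 \<le> k" unfolding k_def using d(1) by (metis mult_le_mono2 nat_mult_1_right Suc_leI One_nat_def)
  then obtain l where kl: "k = i + l" "k > 0" by (metis add_gr_0 le_add_diff_inverse2 le_iff_add add.assoc zero_less_one)
  define r where "r = f ^^ k"
  have idem: "r (r v) = r v" if "v \<in> V" for v
  proof -
    have "r (r v) = (f ^^ (k + k)) v" unfolding r_def by (simp add: funpow_add)
    also have "k + k = i + l + (i + 1) * d" using kl k_def by simp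
    finally show ?thesis using per[OF that, of l "i + 1"] kl r_def by simp
  qed
  have rV: "r \<in> V \<rightarrow> V" unfolding r_def by (rule fk)
  define T where "T = {v \<in> V. r v \<noteq> v}"
  have "T \<noteq> {}"
  proof
    assume "T = {}"
    then have rid: "r v = v" if "v \<in> V" for v using that by (auto simp: T_def)
    obtain k' where k': "k = Suc k'" using kl(2) by (cases k) auto
    have "inj_on f V"
    proof (rule inj_on_inverseI)
      fix v assume "v \<in> V"
      then have "(f ^^ k) v = v" using rid by (simp add: r_def)
      then show "(f ^^ k') (f v) = v" unfolding k' by (simp add: funpow_swap1)
    qed
    then show False using ninj by simp
  qed
  moreover have "r \<in> V \<rightarrow> V - T" using rV idem by (auto simp: T_def)
  moreover have "graph_endomorphism V E r"
    unfolding r_def by (rule graph_endomorphism_funpow[OF f(1)])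
  moreover have "r v = v" if "v \<in> V - T" for v using that by (auto simp: T_def)
  moreover have "T \<subseteq> V" by (auto simp: T_def)
  ultimately show ?thesis by (intro that)
qed

text \<open>Links the two ways of measuring density: the sparsity condition counts edges inside a
  set, whereas the folding argument produces neighbours inside it.\<close>

lemma handshake:
  assumes "finite U" "E \<subseteq> all_pairs V"
  shows "(\<Sum>v\<in>U. card (nbrs E v \<inter> U)) = 2 * card (E \<inter> all_pairs U)"
proof -
  let ?F = "E \<inter> all_pairs U"
  have finF: "finite ?F" using assms(1) by simp
  have "card (nbrs E v \<inter> U) = card {e \<in> ?F. v \<in> e}" if v: "v \<in> U" for v
  proof (rule bij_betw_same_card[of "\<lambda>w. {v, w}"], rule bij_betw_imageI)
    show "inj_on (\<lambda>w. {v, w}) (nbrs E v \<inter> U)" by (auto simp: inj_on_def doubleton_eq_iff)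
    show "(\<lambda>w. {v, w}) ` (nbrs E v \<inter> U) = {e \<in> ?F. v \<in> e}"
    proof (intro equalityI subsetI)
      fix e assume "e \<in> (\<lambda>w. {v, w}) ` (nbrs E v \<inter> U)"
      then obtain w where w: "e = {v, w}" "w \<in> nbrs E v" "w \<in> U" by auto
      then have "w \<noteq> v" using nbrs_subset[OF assms(2)] by auto
      then show "e \<in> {e \<in> ?F. v \<in> e}" using w v by (auto simp: nbrs_def doubleton_in_all_pairs)
    next
      fix e assume e: "e \<in> {e \<in> ?F. v \<in> e}"
      then obtain x y where xy: "e = {x, y}" "x \<in> U" "y \<in> U" using all_pairsE by blast
      then consider "v = x" | "v = y" using e by auto
      then show "e \<in> (\<lambda>w. {v, w}) ` (nbrs E v \<inter> U)"
        using xy e by cases (auto simp: nbrs_def insert_commute)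
    qed
  qed
  then have "(\<Sum>v\<in>U. card (nbrs E v \<inter> U)) = (\<Sum>v\<in>U. card {e \<in> ?F. v \<in> e})" by simp
  also have "\<dots> = (\<Sum>e\<in>?F. 2)"
  proof (rule sum_multicount_gen[OF assms(1) finF], rule ballI)
    fix e assume "e \<in> ?F"
    then have "{v \<in> U. v \<in> e} = e" "card e = 2" by (auto simp: all_pairs_def)
    then show "card {v \<in> U. v \<in> e} = 2" by simp
  qed
  finally show ?thesis by simp
qed

text \<open>The set of vertices that are almost dominated by another vertex, and hence could be moved by a
  retraction that fixes most of their neighbours.\<close>

definition foldable :: "'a set \<Rightarrow> 'a set set \<Rightarrow> real \<Rightarrow> 'a set" where
  "foldable V E d = {v \<in> V. \<exists>u\<in>V. u \<noteq> v \<and> real (card (nbrs E v - nbrs E u)) \<le> d}"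

text \<open>The deterministic properties on which the exclusion of small moved sets rests; they are
  applied with d = n p / 40 and m = n / 1000. The bound d / 4 in \<open>sparse\<close> is the number
  of edges per vertex forced by minimum degree d / 2. The condition 2 \<le> d serves to absorb the
  loss of one foldable neighbour: d - 1 \<ge> d / 2.\<close>

locale expanding_graph =
  fixes V :: "'a set" and E :: "'a set set" and d m :: real
  assumes finV: "finite V" and EV: "E \<subseteq> all_pairs V" and d2: "2 \<le> d" and V2: "2 \<le> card V"
    and fold_indep: "\<And>v w. v \<in> foldable V E d \<Longrightarrow> w \<in> foldable V E d \<Longrightarrow> {v, w} \<notin> E"
    and fold_sep: "\<And>x v w. v \<in> foldable V E d \<Longrightarrow> w \<in> foldable V E d \<Longrightarrow> v \<noteq> w \<Longrightarrow>
      {x, v} \<in> E \<Longrightarrow> {x, w} \<in> E \<Longrightarrow> False"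
    and no_fold: "\<And>u v. u \<in> V \<Longrightarrow> v \<in> V \<Longrightarrow> u \<noteq> v \<Longrightarrow> \<not> nbrs E v \<subseteq> nbrs E u"
    and sparse: "\<And>U. U \<subseteq> V \<Longrightarrow> U \<noteq> {} \<Longrightarrow> real (card U) \<le> m \<Longrightarrow>
      real (card (E \<inter> all_pairs U)) < real (card U) * (d / 4)"
    and no_cut: "\<And>K. K \<subseteq> V \<Longrightarrow> real (card K) > m \<Longrightarrow> real (card (V - K)) > m \<Longrightarrow>
      \<exists>v\<in>K. \<exists>w\<in>V - K. {v, w} \<in> E"
begin

text \<open>By \<open>fold_sep\<close> a vertex has at most one foldable neighbour. Deleting the
  foldable vertices from K thus lowers each remaining internal degree by at most one, to no less
  than d / 2, and by \<open>sparse\<close> a small nonempty set cannot span that many edges.\<close>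

lemma large_if_internal_degrees:
  assumes K: "K \<subseteq> V" "\<not> K \<subseteq> foldable V E d"
    and deg: "\<And>v. v \<in> K - foldable V E d \<Longrightarrow> real (card (nbrs E v \<inter> K)) > d"
  shows "real (card K) > m"
proof (rule ccontr)
  assume small: "\<not> real (card K) > m"
  define U where "U = K - foldable V E d"
  have U: "U \<subseteq> V" "U \<noteq> {}" "finite U" using K finV finite_subset by (auto simp: U_def)
  have finK: "finite K" using K finV finite_subset by auto
  have "card U \<le> card K" using finK by (auto simp: U_def intro: card_mono)
  then have lt: "real (card (E \<inter> all_pairs U)) < real (card U) * (d / 4)"
    using sparse[OF U(1,2)] small by linarith
  have one: "d / 2 \<le> real (card (nbrs E v \<inter> U))" if v: "v \<in> U" for v
  proof -
    have "card (nbrs E v \<inter> foldable V E d) \<le> 1"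
    proof (rule ccontr)
      assume "\<not> ?thesis"
      then have "1 < card (nbrs E v \<inter> foldable V E d)" by simp
      then obtain x y where "x \<in> nbrs E v \<inter> foldable V E d" "y \<in> nbrs E v \<inter> foldable V E d" "x \<noteq> y"
        by (metis One_nat_def card_le_Suc0_iff_eq card_gt_0_iff not_le zero_less_one order.strict_trans)
      then show False using fold_sep[of x y v] by (auto simp: nbrs_def)
    qed
    moreover have "nbrs E v \<inter> K \<subseteq> (nbrs E v \<inter> U) \<union> (nbrs E v \<inter> foldable V E d)"
      by (auto simp: U_def)
    then have "card (nbrs E v \<inter> K) \<le> card ((nbrs E v \<inter> U) \<union> (nbrs E v \<inter> foldable V E d))"
      using finite_nbrs[OF finV EV] by (intro card_mono) auto
    then have "card (nbrs E v \<inter> K) \<le> card (nbrs E v \<inter> U) + card (nbrs E v \<inter> foldable V E d)"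
      using card_Un_le order_trans by blast
    ultimately have "card (nbrs E v \<inter> K) \<le> card (nbrs E v \<inter> U) + 1" by simp
    then have "real (card (nbrs E v \<inter> K)) \<le> real (card (nbrs E v \<inter> U)) + 1" by linarith
    then show ?thesis using deg[of v] v d2 by (simp add: U_def)
  qed
  have "real (card U) * (d / 2) \<le> (\<Sum>v\<in>U. real (card (nbrs E v \<inter> U)))"
    using sum_mono[of U "\<lambda>_. d / 2" "\<lambda>v. real (card (nbrs E v \<inter> U))"] one by simp
  also have "\<dots> = 2 * real (card (E \<inter> all_pairs U))"
    using handshake[OF U(3) EV] by (metis of_nat_sum of_nat_mult of_nat_numeral)
  finally show False using lt by simp
qed

text \<open>If every vertex of T were foldable, T would be independent; all neighbours of some v in
  T would then be fixed and hence adjacent to r v, against \<open>no_fold\<close>. Otherwise, a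
  vertex v of T that is not foldable has more than d neighbours not adjacent to r v, and these all
  lie in T.\<close>

lemma moved_set_large:
  assumes T: "T \<subseteq> V" "T \<noteq> {}" "r \<in> V \<rightarrow> V - T" "\<And>v. v \<in> V - T \<Longrightarrow> r v = v"
    and r: "graph_endomorphism V E r"
  shows "real (card T) > m"
proof (rule large_if_internal_degrees[OF T(1)])
  have out: "w \<in> nbrs E (r v)" if "v \<in> V" "w \<in> nbrs E v" "w \<notin> T" for v w
  proof -
    have "w \<in> V" using that nbrs_subset[OF EV] by auto
    then have "{r v, r w} \<in> E" using that r by (auto simp: nbrs_def graph_endomorphism_def)
    then show ?thesis using T(4) \<open>w \<in> V\<close> that by (simp add: nbrs_def)
  qed
  have rv: "r v \<in> V" "r v \<noteq> v" if "v \<in> T" for v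
  proof -
    have "r v \<in> V - T" using that T(1,3) by (auto simp: Pi_def)
    then show "r v \<in> V" "r v \<noteq> v" using that by auto
  qed
  show "\<not> T \<subseteq> foldable V E d"
  proof
    assume sub: "T \<subseteq> foldable V E d"
    obtain v where v: "v \<in> T" using T by auto
    have "nbrs E v \<subseteq> nbrs E (r v)"
    proof
      fix w assume w: "w \<in> nbrs E v"
      then have "w \<notin> T" using fold_indep[of v w] sub v by (auto simp: nbrs_def)
      then show "w \<in> nbrs E (r v)" using out w v T(1) by auto
    qed
    then show False using no_fold[of "r v" v] rv[OF v] v T(1) by auto
  qed
  fix v assume v: "v \<in> T - foldable V E d"
  then have "real (card (nbrs E v - nbrs E (r v))) > d"
    using rv[of v] T(1) by (force simp: foldable_def)
  moreover have "nbrs E v - nbrs E (r v) \<subseteq> nbrs E v \<inter> T" using out v T(1) by blast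
  then have "card (nbrs E v - nbrs E (r v)) \<le> card (nbrs E v \<inter> T)"
    using finite_nbrs[OF finV EV] by (intro card_mono) auto
  ultimately show "real (card (nbrs E v \<inter> T)) > d" by linarith
qed

text \<open>The argument for moved sets with an arbitrary vertex u in place of r v: the neighbours
  of v that u misses stay in K because all neighbours of v do. Applied to unions of
  components.\<close>

lemma closed_set_large:
  assumes K: "K \<subseteq> V" "K \<noteq> {}" "\<And>v. v \<in> K \<Longrightarrow> nbrs E v \<subseteq> K"
  shows "real (card K) > m"
proof (rule large_if_internal_degrees[OF K(1)])
  have other: "\<exists>u\<in>V. u \<noteq> v" for v
  proof (rule ccontr)
    assume "\<not> ?thesis"
    then have "V \<subseteq> {v}" by auto
    then have "card V \<le> 1" using card_mono[of "{v}" V] by simp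
    then show False using V2 by simp
  qed
  show "\<not> K \<subseteq> foldable V E d"
  proof
    assume sub: "K \<subseteq> foldable V E d"
    obtain v where v: "v \<in> K" using K by auto
    obtain u where u: "u \<in> V" "u \<noteq> v" using other by auto
    then obtain w where "w \<in> nbrs E v" using no_fold[of u v] v K by auto
    then show False using fold_indep[of v w] K(3)[OF v] sub v by (auto simp: nbrs_def)
  qed
  fix v assume v: "v \<in> K - foldable V E d"
  obtain u where u: "u \<in> V" "u \<noteq> v" using other by auto
  then have "real (card (nbrs E v - nbrs E u)) > d" using v K(1) by (force simp: foldable_def)
  moreover have "card (nbrs E v - nbrs E u) \<le> card (nbrs E v \<inter> K)"
    using finite_nbrs[OF finV EV] K(3) v by (intro card_mono) auto
  ultimately show "real (card (nbrs E v \<inter> K)) > d" by linarith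
qed

text \<open>Without crossing edges both sides are closed under taking neighbours, hence both are
  larger than m, and \<open>no_cut\<close> supplies a crossing edge.\<close>

lemma connected:
  assumes K: "K \<subseteq> V" "K \<noteq> {}" "K \<noteq> V"
  shows "\<exists>v\<in>K. \<exists>w\<in>V - K. {v, w} \<in> E"
proof (rule ccontr)
  assume no: "\<not> ?thesis"
  have "nbrs E v \<subseteq> K" if "v \<in> K" for v
    using no that nbrs_subset[OF EV, of v] by (auto simp: nbrs_def)
  then have 1: "real (card K) > m" using closed_set_large K by auto
  have "nbrs E v \<subseteq> V - K" if "v \<in> V - K" for v
  proof
    fix w assume "w \<in> nbrs E v"
    then have "{w, v} \<in> E" "w \<in> V" using nbrs_subset[OF EV, of v] by (auto simp: nbrs_def insert_commute)
    then show "w \<in> V - K" using no that by auto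
  qed
  then have "real (card (V - K)) > m" using closed_set_large[of "V - K"] K by auto
  then show False using no no_cut[OF K(1) 1] by auto
qed

end

section \<open>Retractions moving many vertices\<close>

text \<open>Take a maximal clique K of G inside T. By maximality every vertex of T belongs to K or
  is non-adjacent to a member of K, so the at most q sets attached to the members of K cover T, and
  one of them has at least the average size.\<close>

lemma exists_many_nonneighbours:
  assumes "finite T" "T \<noteq> {}"
    and clique: "\<And>K. K \<subseteq> T \<Longrightarrow> all_pairs K \<subseteq> G \<Longrightarrow> card K \<le> q"
  obtains x where "x \<in> T" "card T \<le> q * card {y \<in> T. y = x \<or> {x, y} \<notin> G}"
proof -
  let ?b = "\<lambda>x. {y \<in> T. y = x \<or> {x, y} \<notin> G}"
  let ?C = "{K. K \<subseteq> T \<and> all_pairs K \<subseteq> G}"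
  have "finite ?C" by (rule finite_subset[of _ "Pow T"]) (use assms in auto)
  moreover have "{} \<in> ?C" by (auto simp: all_pairs_def)
  ultimately have "\<exists>K\<in>?C. \<forall>K'\<in>?C. K \<subseteq> K' \<longrightarrow> K = K'" by (intro finite_has_maximal) auto
  then obtain K where K: "K \<in> ?C" "\<forall>K'\<in>?C. K \<subseteq> K' \<longrightarrow> K = K'" by (rule bexE)
  have finK: "finite K" using K assms finite_subset by auto
  have cover: "T \<subseteq> (\<Union>x\<in>K. ?b x)"
  proof
    fix y assume y: "y \<in> T"
    show "y \<in> (\<Union>x\<in>K. ?b x)"
    proof (rule ccontr)
      assume no: "y \<notin> (\<Union>x\<in>K. ?b x)"
      have "all_pairs (insert y K) \<subseteq> G"
      proof
        fix e assume "e \<in> all_pairs (insert y K)"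
        then obtain a b where ab: "e = {a, b}" "a \<in> insert y K" "b \<in> insert y K" "a \<noteq> b"
          by (rule all_pairsE)
        show "e \<in> G"
        proof (cases "a \<in> K \<and> b \<in> K")
          case True
          then have "e \<in> all_pairs K" using ab by (simp add: doubleton_in_all_pairs)
          then show ?thesis using K by auto
        next
          case False
          then consider "a = y" "b \<in> K" | "b = y" "a \<in> K" using ab by auto
          then show ?thesis using no y ab by cases (auto simp: insert_commute)
        qed
      qed
      then have "insert y K \<in> ?C" using K y by auto
      then have "K = insert y K" using K(2) by blast
      then have "y \<in> K" by blast
      then show False using no y by auto
    qed
  qed
  then have "card T \<le> card (\<Union>x\<in>K. ?b x)"
    using assms(1) finK by (intro card_mono) auto
  also have "\<dots> \<le> (\<Sum>x\<in>K. card (?b x))" by (rule card_UN_le[OF finK])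
  finally have le: "card T \<le> (\<Sum>x\<in>K. card (?b x))" .
  have "K \<noteq> {}" using cover assms(2) by auto
  have "\<exists>x\<in>K. card T \<le> q * card (?b x)"
  proof (rule ccontr)
    assume "\<not> ?thesis"
    then have lt: "q * card (?b x) < card T" if "x \<in> K" for x using that by auto
    have "q * card T \<le> (\<Sum>x\<in>K. q * card (?b x))" using le by (simp flip: sum_distrib_left)
    also have "\<dots> < (\<Sum>x\<in>K. card T)" by (rule sum_strict_mono[OF finK \<open>K \<noteq> {}\<close> lt])
    also have "\<dots> \<le> q * card T" using clique[of K] K(1) by simp
    finally show False by simp
  qed
  then obtain x where "x \<in> K" "card T \<le> q * card (?b x)" by blast
  then show thesis using K(1) by (intro that[of x]) auto
qed

text \<open>Induction removing a vertex x with many non-neighbours. If T has N + 1 elements, the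
  square grows by at most 2 (N + 1), which is at most 2 q times the number of missing pairs at x
  plus one. That extra one, for x itself, is the origin of the summand
  \<open>card T\<close>.\<close>

lemma turan:
  assumes "finite T"
    and clique: "\<And>K. K \<subseteq> T \<Longrightarrow> all_pairs K \<subseteq> G \<Longrightarrow> card K \<le> q"
  shows "(card T)\<^sup>2 \<le> 2 * q * (card (all_pairs T - G) + card T)"
  using assms
proof (induction "card T" arbitrary: T)
  case (Suc N)
  then have "T \<noteq> {}" by auto
  then obtain x where x: "x \<in> T" "card T \<le> q * card {y \<in> T. y = x \<or> {x, y} \<notin> G}"
    using exists_many_nonneighbours[of T G q] Suc.prems by auto
  let ?T' = "T - {x}" and ?B = "{y \<in> T. y \<noteq> x \<and> {x, y} \<notin> G}"
  have N: "card ?T' = N" "card T = Suc N" using Suc x by auto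
  have IH: "N\<^sup>2 \<le> 2 * q * (card (all_pairs ?T' - G) + N)"
  proof -
    have "(card ?T')\<^sup>2 \<le> 2 * q * (card (all_pairs ?T' - G) + card ?T')"
    proof (rule Suc.hyps(1))
      show "card K \<le> q" if "K \<subseteq> ?T'" "all_pairs K \<subseteq> G" for K
        using Suc.prems(2)[of K] that by blast
    qed (use N Suc.prems(1) in auto)
    then show ?thesis by (simp only: N(1))
  qed
  have "{y \<in> T. y = x \<or> {x, y} \<notin> G} = insert x ?B" using x by auto
  then have b: "card {y \<in> T. y = x \<or> {x, y} \<notin> G} = Suc (card ?B)" using Suc.prems(1) by simp
  have "card ((\<lambda>y. {x, y}) ` ?B) = card ?B"
    by (rule card_image) (auto simp: inj_on_def doubleton_eq_iff)
  moreover have "(all_pairs ?T' - G) \<inter> (\<lambda>y. {x, y}) ` ?B = {}" by (auto simp: doubleton_in_all_pairs)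
  ultimately have "card (all_pairs ?T' - G) + card ?B = card ((all_pairs ?T' - G) \<union> (\<lambda>y. {x, y}) ` ?B)"
    using Suc.prems(1) by (subst card_Un_disjoint) auto
  also have "\<dots> \<le> card (all_pairs T - G)"
    using Suc.prems(1) x(1) by (intro card_mono) (auto simp: doubleton_in_all_pairs, auto simp: all_pairs_def)
  finally have M: "card (all_pairs ?T' - G) + card ?B \<le> card (all_pairs T - G)" .
  have "(Suc N)\<^sup>2 \<le> N\<^sup>2 + 2 * Suc N" by (simp add: power2_eq_square)
  also have "\<dots> \<le> 2 * q * (card (all_pairs ?T' - G) + N) + 2 * (q * Suc (card ?B))"
    using IH x(2) b N by simp
  also have "\<dots> = 2 * q * ((card (all_pairs ?T' - G) + card ?B) + Suc N)"
    by (simp add: algebra_simps)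
  also have "\<dots> \<le> 2 * q * (card (all_pairs T - G) + Suc N)" using M by simp
  finally show ?case using N by simp
qed simp

text \<open>A map that is the identity outside \<open>T\<close> and sends the edges \<open>{v, \<pi> v}\<close> of a spanning forest
  into a graph of maximum degree \<open>t\<close> is determined by one of \<open>t\<close> choices at each vertex of \<open>T\<close>.\<close>

definition forest_maps :: "'a set \<Rightarrow> ('a \<Rightarrow> 'a) \<Rightarrow> 'a set set \<Rightarrow> ('a \<Rightarrow> 'a) set" where
  "forest_maps T \<pi> E = {r. (\<forall>v. v \<notin> T \<longrightarrow> r v = v) \<and> (\<forall>v\<in>T. {r (\<pi> v), r v} \<in> E)}"

text \<open>Number the neighbours of each vertex by less than t. Label v by the number of r v among
  the neighbours of r (\<pi> v). Going through T in the order of the rank h, these labels determine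
  r, because r (\<pi> v) is known before r v.\<close>

lemma card_forest_maps:
  fixes h :: "'a \<Rightarrow> nat"
  assumes "finite T" "\<And>v. v \<in> T \<Longrightarrow> h (\<pi> v) < h v"
    and deg: "\<And>a. finite (nbrs E a)" "\<And>a. card (nbrs E a) \<le> t"
  shows "finite (forest_maps T \<pi> E)" "card (forest_maps T \<pi> E) \<le> t ^ card T"
proof -
  have "\<exists>g. inj_on g (nbrs E a) \<and> g ` nbrs E a \<subseteq> {..<t}" for a
  proof -
    obtain g where g: "bij_betw g (nbrs E a) {0..<card (nbrs E a)}"
      using ex_bij_betw_finite_nat deg(1) by blast
    then have "g ` nbrs E a = {0..<card (nbrs E a)}" by (simp add: bij_betw_def)
    also have "\<dots> \<subseteq> {..<t}" using deg(2)[of a] by auto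
    finally show ?thesis using g by (auto simp: bij_betw_def)
  qed
  then obtain g where g: "\<And>a. inj_on (g a) (nbrs E a)" "\<And>a. g a ` nbrs E a \<subseteq> {..<t}" by metis
  define c where "c r = restrict (\<lambda>v. g (r (\<pi> v)) (r v)) T" for r
  have sub: "c ` forest_maps T \<pi> E \<subseteq> T \<rightarrow>\<^sub>E {..<t}"
    using g(2) by (force simp: c_def forest_maps_def nbrs_def)
  have inj: "inj_on c (forest_maps T \<pi> E)"
  proof (rule inj_onI)
    fix r r' assume r: "r \<in> forest_maps T \<pi> E" "r' \<in> forest_maps T \<pi> E" "c r = c r'"
    have "r v = r' v" for v
    proof (induction "h v" arbitrary: v rule: less_induct)
      case less
      show ?case
      proof (cases "v \<in> T")
        case True
        then have eq: "r (\<pi> v) = r' (\<pi> v)" using less assms(2) by auto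
        have "c r v = c r' v" using r by simp
        then have "g (r (\<pi> v)) (r v) = g (r (\<pi> v)) (r' v)" using True eq by (simp add: c_def)
        moreover have "r v \<in> nbrs E (r (\<pi> v))" "r' v \<in> nbrs E (r (\<pi> v))"
          using r True eq by (auto simp: forest_maps_def nbrs_def)
        ultimately show ?thesis using g(1) by (auto dest: inj_onD)
      qed (use r in \<open>auto simp: forest_maps_def\<close>)
    qed
    then show "r = r'" by auto
  qed
  have fin: "finite (T \<rightarrow>\<^sub>E {..<t})" using assms(1) by (auto intro: finite_PiE)
  show "finite (forest_maps T \<pi> E)" using inj_on_finite[OF inj sub fin] .
  have "card (forest_maps T \<pi> E) \<le> card (T \<rightarrow>\<^sub>E {..<t})" by (rule card_inj_on_le[OF inj sub fin])
  then show "card (forest_maps T \<pi> E) \<le> t ^ card T" using assms(1) by (simp add: card_PiE)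
qed

text \<open>The rank h certifies that \<pi> has no cycle, so that following parents leads out of T.
  The identity is required on the whole complement of T, also outside V, so that r is determined by
  its values on T.\<close>

definition forest_retraction :: "'a set \<Rightarrow> 'a set \<Rightarrow> 'a set set \<Rightarrow> bool" where
  "forest_retraction V T E \<longleftrightarrow>
    (\<exists>\<pi> (h :: 'a \<Rightarrow> nat) r. (\<forall>v\<in>T. {v, \<pi> v} \<in> E \<and> h (\<pi> v) < h v) \<and> (\<forall>v. v \<notin> T \<longrightarrow> r v = v) \<and>
      r \<in> T \<rightarrow> V - T \<and> graph_endomorphism V E r)"

text \<open>Fix the edges E1 avoiding T. At most n^(card T) parent functions are possible, n = card
  V, and for each at most t^(card T) maps. A given choice requires the card T forest edges to be
  present and all pairs of T sent to non-edges of E1 to be absent; these are disjoint sets of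
  unexposed pairs, and Turan's bound makes the second one large.\<close>

lemma rexp_forest_retraction:
  fixes V T :: "'a set"
  assumes "finite V" "T \<subseteq> V" "0 \<le> p" "p \<le> 1" "1 \<le> q"
  shows "rexp (all_pairs V) p (\<lambda>E. of_bool (forest_retraction V T E \<and>
      (\<forall>v\<in>V. card (nbrs E v) \<le> t) \<and> (\<forall>K\<subseteq>V. all_pairs K \<subseteq> E \<longrightarrow> card K \<le> q)))
    \<le> (real (card V) * real t * p) ^ card T *
       exp (- p * ((real (card T))\<^sup>2 / (2 * real q) - real (card T)))"
    (is "rexp _ _ (\<lambda>E. of_bool (?Q E)) \<le> ?R")
proof -
  define P1 where "P1 = all_pairs (V - T)"
  define P2 where "P2 = all_pairs V - P1"
  have P: "P1 \<subseteq> all_pairs V" unfolding P1_def all_pairs_def by auto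
  have fin: "finite P1" "finite P2" "finite T" "P1 \<inter> P2 = {}"
    using assms finite_subset by (auto simp: P1_def P2_def)
  have inner: "rexp P2 p (\<lambda>E2. of_bool (?Q (E1 \<union> E2))) \<le> ?R" if E1: "E1 \<subseteq> P1" for E1
  \<comment> \<open>Degree and clique bounds pass to subgraphs, so the event is impossible when E1
    already violates them.\<close>
  proof (cases "(\<forall>v\<in>V. card (nbrs E1 v) \<le> t) \<and> (\<forall>K\<subseteq>V. all_pairs K \<subseteq> E1 \<longrightarrow> card K \<le> q)")
    case False
    have "\<not> ?Q (E1 \<union> E2)" if "E2 \<subseteq> P2" for E2
    proof -
      have sub: "nbrs E1 v \<subseteq> nbrs (E1 \<union> E2) v" for v by (auto simp: nbrs_def)
      have "E1 \<union> E2 \<subseteq> all_pairs V" using E1 that P by (auto simp: P2_def)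
      then have "card (nbrs E1 v) \<le> card (nbrs (E1 \<union> E2) v)" for v
        using finite_nbrs[OF assms(1)] sub by (intro card_mono) auto
      then show ?thesis using False by (meson le_supI1 order_trans)
    qed
    then have "rexp P2 p (\<lambda>E2. of_bool (?Q (E1 \<union> E2))) = rexp P2 p (\<lambda>E2. 0)"
      by (intro rexp_cong) simp
    then show ?thesis using fin assms by simp
  next
    case True
    have E1s: "E1 \<subseteq> all_pairs (V - T)" using E1 by (simp add: P1_def)
    have nb: "nbrs E1 a \<subseteq> V" for a using nbrs_subset[OF E1s] by auto
    have deg: "finite (nbrs E1 a)" "card (nbrs E1 a) \<le> t" for a
    proof -
      show "finite (nbrs E1 a)" by (rule finite_subset[OF nb assms(1)])
      show "card (nbrs E1 a) \<le> t"
      proof (cases "a \<in> V")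
        case False
        then have "nbrs E1 a = {}" using nbrs_commute[of _ E1 a] nb by blast
        then show ?thesis by simp
      qed (use True in auto)
    qed
    define Fs where "Fs = {\<pi> \<in> T \<rightarrow>\<^sub>E V. \<exists>h :: 'a \<Rightarrow> nat. \<forall>v\<in>T. h (\<pi> v) < h v}"
    define I where "I = Sigma Fs (\<lambda>\<pi>. forest_maps T \<pi> E1)"
    define X where "X \<pi> = (\<lambda>v. {v, \<pi> v}) ` T" for \<pi> :: "'a \<Rightarrow> 'a"
    define Y where "Y r = {e \<in> all_pairs T. r ` e \<notin> E1}" for r :: "'a \<Rightarrow> 'a"
    have finF: "finite Fs" "card Fs \<le> card V ^ card T"
    proof -
      have f: "finite (T \<rightarrow>\<^sub>E V)" using fin assms by (intro finite_PiE) auto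
      moreover have s: "Fs \<subseteq> T \<rightarrow>\<^sub>E V" by (auto simp: Fs_def)
      ultimately show "finite Fs" using finite_subset by blast
      have "card Fs \<le> card (T \<rightarrow>\<^sub>E V)" by (rule card_mono[OF f s])
      then show "card Fs \<le> card V ^ card T" using fin by (simp add: card_PiE)
    qed
    have maps: "finite (forest_maps T \<pi> E1)" "card (forest_maps T \<pi> E1) \<le> t ^ card T"
      if "\<pi> \<in> Fs" for \<pi>
      using that card_forest_maps[OF fin(3) _ deg, of _ \<pi>] by (auto simp: Fs_def)
    have finI: "finite I" unfolding I_def using finF maps by auto
    have "card I = (\<Sum>\<pi>\<in>Fs. card (forest_maps T \<pi> E1))"
      unfolding I_def using finF maps by simp
    also have "\<dots> \<le> (\<Sum>\<pi>\<in>Fs. t ^ card T)" by (intro sum_mono maps)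
    also have "\<dots> \<le> card V ^ card T * t ^ card T" using finF by simp
    finally have "real (card I) \<le> real (card V ^ card T * t ^ card T)" by (rule of_nat_mono)
    then have cardI: "real (card I) \<le> (real (card V) * real t) ^ card T"
      by (simp add: power_mult_distrib)
    have "rexp P2 p (\<lambda>E2. of_bool (?Q (E1 \<union> E2)))
      \<le> (\<Sum>i\<in>I. rexp P2 p (\<lambda>E2. of_bool (X (fst i) \<subseteq> E2 \<and> E2 \<inter> Y (snd i) = {})))"
    proof (rule rexp_union_bound[OF finI assms(3,4)])
      fix E2 assume E2: "E2 \<subseteq> P2" and "?Q (E1 \<union> E2)"
      then have "forest_retraction V T (E1 \<union> E2)" by simp
      then obtain \<pi> and h :: "'a \<Rightarrow> nat" and r
        where F: "\<forall>v\<in>T. {v, \<pi> v} \<in> E1 \<union> E2 \<and> h (\<pi> v) < h v" "\<forall>v. v \<notin> T \<longrightarrow> r v = v"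
          and r: "r \<in> T \<rightarrow> V - T" "graph_endomorphism V (E1 \<union> E2) r"
        unfolding forest_retraction_def by (elim exE conjE) (rule that)
      have \<pi>: "{v, \<pi> v} \<in> E1 \<union> E2" "h (\<pi> v) < h v" if "v \<in> T" for v
        using F(1) that by auto
      have E: "E1 \<union> E2 \<subseteq> all_pairs V" using E1 E2 P by (auto simp: P2_def)
      have \<pi>V: "\<pi> v \<in> V" if "v \<in> T" for v
        using \<pi>(1)[OF that] E by (auto simp: doubleton_in_all_pairs)
      have rV: "r v \<in> V - T" if "v \<in> V" for v using r F(2) that by (cases "v \<in> T") auto
      \<comment> \<open>Both images lie in V - T, so the image of an edge is an exposed pair and can
        only be an edge of E1.\<close>
      have edge: "{r v, r w} \<in> E1" if "{v, w} \<in> E1 \<union> E2" for v w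
      proof -
        have vw: "v \<in> V" "w \<in> V" using that E by (auto simp: doubleton_in_all_pairs)
        then have "{r v, r w} \<in> E1 \<union> E2" using that r(2) by (auto simp: graph_endomorphism_def)
        moreover have "r v \<noteq> r w"
          using calculation E by (auto simp: doubleton_in_all_pairs all_pairs_def)
        then have "{r v, r w} \<in> P1" using rV vw by (simp add: P1_def doubleton_in_all_pairs)
        ultimately show ?thesis using E2 by (auto simp: P2_def)
      qed
      let ?\<pi> = "restrict \<pi> T"
      have "?\<pi> \<in> Fs" unfolding Fs_def using \<pi>V \<pi>(2) by auto
      moreover have "r \<in> forest_maps T ?\<pi> E1"
        using F(2) edge \<pi>(1) by (auto simp: forest_maps_def insert_commute)
      ultimately have "(?\<pi>, r) \<in> I" by (simp add: I_def)
      moreover have "X ?\<pi> \<subseteq> E2"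
      proof
        fix e assume "e \<in> X ?\<pi>"
        then obtain v where v: "v \<in> T" "e = {v, \<pi> v}" by (auto simp: X_def)
        then have "e \<notin> P1" by (auto simp: P1_def doubleton_in_all_pairs)
        then show "e \<in> E2" using \<pi>(1)[OF v(1)] v E1 by auto
      qed
      moreover have "E2 \<inter> Y r = {}"
      proof (rule ccontr)
        assume "E2 \<inter> Y r \<noteq> {}"
        then obtain e where e: "e \<in> E2" "e \<in> all_pairs T" "r ` e \<notin> E1" by (auto simp: Y_def)
        then obtain v w where "e = {v, w}" by (auto elim: all_pairsE)
        then show False using edge[of v w] e by auto
      qed
      ultimately show "\<exists>i\<in>I. X (fst i) \<subseteq> E2 \<and> E2 \<inter> Y (snd i) = {}"
        by (intro bexI[of _ "(?\<pi>, r)"]) simp_all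
    qed
    also have "\<dots> \<le> (\<Sum>i\<in>I. p ^ card T * exp (- p * ((real (card T))\<^sup>2 / (2 * real q) - real (card T))))"
    proof (rule sum_mono)
      fix i assume "i \<in> I"
      then obtain \<pi> r where i: "i = (\<pi>, r)" "\<pi> \<in> Fs" "r \<in> forest_maps T \<pi> E1" by (auto simp: I_def)
      then obtain h :: "'a \<Rightarrow> nat" where h: "\<And>v. v \<in> T \<Longrightarrow> h (\<pi> v) < h v" by (auto simp: Fs_def)
      have \<pi>V: "\<pi> v \<in> V" if "v \<in> T" for v using i that by (auto simp: Fs_def)
      have re: "{r (\<pi> v), r v} \<in> E1" if "v \<in> T" for v using i that by (auto simp: forest_maps_def)
      have rV: "r v \<in> V" if "v \<in> T" for v
        using re[OF that] E1s by (auto simp: doubleton_in_all_pairs)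
      \<comment> \<open>Equality of the pairs for distinct v and w would make each of them the
        parent of the other, against the decrease of h.\<close>
      have "inj_on (\<lambda>v. {v, \<pi> v}) T"
      proof (rule inj_onI)
        fix v w assume "v \<in> T" "w \<in> T" "{v, \<pi> v} = {w, \<pi> w}"
        then show "v = w" using h[of v] h[of w] by (auto simp: doubleton_eq_iff)
      qed
      then have cX: "card (X \<pi>) = card T" by (simp add: X_def card_image)
      have XP: "X \<pi> \<subseteq> P2"
      proof
        fix e assume "e \<in> X \<pi>"
        then obtain v where "v \<in> T" "e = {v, \<pi> v}" by (auto simp: X_def)
        moreover then have "v \<noteq> \<pi> v" using h[of v] by auto
        ultimately show "e \<in> P2" using \<pi>V assms(2) by (auto simp: P2_def P1_def doubleton_in_all_pairs)
      qed
      have YP: "Y r \<subseteq> P2"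
      proof
        fix e assume "e \<in> Y r"
        then have e: "e \<in> all_pairs T" by (simp add: Y_def)
        then obtain v w where "e = {v, w}" "v \<in> T" "w \<in> T" "v \<noteq> w" by (rule all_pairsE)
        then show "e \<in> P2" using assms(2) by (auto simp: P2_def P1_def doubleton_in_all_pairs)
      qed
      \<comment> \<open>The forest edges are sent into E1, hence are never among the forbidden
        pairs.\<close>
      have XY: "X \<pi> \<inter> Y r = {}" using re by (auto simp: X_def Y_def insert_commute)
      have "rexp P2 p (\<lambda>E2. of_bool (X (fst i) \<subseteq> E2 \<and> E2 \<inter> Y (snd i) = {}))
        = p ^ card T * (1 - p) ^ card (Y r)"
        using rexp_pattern[OF fin(2) XP YP XY, of p] by (simp add: i cX)
      also have "(1 - p) ^ card (Y r) \<le> exp (- p) ^ card (Y r)"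
        using assms exp_ge_add_one_self[of "- p"] by (intro power_mono) auto
      also have "\<dots> = exp (- p * real (card (Y r)))"
        by (simp add: exp_of_nat_mult[symmetric] mult.commute)
      also have "\<dots> \<le> exp (- p * ((real (card T))\<^sup>2 / (2 * real q) - real (card T)))"
      proof -
        \<comment> \<open>The permitted pairs inside T. On a clique of G the map r is injective, as
          E1 has no loops, and the image is a clique of E1; so cliques of G inherit the bound
          q.\<close>
        define G where "G = {e \<in> all_pairs T. r ` e \<in> E1}"
        have YG: "Y r = all_pairs T - G" by (auto simp: G_def Y_def)
        have "card K \<le> q" if K: "K \<subseteq> T" "all_pairs K \<subseteq> G" for K
        proof -
          have e: "{r x, r y} \<in> E1" if "x \<in> K" "y \<in> K" "x \<noteq> y" for x y
          proof -
            have "{x, y} \<in> G" using K that by (auto simp: doubleton_in_all_pairs)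
            then show ?thesis by (simp add: G_def)
          qed
          then have inj: "inj_on r K"
            by (intro inj_onI) (metis E1s doubleton_in_all_pairs in_mono)
          have "all_pairs (r ` K) \<subseteq> E1"
            using e by (auto elim!: all_pairsE)
          moreover have "r ` K \<subseteq> V" using rV K by auto
          ultimately have "card (r ` K) \<le> q" using True by auto
          then show ?thesis using inj by (simp add: card_image)
        qed
        then have "(card T)\<^sup>2 \<le> 2 * q * (card (Y r) + card T)"
          unfolding YG by (rule turan[OF fin(3)])
        then have "real ((card T)\<^sup>2) \<le> real (2 * q * (card (Y r) + card T))" by (rule of_nat_mono)
        then have "(real (card T))\<^sup>2 \<le> 2 * real q * (real (card (Y r)) + real (card T))" by simp
        then have "(real (card T))\<^sup>2 / (2 * real q) \<le> real (card (Y r)) + real (card T)"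
          using assms(5) by (simp add: divide_simps mult.commute)
        then have "p * ((real (card T))\<^sup>2 / (2 * real q) - real (card T)) \<le> p * real (card (Y r))"
          using assms(3) by (intro mult_left_mono) auto
        then show ?thesis by simp
      qed
      finally show "rexp P2 p (\<lambda>E2. of_bool (X (fst i) \<subseteq> E2 \<and> E2 \<inter> Y (snd i) = {}))
        \<le> p ^ card T * exp (- p * ((real (card T))\<^sup>2 / (2 * real q) - real (card T)))"
        using assms(3) by (simp add: mult_left_mono)
    qed
    also have "\<dots> = real (card I) * (p ^ card T * exp (- p * ((real (card T))\<^sup>2 / (2 * real q) - real (card T))))"
      by simp
    also have "\<dots> \<le> (real (card V) * real t) ^ card T *
        (p ^ card T * exp (- p * ((real (card T))\<^sup>2 / (2 * real q) - real (card T))))"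
      using assms(3) by (intro mult_right_mono[OF cardI]) auto
    also have "\<dots> = ?R" by (simp add: power_mult_distrib mult.assoc)
    finally show ?thesis .
  qed
  have "all_pairs V = P1 \<union> P2" using P by (auto simp: P2_def)
  then have "rexp (all_pairs V) p (\<lambda>E. of_bool (?Q E)) =
      rexp P1 p (\<lambda>E1. rexp P2 p (\<lambda>E2. of_bool (?Q (E1 \<union> E2))))"
    using rexp_Un[OF fin(1,2,4)] by simp
  also have "\<dots> \<le> rexp P1 p (\<lambda>_. ?R)"
    by (rule rexp_mono[OF assms(3,4) inner])
  finally show ?thesis using fin by simp
qed

text \<open>Grow the reached set R from S: connectivity gives an edge leaving R, whose new end w
  gets its old end v as parent and the rank h v + 1. The invariant keeps parents inside R, so that
  the updates at w leave all earlier ranks and parents intact.\<close>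

lemma (in expanding_graph) spanning_forest:
  assumes "S \<subseteq> V" "S \<noteq> {}"
  shows "\<exists>\<pi> (h :: 'a \<Rightarrow> nat). \<forall>v\<in>V - S. {v, \<pi> v} \<in> E \<and> h (\<pi> v) < h v"
proof -
  have "\<exists>\<pi> (h :: 'a \<Rightarrow> nat). \<forall>v\<in>V - S. {v, \<pi> v} \<in> E \<and> h (\<pi> v) < h v"
    if "S \<subseteq> R" "R \<subseteq> V" "\<forall>v\<in>R - S. {v, \<pi> v} \<in> E \<and> \<pi> v \<in> R \<and> (h :: 'a \<Rightarrow> nat) (\<pi> v) < h v"
    for R \<pi> h
    using that
  proof (induction "card (V - R)" arbitrary: R \<pi> h rule: less_induct)
    case less
    show ?case
    proof (cases "R = V")
      case True
      then show ?thesis using less.prems(3) by auto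
    next
      case False
      moreover have "R \<noteq> {}" using assms less.prems by auto
      ultimately obtain v w where vw: "v \<in> R" "w \<in> V - R" "{v, w} \<in> E"
        using connected[of R] less.prems by auto
      have "card (V - insert w R) < card (V - R)"
        using vw finV by (intro psubset_card_mono) auto
      moreover have "\<forall>u\<in>insert w R - S. {u, (\<pi>(w := v)) u} \<in> E \<and> (\<pi>(w := v)) u \<in> insert w R \<and>
          (h(w := Suc (h v))) ((\<pi>(w := v)) u) < (h(w := Suc (h v))) u"
      proof
        fix u assume u: "u \<in> insert w R - S"
        show "{u, (\<pi>(w := v)) u} \<in> E \<and> (\<pi>(w := v)) u \<in> insert w R \<and>
          (h(w := Suc (h v))) ((\<pi>(w := v)) u) < (h(w := Suc (h v))) u"
        proof (cases "u = w")
          case True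
          then show ?thesis using vw by (auto simp: insert_commute)
        next
          case False
          then have "{u, \<pi> u} \<in> E" "\<pi> u \<in> R" "h (\<pi> u) < h u" using less.prems(3) u by auto
          then show ?thesis using False vw by auto
        qed
      qed
      ultimately show ?thesis
        using less.hyps[of "insert w R" "\<pi>(w := v)" "h(w := Suc (h v))"] less.prems vw by blast
    qed
  qed
  from this[of S] show ?thesis using assms by auto
qed

lemma (in expanding_graph) not_core_forest_retraction:
  assumes "\<not> homomorphic_core V E"
  shows "\<exists>T\<subseteq>V. real (card T) > m \<and> forest_retraction V T E"
proof -
  obtain r T where T: "T \<subseteq> V" "T \<noteq> {}" "r \<in> V \<rightarrow> V - T" "\<And>v. v \<in> V - T \<Longrightarrow> r v = v"
    and r: "graph_endomorphism V E r"
    using proper_retraction[OF finV EV assms] by metis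
  have large: "real (card T) > m" by (rule moved_set_large[OF T r])
  have "V - T \<noteq> {}" using T by auto
  then obtain \<pi> and h :: "'a \<Rightarrow> nat" where f: "\<forall>v\<in>V - (V - T). {v, \<pi> v} \<in> E \<and> h (\<pi> v) < h v"
    using spanning_forest[of "V - T"] by blast
  have "V - (V - T) = T" using T by auto
  then have f: "\<forall>v\<in>T. {v, \<pi> v} \<in> E \<and> h (\<pi> v) < h v" using f by simp
  \<comment> \<open>An endomorphism is arbitrary outside V; resetting it to the identity there makes
    it determined by its values on T.\<close>
  define r' where "r' v = (if v \<in> V then r v else v)" for v
  have "graph_endomorphism V E r'"
    using r by (auto simp: graph_endomorphism_def r'_def Pi_iff)
  moreover have "\<forall>v. v \<notin> T \<longrightarrow> r' v = v" using T(4) by (auto simp: r'_def)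
  moreover have "r' \<in> T \<rightarrow> V - T" using T(1,3) by (auto simp: r'_def Pi_iff)
  ultimately have "forest_retraction V T E" unfolding forest_retraction_def using f by blast
  then show ?thesis using T(1) large by blast
qed

text \<open>There are at most 2^(card V) sets T. The bound for one T is made uniform: the base of
  the power is at least one, so its exponent may be raised to \<open>card V\<close>, and the
  exponential uses m < card T \<le> card V.\<close>

lemma rexp_some_forest_retraction:
  fixes V :: "'a set"
  assumes "finite V" "0 \<le> p" "p \<le> 1" "1 \<le> q" "1 \<le> real (card V) * real t * p" "0 \<le> m"
  shows "rexp (all_pairs V) p (\<lambda>E. of_bool ((\<exists>T\<subseteq>V. real (card T) > m \<and> forest_retraction V T E) \<and>
      (\<forall>v\<in>V. card (nbrs E v) \<le> t) \<and> (\<forall>K\<subseteq>V. all_pairs K \<subseteq> E \<longrightarrow> card K \<le> q)))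
    \<le> 2 ^ card V * ((real (card V) * real t * p) ^ card V *
       exp (p * real (card V) - p * m\<^sup>2 / (2 * real q)))"
    (is "rexp _ _ (\<lambda>E. of_bool (?Q E)) \<le> _ * ?R")
proof -
  let ?P = "\<lambda>T E. forest_retraction V T E \<and>
      (\<forall>v\<in>V. card (nbrs E v) \<le> t) \<and> (\<forall>K\<subseteq>V. all_pairs K \<subseteq> E \<longrightarrow> card K \<le> q)"
  let ?I = "{T. T \<subseteq> V \<and> real (card T) > m}"
  have sub: "?I \<subseteq> Pow V" by auto
  have finI: "finite ?I" using assms(1) finite_subset[OF sub] by simp
  have "rexp (all_pairs V) p (\<lambda>E. of_bool (?Q E)) \<le>
      (\<Sum>T\<in>?I. rexp (all_pairs V) p (\<lambda>E. of_bool (?P T E)))"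
    by (rule rexp_union_bound[OF finI assms(2,3)]) blast
  also have "\<dots> \<le> (\<Sum>T\<in>?I. ?R)"
  proof (rule sum_mono)
    fix T assume T: "T \<in> ?I"
    then have le: "card T \<le> card V" using assms(1) by (auto intro: card_mono)
    have "m\<^sup>2 \<le> (real (card T))\<^sup>2" using T assms(6) by (intro power_mono) auto
    then have "m\<^sup>2 / (2 * real q) - real (card V) \<le> (real (card T))\<^sup>2 / (2 * real q) - real (card T)"
      using le by (intro diff_mono divide_right_mono) auto
    then have "p * (m\<^sup>2 / (2 * real q) - real (card V)) \<le> p * ((real (card T))\<^sup>2 / (2 * real q) - real (card T))"
      using assms(2) by (rule mult_left_mono)
    then have 1: "exp (- p * ((real (card T))\<^sup>2 / (2 * real q) - real (card T)))
        \<le> exp (p * real (card V) - p * m\<^sup>2 / (2 * real q))"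
      by (simp add: algebra_simps)
    have 2: "(real (card V) * real t * p) ^ card T \<le> (real (card V) * real t * p) ^ card V"
      by (rule power_increasing[OF le assms(5)])
    have "rexp (all_pairs V) p (\<lambda>E. of_bool (?P T E)) \<le> (real (card V) * real t * p) ^ card T *
       exp (- p * ((real (card T))\<^sup>2 / (2 * real q) - real (card T)))"
      using T by (intro rexp_forest_retraction[OF assms(1) _ assms(2-4)]) auto
    also have "\<dots> \<le> ?R" using assms(5) by (intro mult_mono[OF 2 1]) auto
    finally show "rexp (all_pairs V) p (\<lambda>E. of_bool (?P T E)) \<le> ?R" .
  qed
  also have "\<dots> = real (card ?I) * ?R" by simp
  also have "\<dots> \<le> 2 ^ card V * ?R"
  proof (rule mult_right_mono)
    have "card ?I \<le> card (Pow V)" using assms(1) by (intro card_mono[OF _ sub]) auto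
    then show "real (card ?I) \<le> 2 ^ card V" using assms(1)
      by (simp add: card_Pow)
    have "0 \<le> real (card V) * real t * p" using assms(5) by simp
    then show "0 \<le> ?R" by simp
  qed
  finally show ?thesis .
qed

section \<open>First moment bounds for degrees, cliques and cuts\<close>

lemma rexp_card_ge:
  assumes "finite A" "B \<subseteq> A" "0 \<le> p" "p \<le> 1"
  shows "rexp A p (\<lambda>E. of_bool (j \<le> card (E \<inter> B))) \<le> real (card B choose j) * p ^ j"
proof -
  let ?I = "{X. X \<subseteq> B \<and> card X = j}"
  have finB: "finite B" using assms finite_subset by auto
  have finI: "finite ?I" by (rule finite_subset[of _ "Pow B"]) (use finB in auto)
  have "rexp A p (\<lambda>E. of_bool (j \<le> card (E \<inter> B))) \<le> (\<Sum>X\<in>?I. rexp A p (\<lambda>E. of_bool (X \<subseteq> E)))"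
  proof (rule rexp_union_bound[OF finI assms(3,4)])
    fix E assume "j \<le> card (E \<inter> B)"
    then obtain X where "X \<subseteq> E \<inter> B" "card X = j" by (metis obtain_subset_with_card_n)
    then show "\<exists>X\<in>?I. X \<subseteq> E" by auto
  qed
  also have "\<dots> = (\<Sum>X\<in>?I. p ^ j)"
    using assms by (intro sum.cong) (auto simp: rexp_contains)
  finally show ?thesis using n_subsets[OF finB, of j] by simp
qed

text \<open>k^k / k! is a single term of the series of exp k. This weak form of Stirling's formula
  is all that the binomial estimates use.\<close>

lemma self_power_le_exp_fact: "real k ^ k \<le> exp (real k) * fact k"
proof -
  have "(\<Sum>i\<in>{k}. real k ^ i /\<^sub>R fact i) \<le> (\<Sum>i. real k ^ i /\<^sub>R fact i)"
    by (intro sum_le_suminf summable_exp_generic) auto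
  then have "real k ^ k / fact k \<le> exp (real k)" by (simp add: exp_def divide_inverse mult.commute)
  then show ?thesis by (simp add: divide_simps)
qed

lemma binomial_le_exp_power:
  assumes "k > 0"
  shows "real (n choose k) \<le> (exp 1 * real n / real k) ^ k"
proof -
  have "real (n choose k) * fact k \<le> real n ^ k"
    using binomial_fact_pow[of n k] by (metis of_nat_le_iff of_nat_mult of_nat_power of_nat_fact)
  then have "real (n choose k) * real k ^ k \<le> real (n choose k) * (exp (real k) * fact k)"
    by (intro mult_left_mono self_power_le_exp_fact) auto
  also have "\<dots> \<le> exp (real k) * real n ^ k"
    using \<open>real (n choose k) * fact k \<le> real n ^ k\<close> by (simp add: mult_ac mult_left_mono)
  also have "exp (real k) = exp 1 ^ k" by (simp add: exp_of_nat_mult[symmetric])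
  finally show ?thesis using assms by (simp add: power_divide power_mult_distrib divide_simps)
qed

lemma binomial_power_le:
  assumes "k > 0" "0 \<le> p"
  shows "real (n choose k) * p ^ k \<le> (exp 1 * real n * p / real k) ^ k"
proof -
  have "real (n choose k) * p ^ k \<le> (exp 1 * real n / real k) ^ k * p ^ k"
    using assms by (intro mult_right_mono binomial_le_exp_power) auto
  then show ?thesis by (simp add: power_mult_distrib[symmetric] mult.commute mult.left_commute)
qed

text \<open>The potential edges from v to W. Disjoint stars are the sets of coordinates to which
  independence is applied.\<close>

definition star :: "'a \<Rightarrow> 'a set \<Rightarrow> 'a set set" where
  "star v W = (\<lambda>w. {v, w}) ` W"

lemma star_inter: "E \<inter> star v W = star v (nbrs E v \<inter> W)"
  by (auto simp: star_def nbrs_def)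

lemma inj_doubleton: "inj_on (\<lambda>w. {v, w}) W"
  by (auto simp: inj_on_def doubleton_eq_iff)

lemma card_star [simp]: "card (star v W) = card W"
  unfolding star_def by (rule card_image[OF inj_doubleton])

lemma star_subset_all_pairs: "v \<in> V \<Longrightarrow> W \<subseteq> V - {v} \<Longrightarrow> star v W \<subseteq> all_pairs V"
  by (auto simp: star_def doubleton_in_all_pairs)

lemma card_nbrs_eq: "E \<subseteq> all_pairs V \<Longrightarrow> card (nbrs E v) = card (E \<inter> star v (V - {v}))"
  using nbrs_subset[of E V v] by (simp add: star_inter Int_absorb2)

lemma rexp_max_degree:
  assumes "finite V" "0 \<le> p" "p \<le> 1" "0 < t"
  shows "rexp (all_pairs V) p (\<lambda>E. of_bool (\<exists>v\<in>V. t \<le> card (nbrs E v)))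
    \<le> real (card V) * (exp 1 * (real (card V) * p) / real t) ^ t"
proof -
  have "rexp (all_pairs V) p (\<lambda>E. of_bool (\<exists>v\<in>V. t \<le> card (nbrs E v)))
     \<le> (\<Sum>v\<in>V. rexp (all_pairs V) p (\<lambda>E. of_bool (t \<le> card (E \<inter> star v (V - {v})))))"
    by (rule rexp_union_bound[OF assms(1-3)]) (metis card_nbrs_eq)
  also have "\<dots> \<le> (\<Sum>v\<in>V. (exp 1 * (real (card V) * p) / real t) ^ t)"
  proof (rule sum_mono)
    fix v assume v: "v \<in> V"
    have "rexp (all_pairs V) p (\<lambda>E. of_bool (t \<le> card (E \<inter> star v (V - {v}))))
       \<le> real (card (star v (V - {v})) choose t) * p ^ t"
      using assms v by (intro rexp_card_ge star_subset_all_pairs) auto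
    also have "\<dots> \<le> (exp 1 * real (card (star v (V - {v}))) * p / real t) ^ t"
      using assms by (intro binomial_power_le) auto
    also have "\<dots> \<le> (exp 1 * (real (card V) * p) / real t) ^ t"
      using assms v by (intro power_mono divide_right_mono)
        (auto simp: mult.assoc intro!: mult_left_mono mult_right_mono)
    finally show "rexp (all_pairs V) p (\<lambda>E. of_bool (t \<le> card (E \<inter> star v (V - {v}))))
       \<le> (exp 1 * (real (card V) * p) / real t) ^ t" .
  qed
  finally show ?thesis by simp
qed

lemma card_all_pairs: "finite K \<Longrightarrow> card (all_pairs K) = card K choose 2"
  unfolding all_pairs_def by (rule n_subsets)

lemma all_pairs_mono: "K \<subseteq> V \<Longrightarrow> all_pairs K \<subseteq> all_pairs V"
  by (auto simp: all_pairs_def)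

lemma rexp_clique:
  assumes "finite V" "0 \<le> p" "p \<le> 1"
  shows "rexp (all_pairs V) p (\<lambda>E. of_bool (\<exists>K\<subseteq>V. all_pairs K \<subseteq> E \<and> q \<le> card K))
    \<le> real (card V) ^ q * p ^ (q choose 2)"
proof -
  let ?I = "{K. K \<subseteq> V \<and> card K = q}"
  have finI: "finite ?I" by (rule finite_subset[of _ "Pow V"]) (use assms in auto)
  have "rexp (all_pairs V) p (\<lambda>E. of_bool (\<exists>K\<subseteq>V. all_pairs K \<subseteq> E \<and> q \<le> card K))
     \<le> (\<Sum>K\<in>?I. rexp (all_pairs V) p (\<lambda>E. of_bool (all_pairs K \<subseteq> E)))"
  proof (rule rexp_union_bound[OF finI assms(2,3)])
    fix E assume "\<exists>K\<subseteq>V. all_pairs K \<subseteq> E \<and> q \<le> card K"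
    then obtain K where K: "K \<subseteq> V" "all_pairs K \<subseteq> E" "q \<le> card K" by blast
    then obtain K' where "K' \<subseteq> K" "card K' = q" by (metis obtain_subset_with_card_n)
    then show "\<exists>K\<in>?I. all_pairs K \<subseteq> E" using K all_pairs_mono[of K' K] by blast
  qed
  also have "\<dots> = (\<Sum>K\<in>?I. p ^ (q choose 2))"
  proof (rule sum.cong[OF refl])
    fix K assume K: "K \<in> ?I"
    then have "finite K" using assms(1) finite_subset by auto
    then show "rexp (all_pairs V) p (\<lambda>E. of_bool (all_pairs K \<subseteq> E)) = p ^ (q choose 2)"
      using K assms rexp_contains[of "all_pairs V" "all_pairs K" p] all_pairs_mono[of K V]
      by (simp add: card_all_pairs)
  qed
  also have "\<dots> = real (card V choose q) * p ^ (q choose 2)"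
    using n_subsets[OF assms(1), of q] by simp
  also have "\<dots> \<le> real (card V) ^ q * p ^ (q choose 2)"
  proof (rule mult_right_mono)
    have "(card V choose q) \<le> card V ^ q"
      by (cases "q \<le> card V") (auto simp: binomial_le_pow binomial_eq_0)
    then show "real (card V choose q) \<le> real (card V) ^ q"
      by (metis of_nat_le_iff of_nat_power)
  qed (use assms in auto)
  finally show ?thesis .
qed

lemma rexp_cut:
  assumes "finite V" "0 \<le> p" "p \<le> 1" "0 \<le> m"
  shows "rexp (all_pairs V) p (\<lambda>E. of_bool (\<exists>K\<subseteq>V. real (card K) > m \<and> real (card (V - K)) > m \<and>
      (\<forall>v\<in>K. \<forall>w\<in>V - K. {v, w} \<notin> E)))
    \<le> 2 ^ card V * exp (- p * (m * real (card V) / 2))"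
proof -
  let ?I = "{K. K \<subseteq> V \<and> real (card K) > m \<and> real (card (V - K)) > m}"
  define C where "C K = (\<lambda>(v, w). {v, w}) ` (K \<times> (V - K))" for K
  have sub: "?I \<subseteq> Pow V" by auto
  have finI: "finite ?I" using assms(1) finite_subset[OF sub] by simp
  have "rexp (all_pairs V) p (\<lambda>E. of_bool (\<exists>K\<subseteq>V. real (card K) > m \<and> real (card (V - K)) > m \<and>
      (\<forall>v\<in>K. \<forall>w\<in>V - K. {v, w} \<notin> E))) \<le>
      (\<Sum>K\<in>?I. rexp (all_pairs V) p (\<lambda>E. of_bool ({} \<subseteq> E \<and> E \<inter> C K = {})))"
  proof (rule rexp_union_bound[OF finI assms(2,3)])
    fix E assume "\<exists>K\<subseteq>V. real (card K) > m \<and> real (card (V - K)) > m \<and>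
      (\<forall>v\<in>K. \<forall>w\<in>V - K. {v, w} \<notin> E)"
    then obtain K where K: "K \<in> ?I" "\<And>v w. v \<in> K \<Longrightarrow> w \<in> V - K \<Longrightarrow> {v, w} \<notin> E" by blast
    then have "E \<inter> C K = {}" unfolding C_def by auto
    then show "\<exists>K\<in>?I. {} \<subseteq> E \<and> E \<inter> C K = {}" using K(1) by blast
  qed
  also have "\<dots> \<le> (\<Sum>K\<in>?I. exp (- p * (m * real (card V) / 2)))"
  proof (rule sum_mono)
    fix K assume K: "K \<in> ?I"
    then have finK: "finite K" using assms(1) finite_subset by auto
    have "inj_on (\<lambda>(v, w). {v, w}) (K \<times> (V - K))"
      by (auto simp: inj_on_def doubleton_eq_iff)
    then have cC: "card (C K) = card K * card (V - K)" by (simp add: C_def card_image card_cartesian_product)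
    have "C K \<subseteq> all_pairs V" using K by (auto simp: C_def doubleton_in_all_pairs)
    then have "rexp (all_pairs V) p (\<lambda>E. of_bool ({} \<subseteq> E \<and> E \<inter> C K = {})) = (1 - p) ^ card (C K)"
      using rexp_pattern[of "all_pairs V" "{}" "C K" p] assms(1) by simp
    also have "\<dots> \<le> exp (- p) ^ card (C K)"
      using assms exp_ge_add_one_self[of "- p"] by (intro power_mono) auto
    also have "\<dots> = exp (- p * (real (card K) * real (card (V - K))))"
      by (simp add: cC exp_of_nat_mult[symmetric] mult.commute)
    also have "\<dots> \<le> exp (- p * (m * real (card V) / 2))"
    proof -
      let ?a = "real (card K)" and ?b = "real (card (V - K))"
      have ab: "?a + ?b = real (card V)"
        using K assms(1) finK by (simp add: card_Diff_subset card_mono of_nat_diff)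
      \<comment> \<open>The larger side has at least half of the vertices and the smaller one more
        than m.\<close>
      have "m * (?a + ?b) / 2 \<le> ?a * ?b"
      proof (cases "?a \<le> ?b")
        case True
        have "m * (?a + ?b) \<le> m * (2 * ?b)" using True assms(4) by (intro mult_left_mono) auto
        then have "m * (?a + ?b) / 2 \<le> m * ?b" by simp
        also have "\<dots> \<le> ?a * ?b" using K by (intro mult_right_mono) auto
        finally show ?thesis .
      next
        case False
        have "m * (?a + ?b) \<le> m * (2 * ?a)" using False assms(4) by (intro mult_left_mono) auto
        then have "m * (?a + ?b) / 2 \<le> m * ?a" by simp
        also have "\<dots> \<le> ?b * ?a" using K by (intro mult_right_mono) auto
        finally show ?thesis by (simp add: mult.commute)
      qed
      then have "p * (m * real (card V) / 2) \<le> p * (?a * ?b)"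
        unfolding ab using assms(2) by (rule mult_left_mono)
      then show ?thesis by simp
    qed
    finally show "rexp (all_pairs V) p (\<lambda>E. of_bool ({} \<subseteq> E \<and> E \<inter> C K = {}))
      \<le> exp (- p * (m * real (card V) / 2))" .
  qed
  also have "\<dots> = real (card ?I) * exp (- p * (m * real (card V) / 2))" by simp
  also have "\<dots> \<le> 2 ^ card V * exp (- p * (m * real (card V) / 2))"
  proof (rule mult_right_mono)
    have "card ?I \<le> card (Pow V)" using assms(1) by (intro card_mono[OF _ sub]) auto
    then show "real (card ?I) \<le> 2 ^ card V" using assms(1)
      by (simp add: card_Pow)
  qed simp
  finally show ?thesis .
qed

section \<open>Sparsity and foldable vertices\<close>

lemma sum_power_le_twice:
  fixes x :: real
  assumes "0 \<le> x" "x \<le> 1 / 2"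
  shows "(\<Sum>k = 1..N. x ^ k) \<le> 2 * x"
proof -
  have "(1 - x) * (\<Sum>k<N. x ^ k) = 1 - x ^ N" by (rule one_diff_power_eq[symmetric])
  moreover have "(1 / 2) * (\<Sum>k<N. x ^ k) \<le> (1 - x) * (\<Sum>k<N. x ^ k)"
    using assms by (intro mult_right_mono sum_nonneg) auto
  moreover have "0 \<le> x ^ N" using assms by simp
  ultimately have "(\<Sum>k<N. x ^ k) \<le> 2" by linarith
  then have "x * (\<Sum>k<N. x ^ k) \<le> x * 2" using assms by (intro mult_left_mono) auto
  moreover have "(\<Sum>k = 1..N. x ^ k) = x * (\<Sum>k<N. x ^ k)"
    unfolding sum_distrib_left by (rule sum.reindex_bij_witness[of _ Suc "\<lambda>k. k - 1"])
      (auto simp flip: power_Suc)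
  ultimately show ?thesis by simp
qed

text \<open>The factor (e n / k)^k for the choice of the set is (80 e^2 / y)^k, and the density
  requirement contributes y^(k \<delta>). One power of y per vertex compensates the choice; since y
  \<le> 1 / e, the remaining \<delta> - 1 powers give exp (1 - \<delta>).\<close>

lemma dense_set_term:
  fixes n k j :: nat and p \<delta> :: real
  assumes "0 < k" "1000 * real k \<le> real n" "0 \<le> p" "\<delta> = real n * p / 160" "1 \<le> \<delta>"
    and j: "real k * \<delta> \<le> real j"
  shows "real (n choose k) * (real ((k choose 2) choose j) * p ^ j) \<le> (80 * exp (3 - \<delta>)) ^ k"
proof -
  \<comment> \<open>This is e (k^2 / 2) p / (k \<delta>), that is, e times the bound k^2 p / 2 on
    the expected number of edges divided by the required number k \<delta>, after inserting \<delta>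
    = n p / 160.\<close>
  define y where "y = 80 * exp 1 * real k / real n"
  have n0: "real n > 0" using assms by linarith
  have p0: "p > 0" using assms n0 by (cases "p = 0") auto
  have y0: "0 < y" using assms n0 by (simp add: y_def)
  \<comment> \<open>From 80 e^2 \<le> 1000 follows y \<le> 1 / e for sets of at most n / 1000
    vertices; this is the source of the value of m.\<close>
  have "exp 1 * exp (1::real) \<le> 272 / 100 * (272 / 100)"
    using e_less_272 by (intro mult_mono) auto
  then have "80 * exp 1 * exp (1::real) \<le> 1000" by simp
  then have "80 * exp (1::real) \<le> 1000 * exp (- 1)" by (simp add: exp_minus field_simps)
  then have "80 * exp 1 * real k \<le> 1000 * exp (- 1) * real k" by (intro mult_right_mono) auto
  also have "\<dots> = exp (- 1) * (1000 * real k)" by simp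
  also have "\<dots> \<le> exp (- 1) * real n" using assms(2) by (intro mult_left_mono) auto
  finally have y1: "y \<le> exp (- 1)" using n0 by (simp add: y_def divide_simps)
  then have y1': "y \<le> 1" by (rule order_trans) simp
  have j0: "real j > 0" 
  proof -
    have "0 < real k * \<delta>" using assms(1,5) by simp
    then show ?thesis using j by linarith
  qed
  have N: "real (k choose 2) \<le> real k * real k / 2"
  proof -
    have "(k choose 2) * 2 \<le> k * k" unfolding choose_two by (cases k) auto
    then have "real ((k choose 2) * 2) \<le> real (k * k)" by (rule of_nat_mono)
    then show ?thesis by simp
  qed
  have "real ((k choose 2) choose j) * p ^ j \<le> (exp 1 * real (k choose 2) * p / real j) ^ j"
    using j0 assms(3) by (intro binomial_power_le) auto
  also have "\<dots> \<le> y ^ j"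
  proof (rule power_mono)
    have "exp 1 * real (k choose 2) * p / real j \<le> exp 1 * (real k * real k / 2) * p / (real k * \<delta>)"
      using N j assms(1,3,5) by (intro frac_le mult_right_mono mult_left_mono) auto
    also have "\<dots> = y" using assms(1) n0 p0 unfolding assms(4) by (simp add: y_def field_simps)
    finally show "exp 1 * real (k choose 2) * p / real j \<le> y" .
  qed (use assms in auto)
  also have "\<dots> = y powr real j" using y0 by (simp add: powr_realpow)
  also have "\<dots> \<le> y powr (real k * \<delta>)" using j y0 y1' by (intro powr_mono') auto
  finally have 1: "real ((k choose 2) choose j) * p ^ j \<le> y powr (real k * \<delta>)" .
  have "real (n choose k) \<le> (exp 1 * real n / real k) ^ k" using assms(1) by (rule binomial_le_exp_power)
  also have "exp 1 * real n / real k = 80 * exp 2 / y"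
  proof -
    have "exp (2::real) = exp 1 * exp 1" by (simp flip: exp_add)
    then show ?thesis using assms(1) n0 by (simp add: y_def field_simps)
  qed
  finally have 2: "real (n choose k) \<le> (80 * exp 2 / y) ^ k" .
  have "real (n choose k) * (real ((k choose 2) choose j) * p ^ j)
      \<le> (80 * exp 2 / y) ^ k * y powr (real k * \<delta>)"
    using 1 2 y0 assms(3) by (intro mult_mono) auto
  also have "\<dots> = (80 * exp 2 * y powr (\<delta> - 1)) ^ k"
  proof -
    have "y powr (real k * \<delta>) = (y powr \<delta>) ^ k"
      by (metis mult.commute powr_powr powr_realpow powr_gt_zero y0 less_irrefl)
    moreover have "y powr (\<delta> - 1) = y powr \<delta> / y" using y0 by (simp add: powr_diff)
    ultimately show ?thesis by (simp add: power_mult_distrib power_divide)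
  qed
  also have "\<dots> \<le> (80 * exp 2 * exp (- 1) powr (\<delta> - 1)) ^ k"
    using y0 y1 assms(5) by (intro power_mono mult_left_mono powr_mono2) auto
  also have "80 * exp 2 * exp (- 1) powr (\<delta> - 1) = 80 * exp (3 - \<delta>)"
    by (simp add: powr_def flip: exp_add)
  finally show ?thesis .
qed

text \<open>Union bound over the sizes k and the sets of size k. The terms are dominated by a
  geometric series of ratio at most 1 / 2, so the sum is at most twice the bound for k = 1.\<close>

lemma rexp_dense_set:
  fixes V :: "'a set"
  assumes "finite V" "0 \<le> p" "p \<le> 1" "1000 * m \<le> real (card V)"
    and \<delta>: "\<delta> = real (card V) * p / 160" "80 * exp (3 - \<delta>) \<le> 1 / 2"
  shows "rexp (all_pairs V) p (\<lambda>E. of_bool (\<exists>U\<subseteq>V. U \<noteq> {} \<and> real (card U) \<le> m \<and>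
      real (card U) * \<delta> \<le> real (card (E \<inter> all_pairs U)))) \<le> 160 * exp (3 - \<delta>)"
proof -
  have \<delta>1: "1 \<le> \<delta>"
  proof (rule ccontr)
    assume "\<not> ?thesis"
    then have "1 \<le> exp (3 - \<delta>)" by simp
    then show False using \<delta>(2) by linarith
  qed
  define M where "M = nat \<lfloor>m\<rfloor>"
  define Is where "Is k = {U. U \<subseteq> V \<and> card U = k}" for k
  define I where "I = Sigma {1..M} Is"
  have finIs: "finite (Is k)" for k
    unfolding Is_def by (rule finite_subset[of _ "Pow V"]) (use assms in auto)
  have finI: "finite I" unfolding I_def using finIs by auto
  define j where "j k = nat \<lceil>real k * \<delta>\<rceil>" for k
  have "rexp (all_pairs V) p (\<lambda>E. of_bool (\<exists>U\<subseteq>V. U \<noteq> {} \<and> real (card U) \<le> m \<and>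
      real (card U) * \<delta> \<le> real (card (E \<inter> all_pairs U))))
    \<le> (\<Sum>i\<in>I. rexp (all_pairs V) p (\<lambda>E. of_bool (j (fst i) \<le> card (E \<inter> all_pairs (snd i)))))"
  proof (rule rexp_union_bound[OF finI assms(2,3)])
    fix E assume "\<exists>U\<subseteq>V. U \<noteq> {} \<and> real (card U) \<le> m \<and>
      real (card U) * \<delta> \<le> real (card (E \<inter> all_pairs U))"
    then obtain U where U: "U \<subseteq> V" "U \<noteq> {}" "real (card U) \<le> m"
      "real (card U) * \<delta> \<le> real (card (E \<inter> all_pairs U))" by blast
    have "finite U" using U assms(1) finite_subset by auto
    then have "1 \<le> card U" using U(2) by (simp add: Suc_leI card_gt_0_iff)
    moreover have "card U \<le> M" unfolding M_def using U(3) by linarith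
    ultimately have "(card U, U) \<in> I" using U(1) by (simp add: I_def Is_def)
    moreover have "j (card U) \<le> card (E \<inter> all_pairs U)" unfolding j_def using U(4) by linarith
    ultimately show "\<exists>i\<in>I. j (fst i) \<le> card (E \<inter> all_pairs (snd i))" by force
  qed
  also have "\<dots> = (\<Sum>k\<in>{1..M}. \<Sum>U\<in>Is k. rexp (all_pairs V) p (\<lambda>E. of_bool (j k \<le> card (E \<inter> all_pairs U))))"
    unfolding I_def using finIs by (subst sum.Sigma) (auto simp: case_prod_unfold)
  also have "\<dots> \<le> (\<Sum>k\<in>{1..M}. (80 * exp (3 - \<delta>)) ^ k)"
  proof (rule sum_mono)
    fix k assume k: "k \<in> {1..M}"
    then have "int k \<le> \<lfloor>m\<rfloor>" unfolding M_def by (cases "\<lfloor>m\<rfloor> \<ge> 0") auto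
    then have "real k \<le> m" by (simp add: le_floor_iff)
    then have k1000: "1000 * real k \<le> real (card V)" using assms(4) by linarith
    have "(\<Sum>U\<in>Is k. rexp (all_pairs V) p (\<lambda>E. of_bool (j k \<le> card (E \<inter> all_pairs U))))
      \<le> (\<Sum>U\<in>Is k. real ((k choose 2) choose j k) * p ^ j k)"
    proof (rule sum_mono)
      fix U assume U: "U \<in> Is k"
      then have "finite U" using assms(1) finite_subset by (auto simp: Is_def)
      then show "rexp (all_pairs V) p (\<lambda>E. of_bool (j k \<le> card (E \<inter> all_pairs U)))
        \<le> real ((k choose 2) choose j k) * p ^ j k"
        using rexp_card_ge[of "all_pairs V" "all_pairs U" p "j k"] assms U
        by (simp add: card_all_pairs Is_def all_pairs_mono)
    qed
    also have "\<dots> = real (card V choose k) * (real ((k choose 2) choose j k) * p ^ j k)"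
      using n_subsets[OF assms(1), of k] by (simp add: Is_def)
    also have "\<dots> \<le> (80 * exp (3 - \<delta>)) ^ k"
      using k k1000 assms(2) \<delta>(1) \<delta>1 by (intro dense_set_term) (auto simp: j_def)
    finally show "(\<Sum>U\<in>Is k. rexp (all_pairs V) p (\<lambda>E. of_bool (j k \<le> card (E \<inter> all_pairs U))))
      \<le> (80 * exp (3 - \<delta>)) ^ k" .
  qed
  also have "\<dots> \<le> 2 * (80 * exp (3 - \<delta>))" using \<delta>(2) by (intro sum_power_le_twice) auto
  finally show ?thesis by simp
qed

text \<open>Chernoff's method for lower tails, with the base \<open>1 / 5\<close> throughout.\<close>

lemma of_bool_le_exp_moment: "of_bool (real k \<le> a) \<le> 5 powr a * (1 / 5 :: real) ^ k"
proof (cases "real k \<le> a")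
  case True
  have "(1 / 5 :: real) ^ k = 5 powr (- real k)"
    by (simp add: powr_minus powr_realpow power_one_over inverse_eq_divide)
  then have "5 powr a * (1 / 5 :: real) ^ k = 5 powr (a - real k)"
    using powr_add[of "5 :: real" a "- real k"] by (simp only:) simp
  then show ?thesis using True by (simp add: ge_one_powr_ge_zero)
qed auto

section \<open>Almost nested neighbourhoods, common neighbours and low degrees\<close>

lemma doubleton_in_star: "{a, b} \<in> star v W \<longleftrightarrow> a = v \<and> b \<in> W \<or> b = v \<and> a \<in> W"
  by (simp add: star_def image_iff doubleton_eq_iff) blast

text \<open>The vertices w of W act independently, each through the two pairs {v, w} and {u, w}. A
  factor z appears exactly if the first is an edge and the second is not, which has probability p (1
  - p).\<close>

lemma rexp_power_card_nbrs_diff: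
  assumes "finite W" "u \<notin> W" "v \<notin> W" "u \<noteq> v"
  shows "rexp (star v W \<union> star u W) p (\<lambda>E. z ^ card {w \<in> W. {v, w} \<in> E \<and> {u, w} \<notin> E})
    = (1 - p * (1 - p) * (1 - z)) ^ card W"
  using assms(1-3)
proof (induction W rule: finite_induct)
  case empty
  then show ?case by (simp add: star_def)
next
  case (insert w W)
  let ?A = "star v W \<union> star u W"
  let ?F = "\<lambda>W E. z ^ card {w \<in> W. {v, w} \<in> E \<and> {u, w} \<notin> E}"
  have IH: "rexp ?A p (?F W) = (1 - p * (1 - p) * (1 - z)) ^ card W" using insert by auto
  have un: "star v (insert w W) \<union> star u (insert w W) = insert {v, w} (insert {u, w} ?A)"
    by (auto simp: star_def)
  have fin: "finite ?A" using insert.hyps by (auto simp: star_def)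
  have notin: "{u, w} \<notin> ?A" "{v, w} \<notin> insert {u, w} ?A"
    using insert.hyps insert.prems assms(4) by (simp_all add: doubleton_in_star doubleton_eq_iff)
  have fin': "finite (insert {u, w} ?A)" using fin by simp
  have distinct: "{v, w} \<noteq> {u, w}" "\<And>x. x \<in> W \<Longrightarrow> {v, x} \<noteq> {v, w} \<and> {u, x} \<noteq> {v, w} \<and> {v, x} \<noteq> {u, w} \<and> {u, x} \<noteq> {u, w}"
    using insert.hyps insert.prems assms(4) by (auto simp: doubleton_eq_iff)
  have F: "?F (insert w W) E = ?F W E"
    "?F (insert w W) (insert {u, w} E) = ?F W E"
    "?F (insert w W) (insert {v, w} E) = z * ?F W E"
    "?F (insert w W) (insert {v, w} (insert {u, w} E)) = ?F W E"
    if "E \<subseteq> ?A" for E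
  proof -
    have n: "{v, w} \<notin> E" "{u, w} \<notin> E" using that notin by auto
    have "{x \<in> insert w W. {v, x} \<in> E \<and> {u, x} \<notin> E} = {x \<in> W. {v, x} \<in> E \<and> {u, x} \<notin> E}"
      "{x \<in> insert w W. {v, x} \<in> insert {u, w} E \<and> {u, x} \<notin> insert {u, w} E} = {x \<in> W. {v, x} \<in> E \<and> {u, x} \<notin> E}"
      "{x \<in> insert w W. {v, x} \<in> insert {v, w} E \<and> {u, x} \<notin> insert {v, w} E} = insert w {x \<in> W. {v, x} \<in> E \<and> {u, x} \<notin> E}"
      "{x \<in> insert w W. {v, x} \<in> insert {v, w} (insert {u, w} E) \<and> {u, x} \<notin> insert {v, w} (insert {u, w} E)} = {x \<in> W. {v, x} \<in> E \<and> {u, x} \<notin> E}"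
      using n distinct(1) by (auto dest: distinct(2))
    then show "?F (insert w W) E = ?F W E"
    "?F (insert w W) (insert {u, w} E) = ?F W E"
    "?F (insert w W) (insert {v, w} E) = z * ?F W E"
    "?F (insert w W) (insert {v, w} (insert {u, w} E)) = ?F W E"
      using insert.hyps by simp_all
  qed
  have "rexp (star v (insert w W) \<union> star u (insert w W)) p (?F (insert w W)) =
    (1 - p) * ((1 - p) * rexp ?A p (?F (insert w W)) + p * rexp ?A p (\<lambda>E. ?F (insert w W) (insert {u, w} E)))
    + p * ((1 - p) * rexp ?A p (\<lambda>E. ?F (insert w W) (insert {v, w} E))
       + p * rexp ?A p (\<lambda>E. ?F (insert w W) (insert {v, w} (insert {u, w} E))))"
    unfolding un rexp_insert[OF fin' notin(2)] rexp_insert[OF fin notin(1)] ..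
  also have "\<dots> = (1 - p) * ((1 - p) * rexp ?A p (?F W) + p * rexp ?A p (?F W))
    + p * ((1 - p) * rexp ?A p (\<lambda>E. z * ?F W E) + p * rexp ?A p (?F W))"
    by (intro arg_cong2[of _ _ _ _ "(+)"] arg_cong2[of _ _ _ _ "(*)"] refl rexp_cong F)
  also have "\<dots> = (1 - p * (1 - p) * (1 - z)) * rexp ?A p (?F W)"
    by (simp add: rexp_cmult algebra_simps)
  finally show ?case using IH insert.hyps by simp
qed

text \<open>For fixed v and u the number of w outside {u, v} adjacent to v but not to u is binomial
  with parameter p (1 - p), and the moment bound at 1 / 5 controls its lower tail. The union over
  pairs costs a square, which is affordable once n p is a large multiple of log n.\<close>

lemma rexp_foldable:
  assumes "finite V" "0 \<le> p" "p \<le> 1"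
  shows "rexp (all_pairs V) p (\<lambda>E. of_bool (foldable V E d \<noteq> {}))
    \<le> (real (card V))\<^sup>2 * (5 powr d * (1 - p * (1 - p) * (4 / 5)) ^ (card V - 2))"
proof -
  define I where "I = {(v, u). v \<in> V \<and> u \<in> V \<and> u \<noteq> v}"
  have sub: "I \<subseteq> V \<times> V" by (auto simp: I_def)
  then have finI: "finite I" using assms(1) finite_subset by blast
  define b where "b = 5 powr d * (1 - p * (1 - p) * (4 / 5)) ^ (card V - 2)"
  have "p * (1 - p) * (4 / 5) \<le> 1 * 1 * 1" using assms by (intro mult_mono) auto
  then have b0: "0 \<le> b" unfolding b_def by simp
  have "rexp (all_pairs V) p (\<lambda>E. of_bool (foldable V E d \<noteq> {})) \<le>
    (\<Sum>i\<in>I. rexp (all_pairs V) p (\<lambda>E. of_bool (real (card (nbrs E (fst i) - nbrs E (snd i))) \<le> d)))"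
    by (rule rexp_union_bound[OF finI assms(2,3)]) (force simp: foldable_def I_def)
  also have "\<dots> \<le> (\<Sum>i\<in>I. b)"
  proof (rule sum_mono)
    fix i assume "i \<in> I"
    then obtain v u where i: "i = (v, u)" "v \<in> V" "u \<in> V" "u \<noteq> v" by (auto simp: I_def)
    define W where "W = V - {u, v}"
    define F where "F E = 5 powr d * (1 / 5 :: real) ^ card {w \<in> W. {v, w} \<in> E \<and> {u, w} \<notin> E}" for E
    let ?B = "star v W \<union> star u W"
    have B: "?B \<subseteq> all_pairs V" using i by (auto simp: W_def star_def doubleton_in_all_pairs)
    have "rexp (all_pairs V) p (\<lambda>E. of_bool (real (card (nbrs E v - nbrs E u)) \<le> d))
      \<le> rexp (all_pairs V) p (\<lambda>E. F (E \<inter> ?B))"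
    proof (rule rexp_mono[OF assms(2,3)])
      fix E assume E: "E \<subseteq> all_pairs V"
      have eq: "{w \<in> W. {v, w} \<in> E \<inter> ?B \<and> {u, w} \<notin> E \<inter> ?B} = {w \<in> W. {v, w} \<in> E \<and> {u, w} \<notin> E}"
        by (auto simp: star_def)
      have "{w \<in> W. {v, w} \<in> E \<and> {u, w} \<notin> E} \<subseteq> nbrs E v - nbrs E u" by (auto simp: nbrs_def)
      then have le: "card {w \<in> W. {v, w} \<in> E \<and> {u, w} \<notin> E} \<le> card (nbrs E v - nbrs E u)"
        using finite_nbrs[OF assms(1) E] by (intro card_mono) auto
      have "of_bool (real (card (nbrs E v - nbrs E u)) \<le> d) \<le>
        (of_bool (real (card {w \<in> W. {v, w} \<in> E \<and> {u, w} \<notin> E}) \<le> d) :: real)"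
        using le by (auto simp: of_bool_def)
      also have "\<dots> \<le> F (E \<inter> ?B)" unfolding F_def eq by (rule of_bool_le_exp_moment)
      finally show "of_bool (real (card (nbrs E v - nbrs E u)) \<le> d) \<le> F (E \<inter> ?B)" .
    qed
    also have "\<dots> = rexp ?B p F" using assms(1) B by (intro rexp_Int) auto
    also have "\<dots> = b"
    proof -
      have "card W = card V - 2" using i assms(1) by (simp add: W_def card_Diff_subset)
      moreover have "finite W" "u \<notin> W" "v \<notin> W" "u \<noteq> v" using assms(1) i by (auto simp: W_def)
      ultimately show ?thesis unfolding F_def b_def
        by (simp add: rexp_cmult rexp_power_card_nbrs_diff[of W u v p "1 / 5"])
    qed
    finally show "rexp (all_pairs V) p (\<lambda>E. of_bool (real (card (nbrs E (fst i) - nbrs E (snd i))) \<le> d)) \<le> b"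
      by (simp add: i)
  qed
  also have "\<dots> = real (card I) * b" by simp
  also have "\<dots> \<le> (real (card V))\<^sup>2 * b"
  proof (rule mult_right_mono[OF _ b0])
    have "card I \<le> card (V \<times> V)" using assms(1) sub by (intro card_mono) auto
    then show "real (card I) \<le> (real (card V))\<^sup>2"
      by (simp add: card_cartesian_product power2_eq_square flip: of_nat_mult)
  qed
  finally show ?thesis by (simp add: b_def)
qed

lemma of_bool_le_add: "(P \<Longrightarrow> Q \<or> R) \<Longrightarrow> of_bool P \<le> (of_bool Q + of_bool R :: real)"
  by (cases P; cases Q; cases R) auto

lemma finite_star [simp]: "finite W \<Longrightarrow> finite (star v W)"
  by (simp add: star_def)

lemma star_disjoint: "u \<notin> W \<Longrightarrow> u \<noteq> v \<Longrightarrow> star u W \<inter> star v W = {}"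
  by (auto simp: star_def doubleton_eq_iff)

lemma star_subset_iff: "star v W \<subseteq> E \<longleftrightarrow> W \<subseteq> nbrs E v"
  by (auto simp: star_def nbrs_def)

lemma star_disjoint_iff: "E \<inter> star v W = {} \<longleftrightarrow> nbrs E v \<inter> W = {}"
  by (auto simp: star_def nbrs_def)

text \<open>The expected number of copies of the complete bipartite graph with parts 2 and 3: five
  vertices and six edges. With D = n p the bound is D^6 / n, small when D is of order log n.\<close>

lemma rexp_codegree:
  assumes "finite V" "0 \<le> p" "p \<le> 1"
  shows "rexp (all_pairs V) p (\<lambda>E. of_bool (\<exists>u\<in>V. \<exists>v\<in>V. u \<noteq> v \<and> 3 \<le> card (nbrs E u \<inter> nbrs E v)))
    \<le> real (card V) ^ 5 * p ^ 6"
proof -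
  let ?T = "{W. W \<subseteq> V \<and> card W = 3}"
  define I where "I = {(u, v, W). u \<in> V \<and> v \<in> V \<and> u \<noteq> v \<and> W \<subseteq> V - {u, v} \<and> card W = 3}"
  have sub: "I \<subseteq> V \<times> V \<times> ?T" by (auto simp: I_def)
  have finT: "finite ?T" by (rule finite_subset[of _ "Pow V"]) (use assms in auto)
  have fin: "finite (V \<times> V \<times> ?T)" using assms(1) finT by simp
  have finI: "finite I" using finite_subset[OF sub fin] .
  have "rexp (all_pairs V) p (\<lambda>E. of_bool (\<exists>u\<in>V. \<exists>v\<in>V. u \<noteq> v \<and> 3 \<le> card (nbrs E u \<inter> nbrs E v)))
    \<le> (\<Sum>i\<in>I. rexp (all_pairs V) p (\<lambda>E. of_bool (case i of (u, v, W) \<Rightarrow> star u W \<union> star v W \<subseteq> E)))"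
  proof (rule rexp_union_bound[OF finI assms(2,3)])
    fix E assume E: "E \<subseteq> all_pairs V" and "\<exists>u\<in>V. \<exists>v\<in>V. u \<noteq> v \<and> 3 \<le> card (nbrs E u \<inter> nbrs E v)"
    then obtain u v where uv: "u \<in> V" "v \<in> V" "u \<noteq> v" "3 \<le> card (nbrs E u \<inter> nbrs E v)" by blast
    then obtain W where W: "W \<subseteq> nbrs E u \<inter> nbrs E v" "card W = 3" by (metis obtain_subset_with_card_n)
    then have "(u, v, W) \<in> I" using uv nbrs_subset[OF E] by (auto simp: I_def)
    moreover have "star u W \<union> star v W \<subseteq> E" using W by (simp add: star_subset_iff)
    ultimately show "\<exists>i\<in>I. case i of (u, v, W) \<Rightarrow> star u W \<union> star v W \<subseteq> E" by blast
  qed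
  also have "\<dots> = (\<Sum>i\<in>I. p ^ 6)"
  proof (rule sum.cong[OF refl])
    fix i assume "i \<in> I"
    then obtain u v W where i: "i = (u, v, W)" "u \<in> V" "v \<in> V" "u \<noteq> v" "W \<subseteq> V - {u, v}" "card W = 3"
      by (auto simp: I_def)
    then have "finite W" using assms(1) finite_subset by (metis finite_Diff)
    moreover have "star u W \<inter> star v W = {}" using i by (intro star_disjoint) auto
    ultimately have "card (star u W \<union> star v W) = 6" using i by (simp add: card_Un_disjoint)
    moreover have "star u W \<union> star v W \<subseteq> all_pairs V"
      using i star_subset_all_pairs[of u V W] star_subset_all_pairs[of v V W] by blast
    ultimately show "rexp (all_pairs V) p (\<lambda>E. of_bool (case i of (u, v, W) \<Rightarrow> star u W \<union> star v W \<subseteq> E)) = p ^ 6"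
      using rexp_contains[of "all_pairs V" "star u W \<union> star v W" p] assms(1) by (simp add: i(1))
  qed
  also have "\<dots> = real (card I) * p ^ 6" by simp
  also have "\<dots> \<le> real (card V) ^ 5 * p ^ 6"
  proof (rule mult_right_mono)
    have "card I \<le> card (V \<times> V \<times> ?T)" by (rule card_mono[OF fin sub])
    also have "\<dots> = card V * (card V * (card V choose 3))"
      by (simp add: card_cartesian_product n_subsets[OF assms(1)])
    also have "\<dots> \<le> card V * (card V * card V ^ 3)"
      by (cases "3 \<le> card V") (auto simp: binomial_le_pow binomial_eq_0)
    also have "\<dots> = card V ^ 5" by (simp add: eval_nat_numeral)
    finally show "real (card I) \<le> real (card V) ^ 5" by (metis of_nat_le_iff of_nat_power)
  qed (use assms in auto)
  finally show ?thesis .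
qed

text \<open>The two degrees share the pair {v, w} and may also count prescribed edges from F.
  Counting only neighbours in W can only lower them, and then the two counts and the event that F is
  present depend on disjoint sets of pairs.\<close>

lemma rexp_two_low_degrees:
  assumes "finite V" "0 \<le> p" "p \<le> 1" "v \<in> V" "w \<in> V" "v \<noteq> w" "W \<subseteq> V - {v, w}"
    and F: "F \<subseteq> all_pairs V" "F \<inter> (star v W \<union> star w W) = {}"
  shows "rexp (all_pairs V) p (\<lambda>E. of_bool (F \<subseteq> E \<and> real (card (nbrs E v)) \<le> a \<and> real (card (nbrs E w)) \<le> a))
    \<le> p ^ card F * (5 powr a * (1 - 4 / 5 * p) ^ card W)\<^sup>2"
proof -
  define f :: "'a set set \<Rightarrow> real" where "f E = 5 powr a * (1 / 5) ^ card E" for E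
  let ?C = "star v W \<union> star w W"
  have C: "?C \<subseteq> all_pairs V"
    using assms star_subset_all_pairs[of v V W] star_subset_all_pairs[of w V W] by blast
  have finW: "finite W" using assms(1,7) finite_subset by (metis finite_Diff)
  have disj: "star v W \<inter> star w W = {}" using assms by (intro star_disjoint) auto
  have low: "of_bool (real (card (nbrs E x)) \<le> a) \<le> f (E \<inter> star x W)"
    if "E \<subseteq> all_pairs V" for E x
  proof -
    have "card (nbrs E x \<inter> W) \<le> card (nbrs E x)"
      using finite_nbrs[OF assms(1) that] by (intro card_mono) auto
    then have "of_bool (real (card (nbrs E x)) \<le> a) \<le> (of_bool (real (card (E \<inter> star x W)) \<le> a) :: real)"
      by (auto simp: star_inter)
    also have "\<dots> \<le> f (E \<inter> star x W)" unfolding f_def by (rule of_bool_le_exp_moment)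
    finally show ?thesis .
  qed
  have "rexp (all_pairs V) p (\<lambda>E. of_bool (F \<subseteq> E \<and> real (card (nbrs E v)) \<le> a \<and> real (card (nbrs E w)) \<le> a))
    \<le> rexp (all_pairs V) p (\<lambda>E. of_bool (F \<subseteq> E \<inter> F) * (\<lambda>E. f (E \<inter> star v W) * f (E \<inter> star w W)) (E \<inter> ?C))"
  proof (rule rexp_mono[OF assms(2,3)])
    fix E assume E: "E \<subseteq> all_pairs V"
    have eq: "E \<inter> ?C \<inter> star v W = E \<inter> star v W" "E \<inter> ?C \<inter> star w W = E \<inter> star w W" by auto
    have "of_bool (F \<subseteq> E \<and> real (card (nbrs E v)) \<le> a \<and> real (card (nbrs E w)) \<le> a)
       = of_bool (F \<subseteq> E \<inter> F) * (of_bool (real (card (nbrs E v)) \<le> a) * of_bool (real (card (nbrs E w)) \<le> a) :: real)"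
      by (simp flip: of_bool_conj)
    also have "\<dots> \<le> of_bool (F \<subseteq> E \<inter> F) * (f (E \<inter> star v W) * f (E \<inter> star w W))"
      by (intro mult_left_mono mult_mono low E) (auto simp: f_def)
    finally show "of_bool (F \<subseteq> E \<and> real (card (nbrs E v)) \<le> a \<and> real (card (nbrs E w)) \<le> a)
      \<le> of_bool (F \<subseteq> E \<inter> F) * (\<lambda>E. f (E \<inter> star v W) * f (E \<inter> star w W)) (E \<inter> ?C)"
      by (simp only: eq)
  qed
  also have "\<dots> = rexp F p (\<lambda>E. of_bool (F \<subseteq> E)) * rexp ?C p (\<lambda>E. f (E \<inter> star v W) * f (E \<inter> star w W))"
    using assms(1) F(1) C F(2) by (intro rexp_indep) auto
  also have "rexp F p (\<lambda>E. of_bool (F \<subseteq> E)) = p ^ card F"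
    using F(1) assms(1) by (intro rexp_superset) (auto intro: finite_subset)
  also have "rexp ?C p (\<lambda>E. f (E \<inter> star v W) * f (E \<inter> star w W)) = rexp (star v W) p f * rexp (star w W) p f"
    using finW disj by (intro rexp_indep) auto
  also have "rexp (star v W) p f * rexp (star w W) p f = (5 powr a * (1 - 4 / 5 * p) ^ card W)\<^sup>2"
  proof -
    have "rexp (star x W) p f = 5 powr a * (1 - 4 / 5 * p) ^ card W" for x
      unfolding f_def using finW by (simp add: rexp_cmult rexp_power_card algebra_simps)
    then show ?thesis by (simp only: power2_eq_square)
  qed
  finally show ?thesis .
qed

text \<open>The prescribed edges F form the edge vw or the path v x w, giving the counts n^2 p and
  n^3 p^2. For the path, W must also avoid x, hence the exponent n - 3.\<close>

lemma rexp_close_low_degrees: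
  fixes V :: "'a set"
  assumes "finite V" "0 \<le> p" "p \<le> 1"
  shows "rexp (all_pairs V) p (\<lambda>E. of_bool (\<exists>v\<in>V. \<exists>w\<in>V. v \<noteq> w \<and> real (card (nbrs E v)) \<le> a \<and>
      real (card (nbrs E w)) \<le> a \<and> ({v, w} \<in> E \<or> (\<exists>x. {x, v} \<in> E \<and> {x, w} \<in> E))))
    \<le> (real (card V) ^ 2 * p + real (card V) ^ 3 * p ^ 2) * (5 powr a * (1 - 4 / 5 * p) ^ (card V - 3))\<^sup>2"
proof -
  define \<tau> where "\<tau> = 5 powr a * (1 - 4 / 5 * p) ^ (card V - 3)"
  have \<tau>0: "0 \<le> \<tau>" using assms by (simp add: \<tau>_def)
  define low where "low E v w \<longleftrightarrow> real (card (nbrs E v)) \<le> a \<and> real (card (nbrs E w)) \<le> a"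
    for E and v w :: 'a
  define I where "I = {(v, w). v \<in> V \<and> w \<in> V \<and> v \<noteq> w}"
  define J where "J = {(v, w, x). v \<in> V \<and> w \<in> V \<and> x \<in> V \<and> v \<noteq> w \<and> x \<noteq> v \<and> x \<noteq> w}"
  have sub: "I \<subseteq> V \<times> V" "J \<subseteq> V \<times> V \<times> V" by (auto simp: I_def J_def)
  have fin: "finite (V \<times> V)" "finite (V \<times> V \<times> V)" using assms by auto
  have finIJ: "finite I" "finite J" using finite_subset[OF sub(1) fin(1)] finite_subset[OF sub(2) fin(2)] .
  let ?A = "\<lambda>E. \<exists>v\<in>V. \<exists>w\<in>V. v \<noteq> w \<and> low E v w \<and> {v, w} \<in> E"
  let ?B = "\<lambda>E. \<exists>v\<in>V. \<exists>w\<in>V. v \<noteq> w \<and> low E v w \<and> (\<exists>x. {x, v} \<in> E \<and> {x, w} \<in> E)"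
  have A: "rexp (all_pairs V) p (\<lambda>E. of_bool (?A E)) \<le> real (card V) ^ 2 * p * \<tau>\<^sup>2"
  proof -
    have "rexp (all_pairs V) p (\<lambda>E. of_bool (?A E)) \<le>
      (\<Sum>i\<in>I. rexp (all_pairs V) p (\<lambda>E. of_bool ({{fst i, snd i}} \<subseteq> E \<and> low E (fst i) (snd i))))"
    proof (rule rexp_union_bound[OF finIJ(1) assms(2,3)])
      fix E assume "?A E"
      then obtain v w where "(v, w) \<in> I" "low E v w" "{v, w} \<in> E" by (auto simp: I_def)
      then show "\<exists>i\<in>I. {{fst i, snd i}} \<subseteq> E \<and> low E (fst i) (snd i)" by (intro bexI[of _ "(v, w)"]) auto
    qed
    also have "\<dots> \<le> (\<Sum>i\<in>I. p * \<tau>\<^sup>2)"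
    proof (rule sum_mono)
      fix i assume "i \<in> I"
      then obtain v w where i: "i = (v, w)" "v \<in> V" "w \<in> V" "v \<noteq> w" by (auto simp: I_def)
      let ?W = "V - {v, w}"
      have "rexp (all_pairs V) p (\<lambda>E. of_bool ({{v, w}} \<subseteq> E \<and> low E v w))
        \<le> p ^ card {{v, w}} * (5 powr a * (1 - 4 / 5 * p) ^ card ?W)\<^sup>2"
        unfolding low_def using i assms
        by (intro rexp_two_low_degrees) (simp_all add: doubleton_in_all_pairs doubleton_in_star)
      also have "\<dots> \<le> p * \<tau>\<^sup>2"
      proof -
        \<comment> \<open>For an edge n - 2 vertices are available; one is given away so that both
          cases share \<tau>.\<close>
        have "card V - 3 \<le> card ?W" using i assms(1) by (simp add: card_Diff_subset)
        then have "(1 - 4 / 5 * p) ^ card ?W \<le> (1 - 4 / 5 * p) ^ (card V - 3)"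
          using assms by (intro power_decreasing) auto
        then have "(5 powr a * (1 - 4 / 5 * p) ^ card ?W)\<^sup>2 \<le> \<tau>\<^sup>2"
          unfolding \<tau>_def using assms by (intro power_mono mult_left_mono) auto
        then show ?thesis using assms by (simp add: mult_left_mono)
      qed
      finally show "rexp (all_pairs V) p (\<lambda>E. of_bool ({{fst i, snd i}} \<subseteq> E \<and> low E (fst i) (snd i))) \<le> p * \<tau>\<^sup>2"
        by (simp add: i(1))
    qed
    also have "\<dots> = real (card I) * (p * \<tau>\<^sup>2)" by simp
    also have "\<dots> \<le> real (card V) ^ 2 * (p * \<tau>\<^sup>2)"
    proof (rule mult_right_mono)
      have "card I \<le> card V * card V" using card_mono[OF fin(1) sub(1)] by (simp add: card_cartesian_product)
      then show "real (card I) \<le> real (card V) ^ 2"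
        by (simp add: power2_eq_square flip: of_nat_mult)
    qed (use assms in auto)
    finally show ?thesis by (simp add: mult.assoc)
  qed
  have B: "rexp (all_pairs V) p (\<lambda>E. of_bool (?B E)) \<le> real (card V) ^ 3 * p ^ 2 * \<tau>\<^sup>2"
  proof -
    have "rexp (all_pairs V) p (\<lambda>E. of_bool (?B E)) \<le>
      (\<Sum>i\<in>J. rexp (all_pairs V) p (\<lambda>E. of_bool (case i of (v, w, x) \<Rightarrow> {{x, v}, {x, w}} \<subseteq> E \<and> low E v w)))"
    proof (rule rexp_union_bound[OF finIJ(2) assms(2,3)])
      fix E assume E: "E \<subseteq> all_pairs V" and "?B E"
      then obtain v w x where vw: "v \<in> V" "w \<in> V" "v \<noteq> w" "low E v w" "{x, v} \<in> E" "{x, w} \<in> E" by blast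
      then have "{x, v} \<in> all_pairs V" "{x, w} \<in> all_pairs V" using E by auto
      then have "(v, w, x) \<in> J" using vw by (auto simp: J_def doubleton_in_all_pairs)
      then show "\<exists>i\<in>J. case i of (v, w, x) \<Rightarrow> {{x, v}, {x, w}} \<subseteq> E \<and> low E v w"
        using vw by (intro bexI[of _ "(v, w, x)"]) auto
    qed
    also have "\<dots> \<le> (\<Sum>i\<in>J. p ^ 2 * \<tau>\<^sup>2)"
    proof (rule sum_mono)
      fix i assume "i \<in> J"
      then obtain v w x where i: "i = (v, w, x)" "v \<in> V" "w \<in> V" "x \<in> V" "v \<noteq> w" "x \<noteq> v" "x \<noteq> w"
        by (auto simp: J_def)
      let ?W = "V - {v, w, x}"
      have cF: "card {{x, v}, {x, w}} = 2" using i by (auto simp: card_insert_if doubleton_eq_iff)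
      have cW: "card ?W = card V - 3" using i assms(1) by (simp add: card_Diff_subset)
      have "rexp (all_pairs V) p (\<lambda>E. of_bool ({{x, v}, {x, w}} \<subseteq> E \<and> low E v w))
        \<le> p ^ card {{x, v}, {x, w}} * (5 powr a * (1 - 4 / 5 * p) ^ card ?W)\<^sup>2"
        unfolding low_def using i assms
        by (intro rexp_two_low_degrees) (auto simp: doubleton_in_all_pairs doubleton_in_star)
      then show "rexp (all_pairs V) p (\<lambda>E. of_bool (case i of (v, w, x) \<Rightarrow> {{x, v}, {x, w}} \<subseteq> E \<and> low E v w))
        \<le> p ^ 2 * \<tau>\<^sup>2"
        unfolding cF cW \<tau>_def by (simp add: i(1))
    qed
    also have "\<dots> = real (card J) * (p ^ 2 * \<tau>\<^sup>2)" by simp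
    also have "\<dots> \<le> real (card V) ^ 3 * (p ^ 2 * \<tau>\<^sup>2)"
    proof (rule mult_right_mono)
      have "card J \<le> card V * (card V * card V)" using card_mono[OF fin(2) sub(2)] by (simp add: card_cartesian_product)
      then show "real (card J) \<le> real (card V) ^ 3"
        by (simp add: power3_eq_cube mult.assoc flip: of_nat_mult)
    qed (use assms in auto)
    finally show ?thesis by (simp add: mult.assoc)
  qed
  have "rexp (all_pairs V) p (\<lambda>E. of_bool (\<exists>v\<in>V. \<exists>w\<in>V. v \<noteq> w \<and> real (card (nbrs E v)) \<le> a \<and>
      real (card (nbrs E w)) \<le> a \<and> ({v, w} \<in> E \<or> (\<exists>x. {x, v} \<in> E \<and> {x, w} \<in> E))))
    \<le> rexp (all_pairs V) p (\<lambda>E. of_bool (?A E) + of_bool (?B E))"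
  proof (rule rexp_mono[OF assms(2,3)])
    fix E :: "'a set set"
    let ?C = "\<exists>v\<in>V. \<exists>w\<in>V. v \<noteq> w \<and> real (card (nbrs E v)) \<le> a \<and>
      real (card (nbrs E w)) \<le> a \<and> ({v, w} \<in> E \<or> (\<exists>x. {x, v} \<in> E \<and> {x, w} \<in> E))"
    have *: "?C \<Longrightarrow> ?A E \<or> ?B E" unfolding low_def by blast
    show "of_bool ?C \<le> (of_bool (?A E) + of_bool (?B E) :: real)"
      by (rule of_bool_le_add[OF *])
  qed
  also have "\<dots> \<le> real (card V) ^ 2 * p * \<tau>\<^sup>2 + real (card V) ^ 3 * p ^ 2 * \<tau>\<^sup>2"
    unfolding rexp_add using A B by (rule add_mono)
  finally show ?thesis by (simp add: \<tau>_def distrib_right)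
qed

text \<open>Either v has no neighbour, or exactly one, w. For n = card V, the second term, n^2 p (1
  - p)^(n - 2), is of order n D exp (- D) near the threshold and is what places it at log n + log
  log n.\<close>

lemma rexp_min_degree:
  fixes V :: "'a set"
  assumes "finite V" "0 \<le> p" "p \<le> 1"
  shows "rexp (all_pairs V) p (\<lambda>E. of_bool (\<exists>v\<in>V. card (nbrs E v) \<le> 1))
    \<le> real (card V) * (1 - p) ^ (card V - 1) + real (card V) ^ 2 * (p * (1 - p) ^ (card V - 2))"
proof -
  let ?I = "{(v, w). v \<in> V \<and> w \<in> V \<and> v \<noteq> w}"
  have sub: "?I \<subseteq> V \<times> V" by auto
  have fin: "finite (V \<times> V)" using assms by auto
  have finI: "finite ?I" by (rule finite_subset[OF sub fin])
  let ?A = "\<lambda>E. \<exists>v\<in>V. {} \<subseteq> E \<and> E \<inter> star v (V - {v}) = {}"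
  let ?B = "\<lambda>E. \<exists>i\<in>?I. {{fst i, snd i}} \<subseteq> E \<and> E \<inter> star (fst i) (V - {fst i, snd i}) = {}"
  have "rexp (all_pairs V) p (\<lambda>E. of_bool (\<exists>v\<in>V. card (nbrs E v) \<le> 1))
    \<le> rexp (all_pairs V) p (\<lambda>E. of_bool (?A E) + of_bool (?B E))"
  proof (rule rexp_mono[OF assms(2,3)])
    fix E assume E: "E \<subseteq> all_pairs V"
    have "?A E \<or> ?B E" if v: "v \<in> V" "card (nbrs E v) \<le> 1" for v
    proof (cases "nbrs E v = {}")
      case True
      then show ?thesis using v by (auto simp: star_disjoint_iff)
    next
      case False
      then have "card (nbrs E v) = 1"
        using v finite_nbrs[OF assms(1) E, of v] by (simp add: card_gt_0_iff le_antisym Suc_leI)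
      then obtain w where w: "nbrs E v = {w}" by (auto simp: card_1_singleton_iff)
      then have "w \<in> V" "w \<noteq> v" using nbrs_subset[OF E, of v] by auto
      moreover have "{v, w} \<in> E" using w by (auto simp: nbrs_def)
      moreover have "E \<inter> star v (V - {v, w}) = {}" using w by (simp add: star_disjoint_iff)
      ultimately have "?B E" using v by (intro bexI[of _ "(v, w)"]) auto
      then show ?thesis ..
    qed
    then have *: "\<exists>v\<in>V. card (nbrs E v) \<le> 1 \<Longrightarrow> ?A E \<or> ?B E" by blast
    show "of_bool (\<exists>v\<in>V. card (nbrs E v) \<le> 1) \<le> (of_bool (?A E) + of_bool (?B E) :: real)"
      by (rule of_bool_le_add[OF *])
  qed
  also have "\<dots> \<le> (\<Sum>v\<in>V. rexp (all_pairs V) p (\<lambda>E. of_bool ({} \<subseteq> E \<and> E \<inter> star v (V - {v}) = {})))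
    + (\<Sum>i\<in>?I. rexp (all_pairs V) p (\<lambda>E. of_bool ({{fst i, snd i}} \<subseteq> E \<and> E \<inter> star (fst i) (V - {fst i, snd i}) = {})))"
    unfolding rexp_add
    by (intro add_mono rexp_union_bound[OF assms(1-3)] rexp_union_bound[OF finI assms(2,3)])
  also have "\<dots> = (\<Sum>v\<in>V. (1 - p) ^ (card V - 1)) + (\<Sum>i\<in>?I. p * (1 - p) ^ (card V - 2))"
  proof (intro arg_cong2[of _ _ _ _ "(+)"] sum.cong refl)
    fix v assume v: "v \<in> V"
    have "rexp (all_pairs V) p (\<lambda>E. of_bool ({} \<subseteq> E \<and> E \<inter> star v (V - {v}) = {}))
      = p ^ card ({} :: 'a set set) * (1 - p) ^ card (star v (V - {v}))"
      using assms v by (intro rexp_pattern star_subset_all_pairs) auto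
    then show "rexp (all_pairs V) p (\<lambda>E. of_bool ({} \<subseteq> E \<and> E \<inter> star v (V - {v}) = {})) = (1 - p) ^ (card V - 1)"
      using v assms(1) by (simp add: card_Diff_subset)
  next
    fix i assume "i \<in> ?I"
    then obtain v w where i: "i = (v, w)" "v \<in> V" "w \<in> V" "v \<noteq> w" by auto
    have "rexp (all_pairs V) p (\<lambda>E. of_bool ({{v, w}} \<subseteq> E \<and> E \<inter> star v (V - {v, w}) = {}))
      = p ^ card {{v, w}} * (1 - p) ^ card (star v (V - {v, w}))"
      using assms i by (intro rexp_pattern star_subset_all_pairs) (simp_all add: doubleton_in_all_pairs doubleton_in_star, blast)
    moreover have "card (V - {v, w}) = card V - 2" using i assms(1) by (simp add: card_Diff_subset)
    ultimately show "rexp (all_pairs V) p (\<lambda>E. of_bool ({{fst i, snd i}} \<subseteq> E \<and> E \<inter> star (fst i) (V - {fst i, snd i}) = {}))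
      = p * (1 - p) ^ (card V - 2)"
      by (simp add: i(1))
  qed
  also have "\<dots> = real (card V) * (1 - p) ^ (card V - 1) + real (card ?I) * (p * (1 - p) ^ (card V - 2))"
    by simp
  also have "\<dots> \<le> real (card V) * (1 - p) ^ (card V - 1) + real (card V) ^ 2 * (p * (1 - p) ^ (card V - 2))"
  proof (intro add_left_mono mult_right_mono)
    have "card ?I \<le> card V * card V" using card_mono[OF fin sub] by (simp add: card_cartesian_product)
    then show "real (card ?I) \<le> real (card V) ^ 2"
      by (simp add: power2_eq_square flip: of_nat_mult)
  qed (use assms in auto)
  finally show ?thesis .
qed

text \<open>If {x, y} is the neighbourhood of v and is contained in that of u, then v x u y is a
  4-cycle and v has no neighbour among the other n - 4 vertices. The pair {v, u} is left
  unexamined.\<close>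

lemma rexp_degree_two_fold:
  assumes "finite V" "0 \<le> p" "p \<le> 1"
  shows "rexp (all_pairs V) p (\<lambda>E. of_bool (\<exists>v\<in>V. \<exists>u\<in>V. u \<noteq> v \<and> nbrs E v \<subseteq> nbrs E u \<and> card (nbrs E v) = 2))
    \<le> real (card V) ^ 4 * (p ^ 4 * (1 - p) ^ (card V - 4))"
proof -
  define I where "I = {(v, u, x, y). v \<in> V \<and> u \<in> V \<and> x \<in> V \<and> y \<in> V \<and> distinct [v, u, x, y]}"
  have sub: "I \<subseteq> V \<times> V \<times> V \<times> V" by (auto simp: I_def)
  have fin: "finite (V \<times> V \<times> V \<times> V)" using assms by auto
  have finI: "finite I" by (rule finite_subset[OF sub fin])
  let ?X = "\<lambda>v u x y. star v {x, y} \<union> star u {x, y}"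
  let ?Y = "\<lambda>v u x y. star v (V - {v, u, x, y})"
  have "rexp (all_pairs V) p (\<lambda>E. of_bool (\<exists>v\<in>V. \<exists>u\<in>V. u \<noteq> v \<and> nbrs E v \<subseteq> nbrs E u \<and> card (nbrs E v) = 2))
    \<le> (\<Sum>i\<in>I. rexp (all_pairs V) p (\<lambda>E. of_bool (case i of (v, u, x, y) \<Rightarrow>
         ?X v u x y \<subseteq> E \<and> E \<inter> ?Y v u x y = {})))"
  proof (rule rexp_union_bound[OF finI assms(2,3)])
    fix E assume E: "E \<subseteq> all_pairs V"
      and "\<exists>v\<in>V. \<exists>u\<in>V. u \<noteq> v \<and> nbrs E v \<subseteq> nbrs E u \<and> card (nbrs E v) = 2"
    then obtain v u x y where vu: "v \<in> V" "u \<in> V" "u \<noteq> v" "nbrs E v \<subseteq> nbrs E u"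
      and xy: "nbrs E v = {x, y}" "x \<noteq> y"
      by (auto simp: card_2_iff)
    have "x \<in> V - {v}" "y \<in> V - {v}" "x \<in> V - {u}" "y \<in> V - {u}"
      using nbrs_subset[OF E, of v] nbrs_subset[OF E, of u] vu(4) xy(1) by auto
    then have "(v, u, x, y) \<in> I" using vu xy(2) by (auto simp: I_def)
    moreover have "?X v u x y \<subseteq> E" using xy(1) vu(4) by (simp add: star_subset_iff)
    moreover have "E \<inter> ?Y v u x y = {}" using xy(1) by (auto simp: star_disjoint_iff)
    ultimately show "\<exists>i\<in>I. case i of (v, u, x, y) \<Rightarrow> ?X v u x y \<subseteq> E \<and> E \<inter> ?Y v u x y = {}"
      by blast
  qed
  also have "\<dots> = (\<Sum>i\<in>I. p ^ 4 * (1 - p) ^ (card V - 4))"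
  proof (rule sum.cong[OF refl])
    fix i assume "i \<in> I"
    then obtain v u x y where i: "i = (v, u, x, y)" "v \<in> V" "u \<in> V" "x \<in> V" "y \<in> V" "distinct [v, u, x, y]"
      by (auto simp: I_def)
    have "star v {x, y} \<inter> star u {x, y} = {}" using i by (intro star_disjoint) auto
    then have cX: "card (?X v u x y) = 4" using i by (simp add: card_Un_disjoint)
    have cY: "card (?Y v u x y) = card V - 4" using i assms(1) by (simp add: card_Diff_subset)
    have X: "?X v u x y \<subseteq> all_pairs V"
      using i star_subset_all_pairs[of v V "{x, y}"] star_subset_all_pairs[of u V "{x, y}"] by auto
    have Y: "?Y v u x y \<subseteq> all_pairs V" using i by (intro star_subset_all_pairs) auto
    have XY: "?X v u x y \<inter> ?Y v u x y = {}"
    proof -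
      have "?X v u x y = {{v, x}, {v, y}, {u, x}, {u, y}}" by (auto simp: star_def)
      then show ?thesis using i(6) by (simp add: doubleton_in_star)
    qed
    show "rexp (all_pairs V) p (\<lambda>E. of_bool (case i of (v, u, x, y) \<Rightarrow>
         ?X v u x y \<subseteq> E \<and> E \<inter> ?Y v u x y = {})) = p ^ 4 * (1 - p) ^ (card V - 4)"
      using rexp_pattern[OF _ X Y XY, of p] assms(1) unfolding i(1) prod.case cX cY by simp
  qed
  also have "\<dots> = real (card I) * (p ^ 4 * (1 - p) ^ (card V - 4))" by simp
  also have "\<dots> \<le> real (card V) ^ 4 * (p ^ 4 * (1 - p) ^ (card V - 4))"
  proof (rule mult_right_mono)
    have "card I \<le> card V * (card V * (card V * card V))"
      using card_mono[OF fin sub] by (simp add: card_cartesian_product)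
    also have "\<dots> = card V ^ 4" by (simp add: eval_nat_numeral)
    finally show "real (card I) \<le> real (card V) ^ 4" by (metis of_nat_le_iff of_nat_power)
  qed (use assms in auto)
  finally show ?thesis .
qed

text \<open>Bundles \<open>fold_indep\<close>, \<open>fold_sep\<close> and \<open>no_fold\<close> of
  the locale into one event. These are the conditions whose probability is estimated differently in
  the dense and in the sparse regime.\<close>

definition fold_regular :: "'a set \<Rightarrow> 'a set set \<Rightarrow> real \<Rightarrow> bool" where
  "fold_regular V E d \<longleftrightarrow>
    (\<forall>v\<in>foldable V E d. \<forall>w\<in>foldable V E d. {v, w} \<notin> E) \<and>
    (\<forall>v\<in>foldable V E d. \<forall>w\<in>foldable V E d. v \<noteq> w \<longrightarrow> (\<forall>x. \<not> ({x, v} \<in> E \<and> {x, w} \<in> E))) \<and>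
    (\<forall>u\<in>V. \<forall>v\<in>V. u \<noteq> v \<longrightarrow> \<not> nbrs E v \<subseteq> nbrs E u)"

lemma power_one_minus_le_exp:
  fixes x :: real
  assumes "x \<le> 1"
  shows "(1 - x) ^ k \<le> exp (- x * real k)"
proof -
  have "(1 - x) ^ k \<le> exp (- x) ^ k"
    using assms exp_ge_add_one_self[of "- x"] by (intro power_mono) auto
  then show ?thesis by (simp add: exp_of_nat_mult[symmetric] mult.commute)
qed

text \<open>A complete containment also makes v foldable, as 0 \<le> d. So all three conditions hold
  as soon as there is no foldable vertex.\<close>

lemma rexp_not_fold_regular_dense:
  assumes "finite V" "0 \<le> p" "p \<le> 1" "0 \<le> d"
  shows "rexp (all_pairs V) p (\<lambda>E. of_bool (\<not> fold_regular V E d))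
    \<le> (real (card V))\<^sup>2 * (5 powr d * (1 - p * (1 - p) * (4 / 5)) ^ (card V - 2))"
proof -
  have "rexp (all_pairs V) p (\<lambda>E. of_bool (\<not> fold_regular V E d))
    \<le> rexp (all_pairs V) p (\<lambda>E. of_bool (foldable V E d \<noteq> {}))"
  proof (rule rexp_mono[OF assms(2,3)])
    fix E :: "'a set set"
    have "fold_regular V E d" if empty: "foldable V E d = {}"
    proof -
      have "\<not> nbrs E v \<subseteq> nbrs E u" if "u \<in> V" "v \<in> V" "u \<noteq> v" for u v
      proof
        assume "nbrs E v \<subseteq> nbrs E u"
        then have "card (nbrs E v - nbrs E u) = 0" by (metis Diff_eq_empty_iff card.empty)
        then have "v \<in> foldable V E d" using that assms(4) by (force simp: foldable_def)
        then show False using empty by simp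
      qed
      then show ?thesis using empty by (simp add: fold_regular_def)
    qed
    then show "of_bool (\<not> fold_regular V E d) \<le> (of_bool (foldable V E d \<noteq> {}) :: real)"
      by (auto simp: of_bool_def)
  qed
  also have "\<dots> \<le> (real (card V))\<^sup>2 * (5 powr d * (1 - p * (1 - p) * (4 / 5)) ^ (card V - 2))"
    by (rule rexp_foldable[OF assms(1-3)])
  finally show ?thesis .
qed

lemma bexI2: "x \<in> A \<Longrightarrow> y \<in> B \<Longrightarrow> P x y \<Longrightarrow> \<exists>x\<in>A. \<exists>y\<in>B. P x y"
  by blast

text \<open>With at most two common neighbours per pair, foldable vertices have degree at most d +
  2, and two of these are neither adjacent nor joined by a path of length two. A completely
  dominated vertex has degree at most two; the degrees 0 and 1 and the degree 2 are excluded
  separately.\<close>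

lemma rexp_not_fold_regular_sparse:
  fixes V :: "'a set"
  assumes "finite V" "0 \<le> p" "p \<le> 1"
  shows "rexp (all_pairs V) p (\<lambda>E. of_bool (\<not> fold_regular V E d))
    \<le> real (card V) ^ 5 * p ^ 6
     + (real (card V) ^ 2 * p + real (card V) ^ 3 * p ^ 2) * (5 powr (d + 2) * (1 - 4 / 5 * p) ^ (card V - 3))\<^sup>2
     + (real (card V) * (1 - p) ^ (card V - 1) + real (card V) ^ 2 * (p * (1 - p) ^ (card V - 2)))
     + real (card V) ^ 4 * (p ^ 4 * (1 - p) ^ (card V - 4))"
proof -
  let ?A = "\<lambda>E. \<exists>u\<in>V. \<exists>v\<in>V. u \<noteq> v \<and> 3 \<le> card (nbrs E u \<inter> nbrs E v)"
  let ?B = "\<lambda>E. \<exists>v\<in>V. \<exists>w\<in>V. v \<noteq> w \<and> real (card (nbrs E v)) \<le> d + 2 \<and>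
      real (card (nbrs E w)) \<le> d + 2 \<and> ({v, w} \<in> E \<or> (\<exists>x. {x, v} \<in> E \<and> {x, w} \<in> E))"
  let ?C = "\<lambda>E. \<exists>v\<in>V. card (nbrs E v) \<le> 1"
  let ?D = "\<lambda>E. \<exists>v\<in>V. \<exists>u\<in>V. u \<noteq> v \<and> nbrs E v \<subseteq> nbrs E u \<and> card (nbrs E v) = 2"
  have "rexp (all_pairs V) p (\<lambda>E. of_bool (\<not> fold_regular V E d))
    \<le> rexp (all_pairs V) p (\<lambda>E. of_bool (?A E) + of_bool (?B E) + of_bool (?C E) + of_bool (?D E))"
  proof (rule rexp_mono[OF assms(2,3)])
    fix E assume E: "E \<subseteq> all_pairs V"
    have "fold_regular V E d" if nA: "\<not> ?A E" and nB: "\<not> ?B E" and nC: "\<not> ?C E" and nD: "\<not> ?D E"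
    proof -
      have fin: "finite (nbrs E v)" for v by (rule finite_nbrs[OF assms(1) E])
      have codeg: "card (nbrs E v \<inter> nbrs E u) \<le> 2" if "u \<in> V" "v \<in> V" "u \<noteq> v" for u v
      proof (rule ccontr)
        assume "\<not> ?thesis"
        then have "3 \<le> card (nbrs E v \<inter> nbrs E u)" by simp
        then have "?A E" using that by (intro bexI2[of v V u V]) auto
        then show False using nA by contradiction
      qed
      have low: "v \<in> V \<and> real (card (nbrs E v)) \<le> d + 2" if v: "v \<in> foldable V E d" for v
      proof -
        obtain u where u: "v \<in> V" "u \<in> V" "u \<noteq> v" "real (card (nbrs E v - nbrs E u)) \<le> d"
          using v by (auto simp: foldable_def)
        have "card (nbrs E v) = card (nbrs E v - nbrs E u) + card (nbrs E v \<inter> nbrs E u)"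
          using fin[of v] by (metis card_Diff_subset_Int add.commute card_Int_Diff finite_Int)
        then have "card (nbrs E v) \<le> card (nbrs E v - nbrs E u) + 2" using codeg[of u v] u by simp
        then have "real (card (nbrs E v)) \<le> real (card (nbrs E v - nbrs E u)) + 2" by linarith
        then show ?thesis using u by simp
      qed
      have "{v, w} \<notin> E" if "v \<in> foldable V E d" "w \<in> foldable V E d" for v w
      proof
        assume vw: "{v, w} \<in> E"
        then have "v \<noteq> w" using E by (auto simp: all_pairs_def)
        then have "?B E" using low[OF that(1)] low[OF that(2)] vw
          by (intro bexI2[of v V w V]) auto
        then show False using nB by contradiction
      qed
      moreover have "\<not> ({x, v} \<in> E \<and> {x, w} \<in> E)"
        if "v \<in> foldable V E d" "w \<in> foldable V E d" "v \<noteq> w" for v w x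
      proof
        assume "{x, v} \<in> E \<and> {x, w} \<in> E"
        then have "?B E" using low[OF that(1)] low[OF that(2)] that(3)
          by (intro bexI2[of v V w V]) auto
        then show False using nB by contradiction
      qed
      moreover have "\<not> nbrs E v \<subseteq> nbrs E u" if "u \<in> V" "v \<in> V" "u \<noteq> v" for u v
      proof
        assume sub: "nbrs E v \<subseteq> nbrs E u"
        then have "nbrs E v \<inter> nbrs E u = nbrs E v" by auto
        then have "card (nbrs E v) \<le> 2" using codeg[OF that] by simp
        moreover have "\<not> card (nbrs E v) \<le> 1" using nC that by auto
        ultimately have "card (nbrs E v) = 2" by simp
        then have "?D E" using that sub by (intro bexI2[of v V u V]) auto
        then show False using nD by contradiction
      qed
      ultimately show ?thesis unfolding fold_regular_def by blast
    qed
    then show "of_bool (\<not> fold_regular V E d)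
      \<le> (of_bool (?A E) + of_bool (?B E) + of_bool (?C E) + of_bool (?D E) :: real)"
      by (cases "?A E"; cases "?B E"; cases "?C E"; cases "?D E") (simp_all only: of_bool_def, simp_all)
  qed
  also have "\<dots> \<le> real (card V) ^ 5 * p ^ 6
     + (real (card V) ^ 2 * p + real (card V) ^ 3 * p ^ 2) * (5 powr (d + 2) * (1 - 4 / 5 * p) ^ (card V - 3))\<^sup>2
     + (real (card V) * (1 - p) ^ (card V - 1) + real (card V) ^ 2 * (p * (1 - p) ^ (card V - 2)))
     + real (card V) ^ 4 * (p ^ 4 * (1 - p) ^ (card V - 4))"
    unfolding rexp_add
    by (intro add_mono rexp_codegree rexp_close_low_degrees rexp_min_degree rexp_degree_two_fold assms)
  finally show ?thesis .
qed

text \<open>Outside the first three events the graph satisfies \<open>expanding_graph\<close>, so a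
  failure to be a core yields a forest retraction of more than m vertices. The next two events
  supply the bounds t and q assumed in the last one; the clique event starts at
  \<open>Suc q\<close>, since cliques of size q are allowed.\<close>

lemma rexp_not_core:
  fixes V :: "'a set"
  assumes "finite V" "0 \<le> p" "p \<le> 1" "2 \<le> card V" "2 \<le> d" "0 \<le> m"
  shows "rexp (all_pairs V) p (\<lambda>E. of_bool (\<not> homomorphic_core V E))
    \<le> rexp (all_pairs V) p (\<lambda>E. of_bool (\<not> fold_regular V E d))
    + rexp (all_pairs V) p (\<lambda>E. of_bool (\<exists>U\<subseteq>V. U \<noteq> {} \<and> real (card U) \<le> m \<and>
        real (card U) * (d / 4) \<le> real (card (E \<inter> all_pairs U))))
    + rexp (all_pairs V) p (\<lambda>E. of_bool (\<exists>K\<subseteq>V. real (card K) > m \<and> real (card (V - K)) > m \<and>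
        (\<forall>v\<in>K. \<forall>w\<in>V - K. {v, w} \<notin> E)))
    + rexp (all_pairs V) p (\<lambda>E. of_bool (\<exists>v\<in>V. t \<le> card (nbrs E v)))
    + rexp (all_pairs V) p (\<lambda>E. of_bool (\<exists>K\<subseteq>V. all_pairs K \<subseteq> E \<and> Suc q \<le> card K))
    + rexp (all_pairs V) p (\<lambda>E. of_bool ((\<exists>T\<subseteq>V. real (card T) > m \<and> forest_retraction V T E) \<and>
        (\<forall>v\<in>V. card (nbrs E v) \<le> t) \<and> (\<forall>K\<subseteq>V. all_pairs K \<subseteq> E \<longrightarrow> card K \<le> q)))"
proof -
  let ?A = "\<lambda>E. \<not> fold_regular V E d"
  let ?B = "\<lambda>E. \<exists>U\<subseteq>V. U \<noteq> {} \<and> real (card U) \<le> m \<and>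
        real (card U) * (d / 4) \<le> real (card (E \<inter> all_pairs U))"
  let ?C = "\<lambda>E. \<exists>K\<subseteq>V. real (card K) > m \<and> real (card (V - K)) > m \<and>
        (\<forall>v\<in>K. \<forall>w\<in>V - K. {v, w} \<notin> E)"
  let ?D = "\<lambda>E. \<exists>v\<in>V. t \<le> card (nbrs E v)"
  let ?F = "\<lambda>E. \<exists>K\<subseteq>V. all_pairs K \<subseteq> E \<and> Suc q \<le> card K"
  let ?G = "\<lambda>E. (\<exists>T\<subseteq>V. real (card T) > m \<and> forest_retraction V T E) \<and>
        (\<forall>v\<in>V. card (nbrs E v) \<le> t) \<and> (\<forall>K\<subseteq>V. all_pairs K \<subseteq> E \<longrightarrow> card K \<le> q)"
  have "rexp (all_pairs V) p (\<lambda>E. of_bool (\<not> homomorphic_core V E))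
    \<le> rexp (all_pairs V) p (\<lambda>E. of_bool (?A E) + of_bool (?B E) + of_bool (?C E) + of_bool (?D E)
       + of_bool (?F E) + of_bool (?G E))"
  proof (rule rexp_mono[OF assms(2,3)])
    fix E assume E: "E \<subseteq> all_pairs V"
    have "homomorphic_core V E"
      if n: "\<not> ?A E" "\<not> ?B E" "\<not> ?C E" "\<not> ?D E" "\<not> ?F E" "\<not> ?G E"
    proof (rule ccontr)
      assume nc: "\<not> homomorphic_core V E"
      note fr = n(1)[unfolded not_not fold_regular_def]
      note fr1 = fr[THEN conjunct1] and fr2 = fr[THEN conjunct2, THEN conjunct1]
        and fr3 = fr[THEN conjunct2, THEN conjunct2]
      interpret expanding_graph V E d m
      proof
        show "{v, w} \<notin> E" if "v \<in> foldable V E d" "w \<in> foldable V E d" for v w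
          by (rule fr1[THEN bspec, THEN bspec, OF that])
        show False if "v \<in> foldable V E d" "w \<in> foldable V E d" "v \<noteq> w" "{x, v} \<in> E" "{x, w} \<in> E"
          for x v w 
          using fr2[THEN bspec, THEN bspec, THEN mp, OF that(1-3)] that(4,5) by simp
        show "\<not> nbrs E v \<subseteq> nbrs E u" if "u \<in> V" "v \<in> V" "u \<noteq> v" for u v
          by (rule fr3[THEN bspec, THEN bspec, THEN mp, OF that])
        show "real (card (E \<inter> all_pairs U)) < real (card U) * (d / 4)"
          if "U \<subseteq> V" "U \<noteq> {}" "real (card U) \<le> m" for U
        proof (rule ccontr)
          assume "\<not> ?thesis"
          then have "?B E" using that by (intro exI[of _ U]) auto
          then show False using n(2) by contradiction
        qed
        show "\<exists>v\<in>K. \<exists>w\<in>V - K. {v, w} \<in> E"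
          if "K \<subseteq> V" "real (card K) > m" "real (card (V - K)) > m" for K
        proof (rule ccontr)
          assume "\<not> ?thesis"
          then have "?C E" using that by (intro exI[of _ K]) auto
          then show False using n(3) by contradiction
        qed
      qed (use assms E in auto)
      have "\<exists>T\<subseteq>V. real (card T) > m \<and> forest_retraction V T E"
        by (rule not_core_forest_retraction[OF nc])
      moreover have "\<forall>v\<in>V. card (nbrs E v) \<le> t" 
      proof
        show "card (nbrs E v) \<le> t" if "v \<in> V" for v
        proof (rule ccontr)
          assume "\<not> ?thesis"
          then have "?D E" using that by (intro bexI[of _ v]) auto
          then show False using n(4) by contradiction
        qed
      qed
      moreover have "\<forall>K\<subseteq>V. all_pairs K \<subseteq> E \<longrightarrow> card K \<le> q" 
      proof (intro allI impI)
        show "card K \<le> q" if "K \<subseteq> V" "all_pairs K \<subseteq> E" for K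
        proof (rule ccontr)
          assume "\<not> ?thesis"
          then have "?F E" using that by (intro exI[of _ K]) auto
          then show False using n(5) by contradiction
        qed
      qed
      ultimately have "?G E" by blast
      then show False using n(6) by contradiction
    qed
    then have *: "\<not> homomorphic_core V E \<Longrightarrow> ?A E \<or> ?B E \<or> ?C E \<or> ?D E \<or> ?F E \<or> ?G E" by argo
    show "of_bool (\<not> homomorphic_core V E) \<le> (of_bool (?A E) + of_bool (?B E) + of_bool (?C E) + of_bool (?D E)
       + of_bool (?F E) + of_bool (?G E) :: real)"
      using of_bool_le_add[of "\<not> homomorphic_core V E" "?A E \<or> ?B E \<or> ?C E \<or> ?D E \<or> ?F E" "?G E"]
        of_bool_le_add[of "?A E \<or> ?B E \<or> ?C E \<or> ?D E \<or> ?F E" "?A E \<or> ?B E \<or> ?C E \<or> ?D E" "?F E"]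
        of_bool_le_add[of "?A E \<or> ?B E \<or> ?C E \<or> ?D E" "?A E \<or> ?B E \<or> ?C E" "?D E"]
        of_bool_le_add[of "?A E \<or> ?B E \<or> ?C E" "?A E \<or> ?B E" "?C E"]
        of_bool_le_add[of "?A E \<or> ?B E" "?A E" "?B E"] *
      by argo
  qed
  then show ?thesis unfolding rexp_add .
qed

section \<open>Numerical estimates\<close>

text \<open>As c p \<le> 1 / 2, each of the j missing factors costs at most exp (1 / 2).\<close>

lemma power_one_minus_le_exp_shift:
  fixes p c :: real
  assumes "0 \<le> p" "p \<le> 1 / 2" "0 \<le> c" "c \<le> 1" "j \<le> n"
  shows "(1 - c * p) ^ (n - j) \<le> exp (real j / 2 - c * (real n * p))"
proof -
  have cp: "c * p \<le> 1 * (1 / 2)" using assms by (intro mult_mono) auto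
  have "(1 - c * p) ^ (n - j) \<le> exp (- (c * p) * real (n - j))"
    using cp by (intro power_one_minus_le_exp) auto
  also have "\<dots> = exp (c * p * real j - c * (real n * p))"
    using assms(5) by (simp add: of_nat_diff algebra_simps)
  also have "\<dots> \<le> exp (real j / 2 - c * (real n * p))"
  proof -
    have "c * p * real j \<le> 1 * (1 / 2) * real j" using cp by (intro mult_right_mono) auto
    then show ?thesis by simp
  qed
  finally show ?thesis .
qed

lemma five_powr_le_exp:
  fixes x :: real
  assumes "0 \<le> x"
  shows "5 powr x \<le> exp (2 * x)"
proof -
  have "(5 :: real) \<le> exp 1 * exp 1"
    using exp_lower_Taylor_quadratic[of "1 :: real"] mult_mono[of "5 / 2" "exp 1" "5 / 2" "exp (1 :: real)"]
    by (simp add: power2_eq_square)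
  then have "(5 :: real) \<le> exp 2" by (simp flip: exp_add)
  then have "ln 5 \<le> ln (exp (2 :: real))" by (intro ln_mono) auto
  then have "ln 5 \<le> (2 :: real)" by (simp only: ln_exp)
  then have "x * ln 5 \<le> x * 2" using assms by (rule mult_left_mono)
  then show ?thesis by (simp add: powr_def mult.commute)
qed

lemma exp_small_bounds: "exp (1 :: real) \<le> 272 / 100" "exp (2 :: real) \<le> 8"
proof -
  show e: "exp (1 :: real) \<le> 272 / 100" using e_less_272 by simp
  have "exp (2 :: real) = exp 1 * exp 1" by (simp flip: exp_add)
  also have "\<dots> \<le> 272 / 100 * (272 / 100)" using e by (intro mult_mono) auto
  finally show "exp (2 :: real) \<le> 8" by simp
qed

text \<open>From p \<le> 1 / 2 follows p (1 - p) \<ge> p / 2, so the decay is exp (- 2 D / 5); the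
  factor 5^(D / 40) costs at most exp (D / 20). For D \<ge> 10 L the remaining 7 D / 20 exceeds the
  2 L spent on pairs by at least 3 L / 2.\<close>

lemma fold_bound_dense:
  fixes n :: nat and p :: real
  assumes p: "0 \<le> p" "p \<le> 1 / 2" and n: "2 \<le> n"
    and D: "D = real n * p" "10 * ln (real n) \<le> D" and L: "1 \<le> ln (real n)"
  shows "(real n)\<^sup>2 * (5 powr (D / 40) * (1 - p * (1 - p) * (4 / 5)) ^ (n - 2)) \<le> 3 * exp (- ln (real n))"
proof -
  have D0: "0 \<le> D" using p D(1) by simp
  have "p * (1 / 2) \<le> p * (1 - p)" using p by (intro mult_left_mono) auto
  then have le: "2 / 5 * p \<le> p * (1 - p) * (4 / 5)" by simp
  have "p * (1 - p) \<le> 1 * 1" using p by (intro mult_mono) auto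
  then have "0 \<le> 1 - p * (1 - p) * (4 / 5)" by simp
  then have "(1 - p * (1 - p) * (4 / 5)) ^ (n - 2) \<le> (1 - 2 / 5 * p) ^ (n - 2)"
    using le by (intro power_mono) auto
  also have "\<dots> \<le> exp (real 2 / 2 - 2 / 5 * (real n * p))"
    using p n by (intro power_one_minus_le_exp_shift) auto
  finally have 1: "(1 - p * (1 - p) * (4 / 5)) ^ (n - 2) \<le> exp (1 - 2 / 5 * D)" by (simp add: D(1))
  have 2: "5 powr (D / 40) \<le> exp (2 * (D / 40))" using D0 by (intro five_powr_le_exp) simp
  have 3: "(real n)\<^sup>2 = exp (2 * ln (real n))"
    using n by (simp add: exp_double)
  have "(real n)\<^sup>2 * (5 powr (D / 40) * (1 - p * (1 - p) * (4 / 5)) ^ (n - 2))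
    \<le> exp (2 * ln (real n)) * (exp (2 * (D / 40)) * exp (1 - 2 / 5 * D))"
    unfolding 3 using 1 2 \<open>0 \<le> 1 - p * (1 - p) * (4 / 5)\<close>
    by (intro mult_left_mono mult_mono) auto
  also have "\<dots> = exp (2 * ln (real n) + 2 * (D / 40) + 1 - 2 / 5 * D)"
    by (simp flip: exp_add)
  also have "\<dots> \<le> exp (1 + - ln (real n))" unfolding exp_le_cancel_iff using D(2) L by linarith
  also have "\<dots> = exp 1 * exp (- ln (real n))" by (rule exp_add)
  also have "\<dots> \<le> 3 * exp (- ln (real n))"
    using exp_small_bounds by (intro mult_right_mono) auto
  finally show ?thesis .
qed

text \<open>Only the third summand is of threshold order. The first is D^6 / n. In the second each
  low degree contributes exp (- 3 L / 4), where 3 / 4 = 4 / 5 - 2 / 40; two of them beat the factor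
  n = exp L, which is why d = D / 40 is small enough. The fourth is about D^4 exp (- D).\<close>

lemma fold_bound_sparse:
  fixes n :: nat and p :: real
  assumes p: "0 \<le> p" "p \<le> 1 / 2" and n: "4 \<le> n"
    and L: "L = ln (real n)" "1 \<le> L"
    and D: "D = real n * p" "L \<le> D" "D \<le> 10 * L"
  shows "real n ^ 5 * p ^ 6
     + (real n ^ 2 * p + real n ^ 3 * p ^ 2) * (5 powr (D / 40 + 2) * (1 - 4 / 5 * p) ^ (n - 3))\<^sup>2
     + (real n * (1 - p) ^ (n - 1) + real n ^ 2 * (p * (1 - p) ^ (n - 2)))
     + real n ^ 4 * (p ^ 4 * (1 - p) ^ (n - 4))
   \<le> (10 * L) ^ 6 * exp (- L) + 40000 * (10 * L + (10 * L)\<^sup>2) * exp (- L / 2)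
     + 30 * exp (- (D - L - ln L)) + 8 * (10 * L) ^ 4 * exp (- L)"
proof -
  have D0: "0 \<le> D" using D L by simp
  have n0: "real n > 0" using n by simp
  have nL: "real n = exp L" using L n0 by simp
  have "real n ^ 5 * p ^ 6 = D ^ 6 * exp (- L)"
    using n0 by (simp add: D(1) nL[symmetric] exp_minus power_mult_distrib eval_nat_numeral field_simps)
  also have "\<dots> \<le> (10 * L) ^ 6 * exp (- L)"
    using D D0 by (intro mult_right_mono power_mono) auto
  finally have T1: "real n ^ 5 * p ^ 6 \<le> (10 * L) ^ 6 * exp (- L)" .
  have pw: "(1 - c * p) ^ (n - j) \<le> exp (real j / 2 - c * D)" if "0 \<le> c" "c \<le> 1" "j \<le> 4" for c j
    unfolding D(1) using p n that by (intro power_one_minus_le_exp_shift) auto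
  have "5 powr (D / 40 + 2) = 25 * 5 powr (D / 40)"
    by (simp add: powr_add powr_numeral)
  also have "\<dots> \<le> 25 * exp (2 * (D / 40))"
    using D0 five_powr_le_exp[of "D / 40"] by simp
  finally have five: "5 powr (D / 40 + 2) \<le> 25 * exp (2 * (D / 40))" .
  have "5 powr (D / 40 + 2) * (1 - 4 / 5 * p) ^ (n - 3)
    \<le> 25 * exp (2 * (D / 40)) * exp (real 3 / 2 - 4 / 5 * D)"
    using five p by (intro mult_mono pw) auto
  also have "\<dots> = 25 * exp (3 / 2 - 3 / 4 * D)" by (simp flip: exp_add)
  also have "\<dots> \<le> 25 * exp (2 + - (3 / 4 * L))" using D by simp
  also have "\<dots> \<le> 25 * (8 * exp (- (3 / 4 * L)))"
    unfolding exp_add using exp_small_bounds by (intro mult_left_mono mult_right_mono) auto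
  finally have tau: "5 powr (D / 40 + 2) * (1 - 4 / 5 * p) ^ (n - 3) \<le> 200 * exp (- (3 / 4 * L))" by simp
  have "(real n ^ 2 * p + real n ^ 3 * p ^ 2) = exp L * (D + D\<^sup>2)"
    by (simp add: D(1) nL[symmetric] power_mult_distrib eval_nat_numeral algebra_simps)
  also have "\<dots> \<le> exp L * (10 * L + (10 * L)\<^sup>2)"
    using D D0 by (intro mult_left_mono add_mono power_mono) auto
  finally have "(real n ^ 2 * p + real n ^ 3 * p ^ 2) * (5 powr (D / 40 + 2) * (1 - 4 / 5 * p) ^ (n - 3))\<^sup>2
    \<le> exp L * (10 * L + (10 * L)\<^sup>2) * (200 * exp (- (3 / 4 * L)))\<^sup>2"
    using p L by (intro mult_mono power_mono[OF tau]) auto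
  also have "\<dots> = 40000 * (10 * L + (10 * L)\<^sup>2) * (exp L * (exp (- (3 / 4 * L)))\<^sup>2)"
    by (simp add: power2_eq_square)
  also have "exp L * (exp (- (3 / 4 * L)))\<^sup>2 = exp (- L / 2)"
    by (simp add: power2_eq_square flip: exp_add)
  finally have T2: "(real n ^ 2 * p + real n ^ 3 * p ^ 2) * (5 powr (D / 40 + 2) * (1 - 4 / 5 * p) ^ (n - 3))\<^sup>2
    \<le> 40000 * (10 * L + (10 * L)\<^sup>2) * exp (- L / 2)" .
  have "real n * (1 - p) ^ (n - 1) + real n ^ 2 * (p * (1 - p) ^ (n - 2))
    = exp L * ((1 - p) ^ (n - 1) + D * (1 - p) ^ (n - 2))"
    by (simp add: D(1) nL[symmetric] power2_eq_square algebra_simps)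
  also have "\<dots> \<le> exp L * (exp (1 - D) + D * exp (1 - D))"
  proof (intro mult_left_mono add_mono)
    have "(1 - p) ^ (n - 1) \<le> exp (1 / 2 - D)" using pw[of 1 1] by simp
    also have "\<dots> \<le> exp (1 - D)" by simp
    finally show "(1 - p) ^ (n - 1) \<le> exp (1 - D)" .
    show "(1 - p) ^ (n - 2) \<le> exp (1 - D)" using pw[of 1 2] by simp
  qed (use D0 in auto)
  also have "\<dots> = exp 1 * (1 + D) * exp (L - D)"
    by (simp add: exp_diff exp_minus field_simps)
  also have "\<dots> \<le> 272 / 100 * (11 * L) * exp (L - D)"
    using D L D0 exp_small_bounds(1) by (intro mult_right_mono mult_mono) auto
  \<comment> \<open>The factor 1 + D is at most 11 L and is cancelled by the denominator L. This is
    the role of log log n in the threshold.\<close>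
  also have "exp (L - D) = exp (- (D - L - ln L)) / L"
  proof -
    have "exp (L - D) = exp (- (D - L - ln L) - ln L)" by simp
    also have "\<dots> = exp (- (D - L - ln L)) / exp (ln L)" by (rule exp_diff)
    also have "exp (ln L) = L" using L(2) by simp
    finally show ?thesis .
  qed
  also have "272 / 100 * (11 * L) * (exp (- (D - L - ln L)) / L) = 2992 / 100 * exp (- (D - L - ln L))"
    using L by simp
  also have "\<dots> \<le> 30 * exp (- (D - L - ln L))" by (intro mult_right_mono) auto
  finally have T3: "real n * (1 - p) ^ (n - 1) + real n ^ 2 * (p * (1 - p) ^ (n - 2))
    \<le> 30 * exp (- (D - L - ln L))" .
  have "real n ^ 4 * (p ^ 4 * (1 - p) ^ (n - 4)) = D ^ 4 * (1 - p) ^ (n - 4)"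
    by (simp add: D(1) power_mult_distrib)
  also have "\<dots> \<le> (10 * L) ^ 4 * exp (2 + - D)"
    using D D0 p pw[of 1 4] by (intro mult_mono power_mono) auto
  also have "\<dots> \<le> (10 * L) ^ 4 * (8 * exp (- L))"
    unfolding exp_add using exp_small_bounds D by (intro mult_left_mono mult_mono) auto
  finally have T4: "real n ^ 4 * (p ^ 4 * (1 - p) ^ (n - 4)) \<le> 8 * (10 * L) ^ 4 * exp (- L)" by simp
  show ?thesis by (intro add_mono T1 T2 T3 T4)
qed

text \<open>For t \<ge> 8 D the base is at most e / 8, which is at most 1 / e because e^2 \<le> 8.
  The resulting exp (- t) absorbs the choice of the vertex.\<close>

lemma max_degree_bound:
  fixes n t :: nat and D :: real
  assumes "n > 0" "ln (real n) \<le> D" "1 \<le> D" "8 * D \<le> real t"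
  shows "real n * (exp 1 * D / real t) ^ t \<le> exp (- ln (real n))"
proof -
  have t0: "real t > 0" using assms by linarith
  have "exp 1 * D / real t \<le> exp 1 * D / (8 * D)" using assms t0 by (intro divide_left_mono) auto
  also have "\<dots> = exp 1 / 8" using assms by simp
  also have "\<dots> \<le> exp (- 1)"
  proof -
    have "exp 1 * exp (1 :: real) \<le> 8" using exp_small_bounds(2) by (simp flip: exp_add)
    then show ?thesis by (simp add: exp_minus field_simps)
  qed
  finally have "(exp 1 * D / real t) ^ t \<le> exp (- 1) ^ t" using assms by (intro power_mono) auto
  also have "\<dots> = exp (- real t)" by (simp add: exp_of_nat_mult[symmetric])
  also have "\<dots> \<le> exp (- 2 * ln (real n))" using assms by simp
  finally have "real n * (exp 1 * D / real t) ^ t \<le> exp (ln (real n)) * exp (- 2 * ln (real n))"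
    using assms by (intro mult_mono) auto
  also have "\<dots> = exp (- ln (real n))" by (simp flip: exp_add)
  finally show ?thesis .
qed

text \<open>It suffices that q (- ln p) \<ge> 4 L, which holds for two reasons. If p \<le> exp (- L
  / 2), then - ln p \<ge> L / 2 and q \<ge> 8 is enough. Otherwise sqrt (n p) \<ge> exp (L / 4), so
  q is exponentially large in L, while p \<le> 1 / 2 keeps - ln p at least ln 2.\<close>

lemma clique_bound:
  fixes n q :: nat and p :: real
  assumes p: "0 < p" "p \<le> 1 / 2" and n: "n > 0" and L: "L = ln (real n)" "1 \<le> L"
    and q: "sqrt (real n * p) \<le> real q" "8 \<le> real q" and big: "4 * L \<le> exp (L / 4) * ln 2"
  shows "real n ^ Suc q * p ^ (Suc q choose 2) \<le> exp (- L)"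
proof -
  have nL: "real n = exp L" using L n by simp
  have lnp: "ln p \<le> - ln 2"
    using p ln_mono[of p "1 / 2"] by (simp add: ln_div)
  have key: "4 * L \<le> real q * (- ln p)"
  proof (cases "p \<le> exp (- L / 2)")
    case True
    then have "ln p \<le> - L / 2" using p ln_mono[of p "exp (- L / 2)"] by simp
    then have "8 * (L / 2) \<le> real q * (- ln p)" using q L by (intro mult_mono) auto
    then show ?thesis by simp
  next
    case False
    then have "exp L * exp (- L / 2) \<le> real n * p" unfolding nL by (intro mult_left_mono) auto
    then have "exp (L / 2) \<le> real n * p" by (simp flip: exp_add)
    moreover have "exp (L / 2) = (exp (L / 4))\<^sup>2" by (simp add: power2_eq_square flip: exp_add)
    ultimately have "exp (L / 4) \<le> sqrt (real n * p)" by (intro real_le_rsqrt) simp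
    then have "exp (L / 4) \<le> real q" using q by linarith
    then have "exp (L / 4) * ln 2 \<le> real q * (- ln p)" using lnp by (intro mult_mono) auto
    then show ?thesis using big by linarith
  qed
  have "(Suc q choose 2) * 2 = Suc q * q" unfolding choose_two by simp
  then have "real ((Suc q choose 2) * 2) = real (Suc q * q)" by (rule arg_cong)
  then have C: "real (Suc q choose 2) = real (Suc q) * real q / 2" unfolding of_nat_mult by simp
  have "real n ^ Suc q * p ^ (Suc q choose 2) = exp (real (Suc q) * L) * exp (real (Suc q choose 2) * ln p)"
    using p by (simp only: nL exp_of_nat_mult exp_ln)
  also have "\<dots> = exp (real (Suc q) * (L - real q * (- ln p) / 2))"
    unfolding C exp_add[symmetric] by (simp add: algebra_simps)
  also have "\<dots> \<le> exp (real (Suc q) * (- L))"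
    unfolding exp_le_cancel_iff using key by (intro mult_left_mono) auto
  also have "\<dots> \<le> exp (- L)" using L by simp
  finally show ?thesis .
qed

text \<open>Per vertex the exponent collects ln 2 for the choice of T, ln (9 D^2) for forest and
  map, and p \<le> 1 for the correction in Turan's bound. The gain is D / (2 q 1000^2) with q \<le>
  2 sqrt D, that is sqrt D / 4000000.\<close>

lemma forest_bound:
  fixes n t q :: nat and p :: real
  assumes p: "0 \<le> p" "p \<le> 1" and D: "D = real n * p" "1 \<le> D"
    and t: "0 < real t" "real t \<le> 9 * D" and q: "0 < real q" "real q \<le> 2 * sqrt D"
    and small: "ln 2 + ln (9 * D\<^sup>2) + 1 - sqrt D / 4000000 \<le> - 1"
  shows "2 ^ n * ((real n * real t * p) ^ n * exp (p * real n - p * (real n / 1000)\<^sup>2 / (2 * real q))) \<le> exp (- real n)"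
proof -
  have "real n * real t * p = D * real t" by (simp add: D)
  also have "\<dots> \<le> D * (9 * D)" using D t by (intro mult_left_mono) auto
  finally have 1: "real n * real t * p \<le> exp (ln (9 * D\<^sup>2))" using D(2) by (simp add: power2_eq_square)
  have "sqrt D * sqrt D = D" using D(2) by simp
  then have "sqrt D / 4000000 = D / (2000000 * (2 * sqrt D))" using D(2) by (simp add: field_simps)
  also have "\<dots> \<le> D / (2000000 * real q)" using D q by (intro divide_left_mono) auto
  finally have "real n * (sqrt D / 4000000) \<le> real n * (D / (2000000 * real q))" by (intro mult_left_mono) auto
  also have "\<dots> = p * (real n / 1000)\<^sup>2 / (2 * real q)" by (simp add: D(1) power2_eq_square field_simps)
  finally have "p * real n - p * (real n / 1000)\<^sup>2 / (2 * real q) \<le> 1 * real n - real n * (sqrt D / 4000000)"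
    using p by (intro diff_mono mult_right_mono) auto
  then have 2: "exp (p * real n - p * (real n / 1000)\<^sup>2 / (2 * real q)) \<le> exp (real n * (1 - sqrt D / 4000000))"
    by (simp add: algebra_simps)
  have "2 ^ n * ((real n * real t * p) ^ n * exp (p * real n - p * (real n / 1000)\<^sup>2 / (2 * real q)))
    \<le> 2 ^ n * (exp (ln (9 * D\<^sup>2)) ^ n * exp (real n * (1 - sqrt D / 4000000)))"
    using 1 2 p t by (intro mult_left_mono mult_mono power_mono) auto
  also have "\<dots> = exp (real n * ln 2) * (exp (real n * ln (9 * D\<^sup>2)) * exp (real n * (1 - sqrt D / 4000000)))"
    by (simp only: exp_of_nat_mult exp_ln)
  also have "\<dots> = exp (real n * (ln 2 + ln (9 * D\<^sup>2) + 1 - sqrt D / 4000000))"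
    by (simp add: algebra_simps flip: exp_add)
  also have "\<dots> \<le> exp (real n * (- 1))"
    unfolding exp_le_cancel_iff using small by (intro mult_left_mono) auto
  finally show ?thesis by simp
qed

lemma cut_bound:
  fixes n :: nat and p :: real
  assumes "4000 \<le> real n * p"
  shows "2 ^ n * exp (- p * (real n / 1000 * real n / 2)) \<le> exp (- real n)"
proof -
  have "(2 :: real) ^ n = exp (real n * ln 2)" by (simp add: exp_of_nat_mult)
  then have "2 ^ n * exp (- p * (real n / 1000 * real n / 2)) = exp (real n * (ln 2 - real n * p / 2000))"
    by (simp add: algebra_simps flip: exp_add)
  also have "\<dots> \<le> exp (real n * (- 1))"
    unfolding exp_le_cancel_iff using assms ln_2_less_1 by (intro mult_left_mono) auto
  finally show ?thesis by simp
qed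

section \<open>Asymptotics above and below the threshold\<close>

lemma threshold_lower:
  fixes p :: "nat \<Rightarrow> real"
  assumes "filterlim (\<lambda>n. real n * p n - ln (real n) - ln (ln (real n))) at_top sequentially"
  shows "\<forall>\<^sub>F n in sequentially. ln (real n) \<le> real n * p n"
    "filterlim (\<lambda>n. real n * p n) at_top sequentially"
proof -
  have L: "filterlim (\<lambda>n. ln (real n)) at_top sequentially" by real_asymp
  have "\<forall>\<^sub>F n in sequentially. 0 \<le> real n * p n - ln (real n) - ln (ln (real n))"
    using assms unfolding filterlim_at_top by (rule spec)
  moreover have "\<forall>\<^sub>F n in sequentially. 1 \<le> ln (real n)" using L by (simp add: filterlim_at_top)
  ultimately show *: "\<forall>\<^sub>F n in sequentially. ln (real n) \<le> real n * p n"
  proof eventually_elim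
    case (elim n)
    then have "0 \<le> ln (ln (real n))" by simp
    then show ?case using elim by linarith
  qed
  show "filterlim (\<lambda>n. real n * p n) at_top sequentially"
    by (rule filterlim_at_top_mono[OF L *])
qed

lemma large_expected_degree:
  fixes D :: "nat \<Rightarrow> real"
  assumes "filterlim D at_top sequentially"
  shows "\<forall>\<^sub>F n in sequentially. 10000 \<le> D n"
    "\<forall>\<^sub>F n in sequentially. ln 2 + ln (9 * (D n)\<^sup>2) + 1 - sqrt (D n) / 4000000 \<le> - 1"
    "\<forall>\<^sub>F n in sequentially. 80 * exp (3 - D n / 160) \<le> 1 / 2"
    "(\<lambda>n. 160 * exp (3 - D n / 160)) \<longlonglongrightarrow> 0"
proof -
  show "\<forall>\<^sub>F n in sequentially. 10000 \<le> D n" using assms by (simp add: filterlim_at_top)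
  have "\<forall>\<^sub>F x :: real in at_top. ln 2 + ln (9 * x\<^sup>2) + 1 - sqrt x / 4000000 \<le> - 1" by real_asymp
  then show "\<forall>\<^sub>F n in sequentially. ln 2 + ln (9 * (D n)\<^sup>2) + 1 - sqrt (D n) / 4000000 \<le> - 1"
    using assms by (rule eventually_compose_filterlim)
  have "\<forall>\<^sub>F x :: real in at_top. 80 * exp (3 - x / 160) \<le> 1 / 2" by real_asymp
  then show "\<forall>\<^sub>F n in sequentially. 80 * exp (3 - D n / 160) \<le> 1 / 2"
    using assms by (rule eventually_compose_filterlim)
  have "((\<lambda>x :: real. 160 * exp (3 - x / 160)) \<longlongrightarrow> 0) at_top" by real_asymp
  then show "(\<lambda>n. 160 * exp (3 - D n / 160)) \<longlonglongrightarrow> 0"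
    using assms by (rule filterlim_compose)
qed

text \<open>The bound of \<open>fold_bound_sparse\<close> with w for D - L - ln L. Separating w from
  L lets each summand tend to zero along its own divergent parameter.\<close>

definition fold_error :: "real \<Rightarrow> real \<Rightarrow> real" where
  "fold_error L w = (10 * L) ^ 6 * exp (- L) + 40000 * (10 * L + (10 * L)\<^sup>2) * exp (- L / 2)
     + 30 * exp (- w) + 8 * (10 * L) ^ 4 * exp (- L)"

lemma fold_error_tendsto:
  fixes w :: "nat \<Rightarrow> real"
  assumes "filterlim w at_top sequentially"
  shows "(\<lambda>n. fold_error (ln (real n)) (w n)) \<longlonglongrightarrow> 0"
proof -
  have "((\<lambda>x :: real. 30 * exp (- x)) \<longlongrightarrow> 0) at_top" by real_asymp
  then have w: "(\<lambda>n. 30 * exp (- w n)) \<longlonglongrightarrow> 0" using assms by (rule filterlim_compose)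
  have L: "filterlim (\<lambda>n. ln (real n)) at_top sequentially" by real_asymp
  have "((\<lambda>L :: real. (10 * L) ^ 6 * exp (- L) + 40000 * (10 * L + (10 * L)\<^sup>2) * exp (- L / 2)
     + 8 * (10 * L) ^ 4 * exp (- L)) \<longlongrightarrow> 0) at_top" by real_asymp
  then have "(\<lambda>n. (10 * ln (real n)) ^ 6 * exp (- ln (real n))
     + 40000 * (10 * ln (real n) + (10 * ln (real n))\<^sup>2) * exp (- ln (real n) / 2)
     + 8 * (10 * ln (real n)) ^ 4 * exp (- ln (real n))) \<longlonglongrightarrow> 0"
    using L by (rule filterlim_compose)
  from tendsto_add[OF this w] show ?thesis
    by (simp add: fold_error_def algebra_simps)
qed

lemma eventually_quarter_exp:
  "\<forall>\<^sub>F n in sequentially. 4 * ln (real n) \<le> exp (ln (real n) / 4) * ln 2"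
proof -
  have "\<forall>\<^sub>F x :: real in at_top. 4 * x \<le> exp (x / 4) * ln 2" by real_asymp
  moreover have "filterlim (\<lambda>n. ln (real n)) at_top sequentially" by real_asymp
  ultimately show ?thesis by (rule eventually_compose_filterlim)
qed

lemma exp_errors_tendsto:
  "(\<lambda>n. exp (- real n)) \<longlonglongrightarrow> 0" "(\<lambda>n. exp (- ln (real n))) \<longlonglongrightarrow> 0"
  by real_asymp+

text \<open>For D \<le> L / 2 the isolated vertices alone make \<mu> at least exp (L / 2 - 1). For
  larger D the vertices of degree one contribute the extra factor D \<ge> L / 2, and \<mu> is at
  least a constant times exp (- (D - L - ln L)). The remaining term of the left side is
  O(p).\<close>

lemma expected_low_degree_bound:
  fixes n :: nat and p \<mu> :: real
  assumes p: "0 \<le> p" "p \<le> 1 / 2" and n: "3 \<le> n"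
    and L: "L = ln (real n)" "1 \<le> L" and D: "D = real n * p" "D \<le> 2 * L"
    and sq: "8 * L\<^sup>2 * exp (- L) \<le> 1"
    and \<mu>: "real n * ((1 - p) * ((1 - p) ^ (n - 2) + real (n - 2) * p * (1 - p) ^ (n - 3))) \<le> \<mu>"
  shows "1 / \<mu> + (1 / (1 - p)\<^sup>2 - 1) \<le> exp (1 - L / 2) + 2 * exp (1 + (D - L - ln L)) + 16 * L * exp (- L)"
proof -
  have n0: "real n > 0" using n by simp
  have nL: "real n = exp L" using L n0 by simp
  have D0: "0 \<le> D" using D p by simp
  have pD: "p = D * exp (- L)" using n0 by (simp add: D(1) nL[symmetric] exp_minus)
  \<comment> \<open>The second order error 2 n p^2 of n ln (1 - p) is at most 8 L^2 exp (- L) \<le>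
    1, so (1 - p)^n is within a constant factor of exp (- D).\<close>
  have "real n * (p + 2 * p\<^sup>2) \<le> D + 1"
  proof -
    have "2 * (real n * p\<^sup>2) = 2 * (D\<^sup>2 * exp (- L))"
      using n0 by (simp add: D(1) nL[symmetric] exp_minus power2_eq_square)
    also have "\<dots> \<le> 2 * ((2 * L)\<^sup>2 * exp (- L))"
      using D D0 by (intro mult_left_mono mult_right_mono power_mono) auto
    also have "2 * ((2 * L)\<^sup>2 * exp (- L)) \<le> 1" using sq by (simp add: power2_eq_square)
    finally show ?thesis by (simp add: D(1) distrib_left)
  qed
  moreover have "- p - 2 * p\<^sup>2 \<le> ln (1 - p)" using p by (intro ln_one_minus_pos_lower_bound) auto
  then have "real n * (- p - 2 * p\<^sup>2) \<le> real n * ln (1 - p)" by (intro mult_left_mono) auto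
  ultimately have "- (D + 1) \<le> real n * ln (1 - p)" by (simp add: algebra_simps)
  then have "exp (- (D + 1)) \<le> exp (real n * ln (1 - p))" by simp
  also have "\<dots> = (1 - p) ^ n" using p by (simp add: exp_of_nat_mult)
  finally have pn: "exp (- D - 1) \<le> (1 - p) ^ n" by simp
  \<comment> \<open>A lower bound for 1 + (n - 2) p serving both regimes of D: it uses only 2 p
    \<le> 1.\<close>
  define x where "x = max 1 D"
  have "exp (L - D - 1) * x = real n * (exp (- D - 1) * x)"
    by (simp add: nL flip: exp_add)
  also have "\<dots> \<le> real n * ((1 - p) ^ n * (1 + real (n - 2) * p))"
  proof (intro mult_left_mono mult_mono pn)
    have "D - 1 \<le> real (n - 2) * p" using p n D(1) by (simp add: of_nat_diff algebra_simps)
    then show "x \<le> 1 + real (n - 2) * p" using p by (auto simp: x_def)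
  qed (use p in \<open>auto simp: x_def\<close>)
  also have "\<dots> \<le> real n * ((1 - p) * ((1 - p) ^ (n - 2) + real (n - 2) * p * (1 - p) ^ (n - 3)))"
  proof (rule mult_left_mono)
    obtain k where k: "n = k + 3" using n by (metis le_add_diff_inverse2)
    have a: "(1 - p) ^ n \<le> (1 - p) * (1 - p) ^ (n - 2)" "(1 - p) ^ n \<le> (1 - p) * (1 - p) ^ (n - 3)"
      unfolding power_Suc[symmetric] using p by (intro power_decreasing; simp add: k)+
    have "(1 - p) ^ n * (1 + real (n - 2) * p) = (1 - p) ^ n + real (n - 2) * p * (1 - p) ^ n"
      by (simp add: algebra_simps)
    also have "\<dots> \<le> (1 - p) * (1 - p) ^ (n - 2) + real (n - 2) * p * ((1 - p) * (1 - p) ^ (n - 3))"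
      using p by (intro add_mono mult_left_mono a) auto
    also have "\<dots> = (1 - p) * ((1 - p) ^ (n - 2) + real (n - 2) * p * (1 - p) ^ (n - 3))"
      by (simp add: algebra_simps)
    finally show "(1 - p) ^ n * (1 + real (n - 2) * p)
      \<le> (1 - p) * ((1 - p) ^ (n - 2) + real (n - 2) * p * (1 - p) ^ (n - 3))" .
  qed simp
  also note \<mu>
  finally have \<mu>x: "exp (L - D - 1) * x \<le> \<mu>" .
  have x1: "1 \<le> x" "D \<le> x" by (auto simp: x_def)
  then have \<mu>0: "0 < exp (L - D - 1) * x" by simp
  have "1 / \<mu> \<le> 1 / (exp (L - D - 1) * x)" using \<mu>x \<mu>0 by (intro divide_left_mono) auto
  also have "\<dots> \<le> exp (1 - L / 2) + 2 * exp (1 + (D - L - ln L))"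
  proof (cases "D \<le> L / 2")
    case True
    have "1 / (exp (L - D - 1) * x) \<le> 1 / (exp (L - D - 1) * 1)"
      using x1 by (intro divide_left_mono mult_left_mono) auto
    also have "\<dots> = exp (1 + D - L)" by (simp add: exp_diff exp_add field_simps)
    also have "\<dots> \<le> exp (1 - L / 2)" using True by simp
    finally show ?thesis by (simp add: add_increasing2)
  next
    case False
    have "1 / (exp (L - D - 1) * x) \<le> 1 / (exp (L - D - 1) * (L / 2))"
      using x1 False L by (intro divide_left_mono mult_left_mono) auto
    also have "\<dots> = 2 * exp (1 + D - L) / L" by (simp add: exp_diff exp_add field_simps)
    also have "\<dots> = 2 * (exp (1 + D - L) / exp (ln L))" using L(2) by simp
    also have "exp (1 + D - L) / exp (ln L) = exp (1 + D - L - ln L)" by (rule exp_diff[symmetric])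
    finally show ?thesis by (simp add: algebra_simps add_increasing)
  qed
  finally have 1: "1 / \<mu> \<le> exp (1 - L / 2) + 2 * exp (1 + (D - L - ln L))" .
  have "(1 / 2)\<^sup>2 \<le> (1 - p)\<^sup>2" using p by (intro power_mono) auto
  then have q4: "1 / 4 \<le> (1 - p)\<^sup>2" by (simp add: power2_eq_square)
  have "p * (2 - p) = 1 - (1 - p)\<^sup>2" by (simp add: power2_eq_square algebra_simps)
  then have "1 / (1 - p)\<^sup>2 - 1 = p * (2 - p) / (1 - p)\<^sup>2"
    using p by (simp add: diff_divide_distrib)
  also have "\<dots> \<le> p * (2 - p) / (1 / 4)" using p q4 by (intro divide_left_mono) auto
  also have "\<dots> \<le> 8 * p" using p by (simp add: algebra_simps)
  also have "\<dots> \<le> 8 * (2 * L * exp (- L))" unfolding pD using D(2) by (intro mult_left_mono mult_right_mono) auto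
  finally show ?thesis using 1 by simp
qed

lemma threshold_upper:
  fixes p :: "nat \<Rightarrow> real"
  assumes w: "filterlim (\<lambda>n. real n * p n - ln (real n) - ln (ln (real n))) at_bot sequentially"
  shows "\<forall>\<^sub>F n in sequentially. real n * p n \<le> 2 * ln (real n)"
    "\<forall>\<^sub>F n in sequentially. 8 * (ln (real n))\<^sup>2 * exp (- ln (real n)) \<le> 1"
    "\<forall>\<^sub>F n in sequentially. 1 \<le> ln (real n)"
    "(\<lambda>n. exp (1 - ln (real n) / 2) + 2 * exp (1 + (real n * p n - ln (real n) - ln (ln (real n))))
      + 16 * ln (real n) * exp (- ln (real n))) \<longlonglongrightarrow> 0"
proof -
  have L: "filterlim (\<lambda>n. ln (real n)) at_top sequentially" by real_asymp
  have "\<forall>\<^sub>F n in sequentially. real n * p n - ln (real n) - ln (ln (real n)) \<le> 0"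
    using w unfolding filterlim_at_bot by (rule spec)
  moreover have "\<forall>\<^sub>F n in sequentially. ln (ln (real n)) \<le> ln (real n)" by real_asymp
  ultimately show "\<forall>\<^sub>F n in sequentially. real n * p n \<le> 2 * ln (real n)"
    by eventually_elim linarith
  have "\<forall>\<^sub>F x :: real in at_top. 8 * x\<^sup>2 * exp (- x) \<le> 1" by real_asymp
  then show "\<forall>\<^sub>F n in sequentially. 8 * (ln (real n))\<^sup>2 * exp (- ln (real n)) \<le> 1"
    using L by (rule eventually_compose_filterlim)
  show "\<forall>\<^sub>F n in sequentially. 1 \<le> ln (real n)" using L by (simp add: filterlim_at_top)
  have "((\<lambda>x :: real. 2 * exp (1 + x)) \<longlongrightarrow> 0) at_bot" by real_asymp
  then have a: "(\<lambda>n. 2 * exp (1 + (real n * p n - ln (real n) - ln (ln (real n))))) \<longlonglongrightarrow> 0"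
    using w by (rule filterlim_compose)
  have "((\<lambda>x :: real. exp (1 - x / 2) + 16 * x * exp (- x)) \<longlongrightarrow> 0) at_top" by real_asymp
  then have "(\<lambda>n. exp (1 - ln (real n) / 2) + 16 * ln (real n) * exp (- ln (real n))) \<longlonglongrightarrow> 0"
    using L by (rule filterlim_compose)
  from tendsto_add[OF this a] show "(\<lambda>n. exp (1 - ln (real n) / 2)
      + 2 * exp (1 + (real n * p n - ln (real n) - ln (ln (real n))))
      + 16 * ln (real n) * exp (- ln (real n))) \<longlonglongrightarrow> 0"
    by (simp add: algebra_simps)
qed

section \<open>Vertices of degree at most one\<close>

text \<open>Sending v to u and fixing everything else is an endomorphism, and it identifies u with
  v.\<close>

lemma not_core_if_fold:
  assumes "finite V" "E \<subseteq> all_pairs V" "u \<in> V" "v \<in> V" "u \<noteq> v" "nbrs E v \<subseteq> nbrs E u"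
  shows "\<not> homomorphic_core V E"
proof
  assume core: "homomorphic_core V E"
  define f where "f = id(v := u)"
  have e: "{f x, f y} \<in> E" if xy: "{x, y} \<in> E" for x y
  proof -
    have ne: "x \<noteq> y" using xy assms(2) by (auto simp: doubleton_in_all_pairs all_pairs_def)
    consider "x = v" "y \<noteq> v" | "y = v" "x \<noteq> v" | "x \<noteq> v" "y \<noteq> v" using ne by blast
    then show ?thesis
    proof cases
      case 1
      then have "y \<in> nbrs E u" using xy assms(6) by (auto simp: nbrs_def)
      then show ?thesis using 1 by (simp add: f_def nbrs_def)
    next
      case 2
      then have "x \<in> nbrs E u" using xy assms(6) by (auto simp: nbrs_def insert_commute)
      then show ?thesis using 2 by (simp add: f_def nbrs_def insert_commute)
    next
      case 3
      then show ?thesis using xy by (simp add: f_def)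
    qed
  qed
  have "f \<in> V \<rightarrow> V" using assms(3) by (auto simp: f_def)
  then have "graph_endomorphism V E f" using e by (simp add: graph_endomorphism_def)
  then have "inj_on f V"
    using core by (auto simp: homomorphic_core_def graph_automorphism_def bij_betw_def)
  moreover have "f v = f u" using assms(5) by (simp add: f_def)
  ultimately show False using assms(3-5) by (auto dest: inj_onD)
qed

text \<open>An isolated vertex folds onto any other one. A leaf v at w folds onto another neighbour
  of w. If there is none, vw is a component by itself and folds onto an edge elsewhere, unless the
  rest has an isolated vertex. The bound 3 excludes the single edge, which is a core.\<close>

lemma not_core_if_low_degree:
  assumes fin: "finite V" and E: "E \<subseteq> all_pairs V" and V3: "3 \<le> card V"
    and v: "v \<in> V" "card (nbrs E v) \<le> 1"
  shows "\<not> homomorphic_core V E"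
proof -
  have isolated: "\<not> homomorphic_core V E" if x: "x \<in> V" "nbrs E x = {}" for x
  proof -
    have "\<not> V \<subseteq> {x}"
    proof
      assume "V \<subseteq> {x}"
      then have "card V \<le> 1" using card_mono[of "{x}" V] by simp
      then show False using V3 by simp
    qed
    then obtain u where "u \<in> V" "u \<noteq> x" by blast
    then show ?thesis using x by (intro not_core_if_fold[OF fin E, of u x]) auto
  qed
  show ?thesis
  proof (cases "nbrs E v = {}")
    case True
    then show ?thesis using isolated v by blast
  next
    case False
    then have "card (nbrs E v) = 1"
      using v finite_nbrs[OF fin E, of v] by (simp add: card_gt_0_iff le_antisym Suc_leI)
    then obtain w where w: "nbrs E v = {w}" by (auto simp: card_1_singleton_iff)
    have wV: "w \<in> V" "w \<noteq> v" using nbrs_subset[OF E, of v] w by auto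
    have vw: "v \<in> nbrs E w" using w nbrs_commute[of w E v] by simp
    show ?thesis
    proof (cases "nbrs E w = {v}")
      case False
      then obtain x where x: "x \<in> nbrs E w" "x \<noteq> v" using vw by blast
      then have "x \<in> V" "w \<in> nbrs E x" using nbrs_subset[OF E, of w] nbrs_commute[of w E x] by auto
      then show ?thesis using w x v by (intro not_core_if_fold[OF fin E, of x v]) auto
    next
      case True
      have "\<not> V \<subseteq> {v, w}"
      proof
        assume "V \<subseteq> {v, w}"
        then have "card V \<le> card {v, w}" by (intro card_mono) auto
        also have "\<dots> \<le> 2" by (simp add: card_insert_if)
        finally show False using V3 by simp
      qed
      then obtain u where u: "u \<in> V" "u \<noteq> v" "u \<noteq> w" by blast
      show ?thesis
      proof (cases "nbrs E u = {}")
        case True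
        then show ?thesis using isolated u by blast
      next
        case False
        then obtain y where y: "y \<in> nbrs E u" by blast
        have uy: "u \<in> nbrs E y" using y nbrs_commute[of y E u] by simp
        have yV: "y \<in> V" using y nbrs_subset[OF E, of u] by auto
        show ?thesis
        proof
          assume core: "homomorphic_core V E"
          \<comment> \<open>The isolated edge vw is laid onto the edge uy.\<close>
          define f where "f = id(v := u, w := y)"
          have e: "{f a, f b} \<in> E" if ab: "{a, b} \<in> E" for a b
          proof -
            have "a \<in> nbrs E b" "b \<in> nbrs E a" using ab by (auto simp: nbrs_def insert_commute)
            then have "a = v \<and> b = w \<or> a = w \<and> b = v \<or> a \<notin> {v, w} \<and> b \<notin> {v, w}"
              using w True by auto
            then show ?thesis
            proof (elim disjE)
              assume "a = v \<and> b = w"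
              then show ?thesis using y wV by (simp add: f_def nbrs_def)
            next
              assume "a = w \<and> b = v"
              then show ?thesis using uy wV by (simp add: f_def nbrs_def)
            next
              assume "a \<notin> {v, w} \<and> b \<notin> {v, w}"
              then show ?thesis using ab by (simp add: f_def)
            qed
          qed
          have "f \<in> V \<rightarrow> V" using u yV by (auto simp: f_def)
          then have "graph_endomorphism V E f" using e by (simp add: graph_endomorphism_def)
          then have "inj_on f V"
            using core by (auto simp: homomorphic_core_def graph_automorphism_def bij_betw_def)
          moreover have "f v = f u" using u wV by (simp add: f_def)
          ultimately show False using u v by (auto dest: inj_onD)
        qed
      qed
    qed
  qed
qed

section \<open>The second moment method for vertices of degree at most one\<close>

lemma rexp_card_le_1:
  "finite A \<Longrightarrow> rexp A p (\<lambda>E. of_bool (card E \<le> 1)) =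
    (1 - p) ^ card A + real (card A) * p * (1 - p) ^ (card A - 1)"
proof (induction A rule: finite_induct)
  case (insert a A)
  have "rexp A p (\<lambda>E. of_bool (card (insert a E) \<le> 1)) = rexp A p (\<lambda>E. of_bool (E \<inter> A = {}))"
  proof (rule rexp_cong)
    fix E assume "E \<subseteq> A"
    then have "finite E" "a \<notin> E" "E \<inter> A = E" using insert.hyps finite_subset by auto
    then show "of_bool (card (insert a E) \<le> 1) = (of_bool (E \<inter> A = {}) :: real)" by simp
  qed
  also have "\<dots> = (1 - p) ^ card A" by (rule rexp_disjoint[OF insert.hyps(1)])
  finally have 1: "rexp A p (\<lambda>E. of_bool (card (insert a E) \<le> 1)) = (1 - p) ^ card A" .
  have "rexp (insert a A) p (\<lambda>E. of_bool (card E \<le> 1)) =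
    (1 - p) * ((1 - p) ^ card A + real (card A) * p * (1 - p) ^ (card A - 1)) + p * (1 - p) ^ card A"
    unfolding rexp_insert[OF insert.hyps] 1 insert.IH ..
  also have "(1 - p) * ((1 - p) ^ card A + real (card A) * p * (1 - p) ^ (card A - 1)) =
    (1 - p) ^ Suc (card A) + real (card A) * p * (1 - p) ^ card A"
    by (cases "card A") (auto simp: algebra_simps)
  finally show ?case using insert.hyps by (simp add: algebra_simps)
qed simp

text \<open>Chebyshev's inequality: on Q the sum vanishes, so its squared distance from \<mu> is
  \<mu>^2 there, while the variance is at most s - \<mu>^2.\<close>

lemma rexp_second_moment:
  fixes Y :: "'b \<Rightarrow> 'a set \<Rightarrow> real"
  assumes "finite A" "0 \<le> p" "p \<le> 1"
    and Q: "\<And>E. E \<subseteq> A \<Longrightarrow> Q E \<Longrightarrow> (\<Sum>v\<in>V. Y v E) = 0"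
    and \<mu>: "\<mu> = (\<Sum>v\<in>V. rexp A p (Y v))" "0 < \<mu>"
    and S: "(\<Sum>v\<in>V. \<Sum>w\<in>V. rexp A p (\<lambda>E. Y v E * Y w E)) \<le> s"
  shows "rexp A p (\<lambda>E. of_bool (Q E)) \<le> (s - \<mu>\<^sup>2) / \<mu>\<^sup>2"
proof -
  let ?X = "\<lambda>E. \<Sum>v\<in>V. Y v E"
  have "\<mu>\<^sup>2 * rexp A p (\<lambda>E. of_bool (Q E)) = rexp A p (\<lambda>E. \<mu>\<^sup>2 * of_bool (Q E))"
    by (simp add: rexp_cmult)
  also have "\<dots> \<le> rexp A p (\<lambda>E. (\<Sum>v\<in>V. \<Sum>w\<in>V. Y v E * Y w E) + ((- 2 * \<mu>) * ?X E + \<mu>\<^sup>2))"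
  proof (rule rexp_mono[OF assms(2,3)])
    fix E assume E: "E \<subseteq> A"
    have "(\<Sum>v\<in>V. \<Sum>w\<in>V. Y v E * Y w E) = (?X E)\<^sup>2"
      by (simp add: power2_eq_square sum_product)
    then have eq: "(\<Sum>v\<in>V. \<Sum>w\<in>V. Y v E * Y w E) + ((- 2 * \<mu>) * ?X E + \<mu>\<^sup>2) = (?X E - \<mu>)\<^sup>2"
      by (simp add: power2_diff)
    show "\<mu>\<^sup>2 * of_bool (Q E) \<le> (\<Sum>v\<in>V. \<Sum>w\<in>V. Y v E * Y w E) + ((- 2 * \<mu>) * ?X E + \<mu>\<^sup>2)"
      unfolding eq using Q[OF E] by (cases "Q E") auto
  qed
  also have "\<dots> = (\<Sum>v\<in>V. \<Sum>w\<in>V. rexp A p (\<lambda>E. Y v E * Y w E)) + ((- 2 * \<mu>) * \<mu> + \<mu>\<^sup>2)"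
    unfolding rexp_add rexp_cmult rexp_sum \<mu>(1)[symmetric] using assms(1) by simp
  also have "\<dots> \<le> s - \<mu>\<^sup>2" using S by (simp add: power2_eq_square)
  finally show ?thesis using \<mu>(2) by (simp add: field_simps)
qed

text \<open>The events for v and w depend on each other only through the pair {v, w}. Ignoring this
  pair bounds the joint probability by q0^2; demanding its absence bounds the single probability
  below by (1 - p) q0. Hence the second moment is at most \<mu> + \<mu>^2 / (1 - p)^2. The mean
  stays existentially quantified, as only its lower bound matters later.\<close>

lemma rexp_core_le:
  fixes V :: "'a set"
  assumes V: "finite V" "3 \<le> card V" and p: "0 \<le> p" "p < 1"
  defines "q0 \<equiv> (1 - p) ^ (card V - 2) + real (card V - 2) * p * (1 - p) ^ (card V - 3)"
  shows "\<exists>\<mu>. real (card V) * ((1 - p) * q0) \<le> \<mu> \<and>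
    rexp (all_pairs V) p (\<lambda>E. of_bool (homomorphic_core V E)) \<le> 1 / \<mu> + (1 / (1 - p)\<^sup>2 - 1)"
proof -
  let ?A = "all_pairs V"
  define Y :: "'a \<Rightarrow> 'a set set \<Rightarrow> real" where "Y v E = of_bool (card (nbrs E v) \<le> 1)" for v E
  define \<mu> where "\<mu> = (\<Sum>v\<in>V. rexp ?A p (Y v))"
  have finA: "finite ?A" using V by simp
  have "0 < (1 - p) ^ (card V - 2)" using p by simp
  then have q0: "0 < q0" unfolding q0_def using p by (intro add_pos_nonneg) auto
  have star: "rexp (star v W) p (\<lambda>E. of_bool (card E \<le> 1)) = q0" if "finite W" "card W = card V - 2" for v :: 'a and W
  proof -
    have "card V - 2 - 1 = card V - 3" by simp
    then show ?thesis unfolding q0_def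
      using rexp_card_le_1[of "star v W" p] that by (simp only: finite_star card_star)
  qed
  have W: "finite (V - {v, w})" "card (V - {v, w}) = card V - 2" if "v \<in> V" "w \<in> V" "v \<noteq> w" for v w
    using that V by (auto simp: card_Diff_subset)
  have card_le: "card (E \<inter> star v (V - {v, w})) \<le> card (nbrs E v)" if "E \<subseteq> ?A" for E v w
    using finite_nbrs[OF V(1) that] by (auto simp: star_inter intro: card_mono)
  have single: "(1 - p) * q0 \<le> rexp ?A p (Y v)" if v: "v \<in> V" for v
  proof -
    have "\<not> V \<subseteq> {v}"
    proof
      assume "V \<subseteq> {v}"
      then have "card V \<le> 1" using card_mono[of "{v}" V] by simp
      then show False using V by simp
    qed
    then obtain w where w: "w \<in> V" "w \<noteq> v" by blast
    let ?W = "V - {v, w}"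
    have "(1 - p) * q0 = rexp {{v, w}} p (\<lambda>E. of_bool (E \<inter> {{v, w}} = {})) *
        rexp (star v ?W) p (\<lambda>E. of_bool (card E \<le> 1))"
      using rexp_disjoint[of "{{v, w}}" p] star[OF W] v w by simp
    also have "\<dots> = rexp ?A p (\<lambda>E. of_bool (E \<inter> {{v, w}} \<inter> {{v, w}} = {}) * of_bool (card (E \<inter> star v ?W) \<le> 1))"
    proof (rule rexp_indep[symmetric, OF finA])
      show "{{v, w}} \<subseteq> ?A" using v w by (simp add: doubleton_in_all_pairs)
      show "star v ?W \<subseteq> ?A" using v by (intro star_subset_all_pairs) auto
      show "{{v, w}} \<inter> star v ?W = {}" using w by (simp add: doubleton_in_star)
    qed
    also have "\<dots> \<le> rexp ?A p (Y v)"
    proof (rule rexp_mono)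
      fix E assume E: "E \<subseteq> ?A"
      show "of_bool (E \<inter> {{v, w}} \<inter> {{v, w}} = {}) * of_bool (card (E \<inter> star v ?W) \<le> 1) \<le> Y v E"
      proof (cases "{v, w} \<in> E")
        case False
        then have "nbrs E v = nbrs E v \<inter> ?W" using nbrs_subset[OF E, of v] by (auto simp: nbrs_def)
        then have "card (nbrs E v) = card (E \<inter> star v ?W)" by (simp add: star_inter)
        then show ?thesis by (simp add: Y_def)
      qed (simp add: Y_def)
    qed (use p in auto)
    finally show ?thesis .
  qed
  have pair: "rexp ?A p (\<lambda>E. Y v E * Y w E) \<le> q0\<^sup>2" if vw: "v \<in> V" "w \<in> V" "v \<noteq> w" for v w
  proof -
    let ?W = "V - {v, w}"
    have "rexp ?A p (\<lambda>E. Y v E * Y w E) \<le>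
      rexp ?A p (\<lambda>E. of_bool (card (E \<inter> star v ?W) \<le> 1) * of_bool (card (E \<inter> star w ?W) \<le> 1))"
    proof (rule rexp_mono)
      fix E assume E: "E \<subseteq> ?A"
      have "card (E \<inter> star v ?W) \<le> card (nbrs E v)" "card (E \<inter> star w ?W) \<le> card (nbrs E w)"
        using card_le[OF E, of v w] card_le[OF E, of w v] by (simp_all add: insert_commute)
      then show "Y v E * Y w E \<le> of_bool (card (E \<inter> star v ?W) \<le> 1) * of_bool (card (E \<inter> star w ?W) \<le> 1)"
        unfolding Y_def by (intro mult_mono) (auto simp: of_bool_def)
    qed (use p in auto)
    also have "\<dots> = rexp (star v ?W) p (\<lambda>E. of_bool (card E \<le> 1)) * rexp (star w ?W) p (\<lambda>E. of_bool (card E \<le> 1))"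
    proof (rule rexp_indep[OF finA])
      show "star v ?W \<subseteq> ?A" "star w ?W \<subseteq> ?A" 
        using vw star_subset_all_pairs[of v V ?W] star_subset_all_pairs[of w V ?W] by auto
      show "star v ?W \<inter> star w ?W = {}" using vw by (intro star_disjoint) auto
    qed
    also have "\<dots> = q0\<^sup>2" using star[OF W[OF vw]] by (simp add: power2_eq_square)
    finally show ?thesis .
  qed
  have \<mu>ge: "real (card V) * ((1 - p) * q0) \<le> \<mu>"
    unfolding \<mu>_def using sum_mono[of V "\<lambda>_. (1 - p) * q0" "\<lambda>v. rexp ?A p (Y v)"] single by simp
  have \<mu>0: "0 < \<mu>"
  proof -
    have "0 < real (card V) * ((1 - p) * q0)" using V p q0 by auto
    then show ?thesis using \<mu>ge by linarith
  qed
  have YY: "(\<lambda>E. Y v E * Y v E) = Y v" for v by (auto simp: Y_def)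
  have "(\<Sum>v\<in>V. \<Sum>w\<in>V. rexp ?A p (\<lambda>E. Y v E * Y w E)) \<le> (\<Sum>v\<in>V. \<Sum>w\<in>V. (if v = w then rexp ?A p (Y v) else 0) + q0\<^sup>2)"
  proof (intro sum_mono)
    fix v w assume "v \<in> V" "w \<in> V"
    then show "rexp ?A p (\<lambda>E. Y v E * Y w E) \<le> (if v = w then rexp ?A p (Y v) else 0) + q0\<^sup>2"
      using pair[of v w] YY[of v] by (cases "v = w") simp_all
  qed
  also have "\<dots> = \<mu> + (real (card V) * q0)\<^sup>2"
    using V(1) by (simp add: sum.distrib \<mu>_def power2_eq_square)
  also have "\<dots> \<le> \<mu> + \<mu>\<^sup>2 / (1 - p)\<^sup>2"
  proof -
    have "real (card V) * q0 \<le> \<mu> / (1 - p)" using \<mu>ge p by (simp add: field_simps)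
    then have "(real (card V) * q0)\<^sup>2 \<le> (\<mu> / (1 - p))\<^sup>2" using q0 by (intro power_mono) auto
    then show ?thesis by (simp add: power_divide)
  qed
  finally have S: "(\<Sum>v\<in>V. \<Sum>w\<in>V. rexp ?A p (\<lambda>E. Y v E * Y w E)) \<le> \<mu> + \<mu>\<^sup>2 / (1 - p)\<^sup>2" .
  have "rexp ?A p (\<lambda>E. of_bool (homomorphic_core V E)) \<le> (\<mu> + \<mu>\<^sup>2 / (1 - p)\<^sup>2 - \<mu>\<^sup>2) / \<mu>\<^sup>2"
  proof (rule rexp_second_moment[OF finA _ _ _ \<mu>_def \<mu>0 S])
    fix E assume E: "E \<subseteq> ?A" "homomorphic_core V E"
    have "\<not> card (nbrs E v) \<le> 1" if "v \<in> V" for v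
      using not_core_if_low_degree[OF V(1) E(1) V(2) that] E(2) by blast
    then show "(\<Sum>v\<in>V. Y v E) = 0" by (simp add: Y_def)
  qed (use p in auto)
  also have "\<dots> = 1 / \<mu> + (1 / (1 - p)\<^sup>2 - 1)"
    using \<mu>0 p by (simp add: diff_divide_distrib add_divide_distrib power2_eq_square)
  finally show ?thesis using \<mu>ge by blast
qed

section \<open>The threshold\<close>

text \<open>The six error terms correspond in order to the six events of
  \<open>rexp_not_core\<close>; the first one adds the sparse and the dense estimate, so that it is
  valid in both regimes.\<close>

lemma rexp_not_core_bound:
  fixes n :: nat and p :: real
  defines "L \<equiv> ln (real n)" and "D \<equiv> real n * p"
  assumes p: "0 \<le> p" "p \<le> 1 / 2" and n: "4 \<le> n" and L: "1 \<le> L"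
    and D: "L \<le> D" "10000 \<le> D"
    and small: "ln 2 + ln (9 * D\<^sup>2) + 1 - sqrt D / 4000000 \<le> - 1"
      "80 * exp (3 - D / 160) \<le> 1 / 2" "4 * L \<le> exp (L / 4) * ln 2"
  shows "rexp (all_pairs {1..n}) p (\<lambda>E. of_bool (\<not> homomorphic_core {1..n} E))
    \<le> (fold_error L (D - L - ln L) + 3 * exp (- L)) + 160 * exp (3 - D / 160) + exp (- real n)
      + exp (- L) + exp (- L) + exp (- real n)"
proof -
  let ?V = "{1..n}"
  \<comment> \<open>With this d the edge density d / 4 is the D / 160 of the dense set estimate.
    Rounding up t and q keeps them below 9 D and 2 sqrt D, because D is large.\<close>
  define d where "d = D / 40"
  define m where "m = real n / 1000"
  define t where "t = nat \<lceil>8 * D\<rceil>"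
  define q where "q = nat \<lceil>sqrt D\<rceil>"
  have p1: "p \<le> 1" and p0: "0 < p"
    using p D(2) by (auto simp: D_def intro: ccontr)
  have n0: "0 < n" using n by simp
  have D1: "1 \<le> D" using D by simp
  have t: "8 * D \<le> real t" "real t \<le> 9 * D" "0 < t" unfolding t_def using D1 by linarith+
  have sD: "100 \<le> sqrt D" using D(2) real_le_rsqrt[of 100 D] by simp
  then have q: "sqrt D \<le> real q" "real q \<le> 2 * sqrt D" "8 \<le> real q" "1 \<le> q" unfolding q_def by linarith+
  have A: "rexp (all_pairs ?V) p (\<lambda>E. of_bool (\<not> fold_regular ?V E d))
      \<le> fold_error L (D - L - ln L) + 3 * exp (- L)"
  \<comment> \<open>At D = 10 L both estimates apply: below, D^6 / n is still small; above, the
    decay in D beats the union over pairs of vertices.\<close>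
  proof (cases "D \<le> 10 * L")
    case True
    have "rexp (all_pairs ?V) p (\<lambda>E. of_bool (\<not> fold_regular ?V E d)) \<le> fold_error L (D - L - ln L)"
      using rexp_not_fold_regular_sparse[of ?V p d]
        fold_bound_sparse[OF p n L_def[THEN meta_eq_to_obj_eq] L D_def[THEN meta_eq_to_obj_eq] D(1) True] p p1
      unfolding d_def fold_error_def by simp
    moreover have "0 \<le> 3 * exp (- L)" by simp
    ultimately show ?thesis by linarith
  next
    case False
    have "rexp (all_pairs ?V) p (\<lambda>E. of_bool (\<not> fold_regular ?V E d)) \<le> 3 * exp (- L)"
      using rexp_not_fold_regular_dense[of ?V p d] fold_bound_dense[OF p, of n D] p p1 n False L D1
      unfolding d_def L_def D_def by simp
    moreover have "0 \<le> fold_error L (D - L - ln L)" using L by (simp add: fold_error_def)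
    ultimately show ?thesis by linarith
  qed
  have B: "rexp (all_pairs ?V) p (\<lambda>E. of_bool (\<exists>U\<subseteq>?V. U \<noteq> {} \<and> real (card U) \<le> m \<and>
      real (card U) * (d / 4) \<le> real (card (E \<inter> all_pairs U)))) \<le> 160 * exp (3 - D / 160)"
    using rexp_dense_set[of ?V p m "d / 4"] small(2) p p1 by (simp add: d_def m_def D_def)
  have C: "rexp (all_pairs ?V) p (\<lambda>E. of_bool (\<exists>K\<subseteq>?V. real (card K) > m \<and> real (card (?V - K)) > m \<and>
      (\<forall>v\<in>K. \<forall>w\<in>?V - K. {v, w} \<notin> E))) \<le> exp (- real n)"
  proof -
    have "2 ^ n * exp (- p * (m * real n / 2)) \<le> exp (- real n)"
      using cut_bound[of n p] D(2) by (simp add: m_def D_def)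
    then show ?thesis using rexp_cut[of ?V p m] p p1 by (simp add: m_def)
  qed
  have Dg: "rexp (all_pairs ?V) p (\<lambda>E. of_bool (\<exists>v\<in>?V. t \<le> card (nbrs E v))) \<le> exp (- L)"
    using rexp_max_degree[of ?V p t] max_degree_bound[OF n0, of D t] p p1 t D(1) D1
    by (simp add: L_def D_def)
  have F: "rexp (all_pairs ?V) p (\<lambda>E. of_bool (\<exists>K\<subseteq>?V. all_pairs K \<subseteq> E \<and> Suc q \<le> card K)) \<le> exp (- L)"
    using rexp_clique[of ?V p "Suc q"]
      clique_bound[OF p0 p(2) n0 L_def[THEN meta_eq_to_obj_eq] L q(1)[unfolded D_def] q(3) small(3)] p p1
    by simp
  have "1 * 1 \<le> D * real t" using D1 t by (intro mult_mono) auto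
  then have Dt: "1 \<le> real n * real t * p" by (simp add: D_def mult.commute mult.left_commute)
  have G: "rexp (all_pairs ?V) p (\<lambda>E. of_bool ((\<exists>T\<subseteq>?V. real (card T) > m \<and> forest_retraction ?V T E) \<and>
      (\<forall>v\<in>?V. card (nbrs E v) \<le> t) \<and> (\<forall>K\<subseteq>?V. all_pairs K \<subseteq> E \<longrightarrow> card K \<le> q))) \<le> exp (- real n)"
    using rexp_some_forest_retraction[of ?V p q t m] Dt
      forest_bound[OF p(1) p1 D_def[THEN meta_eq_to_obj_eq] D1 _ t(2) _ q(2) small(1)] t(3) q(3,4) p p1
    by (simp add: m_def)
  have "rexp (all_pairs ?V) p (\<lambda>E. of_bool (\<not> homomorphic_core ?V E))
    \<le> rexp (all_pairs ?V) p (\<lambda>E. of_bool (\<not> fold_regular ?V E d))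
    + rexp (all_pairs ?V) p (\<lambda>E. of_bool (\<exists>U\<subseteq>?V. U \<noteq> {} \<and> real (card U) \<le> m \<and>
        real (card U) * (d / 4) \<le> real (card (E \<inter> all_pairs U))))
    + rexp (all_pairs ?V) p (\<lambda>E. of_bool (\<exists>K\<subseteq>?V. real (card K) > m \<and> real (card (?V - K)) > m \<and>
        (\<forall>v\<in>K. \<forall>w\<in>?V - K. {v, w} \<notin> E)))
    + rexp (all_pairs ?V) p (\<lambda>E. of_bool (\<exists>v\<in>?V. t \<le> card (nbrs E v)))
    + rexp (all_pairs ?V) p (\<lambda>E. of_bool (\<exists>K\<subseteq>?V. all_pairs K \<subseteq> E \<and> Suc q \<le> card K))
    + rexp (all_pairs ?V) p (\<lambda>E. of_bool ((\<exists>T\<subseteq>?V. real (card T) > m \<and> forest_retraction ?V T E) \<and>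
        (\<forall>v\<in>?V. card (nbrs E v) \<le> t) \<and> (\<forall>K\<subseteq>?V. all_pairs K \<subseteq> E \<longrightarrow> card K \<le> q)))"
    using p p1 n D by (intro rexp_not_core) (auto simp: d_def m_def)
  then show ?thesis using A B C Dg F G by linarith
qed

lemma not_core_prob_tendsto_0:
  fixes p :: "nat \<Rightarrow> real"
  assumes p: "\<And>n. 0 \<le> p n" "\<And>n. p n \<le> 1 / 2"
    and w: "filterlim (\<lambda>n. real n * p n - ln (real n) - ln (ln (real n))) at_top sequentially"
  shows "(\<lambda>n. rexp (all_pairs {1..n}) (p n) (\<lambda>E. of_bool (\<not> homomorphic_core {1..n} E))) \<longlonglongrightarrow> 0"
proof -
  let ?L = "\<lambda>n. ln (real n)" and ?D = "\<lambda>n. real n * p n"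
  let ?b = "\<lambda>n. (fold_error (?L n) (?D n - ?L n - ln (?L n)) + 3 * exp (- ?L n))
      + 160 * exp (3 - ?D n / 160) + exp (- real n) + exp (- ?L n) + exp (- ?L n) + exp (- real n)"
  note D = large_expected_degree[OF threshold_lower(2)[OF w]]
  have "filterlim ?L at_top sequentially" by (rule filterlim_compose[OF ln_at_top filterlim_real_sequentially])
  then have L1: "\<forall>\<^sub>F n in sequentially. 1 \<le> ?L n" unfolding filterlim_at_top by (rule spec)
  have "\<forall>\<^sub>F n in sequentially. 4 \<le> n" by (rule eventually_ge_at_top)
  then have ub: "\<forall>\<^sub>F n in sequentially. rexp (all_pairs {1..n}) (p n) (\<lambda>E. of_bool (\<not> homomorphic_core {1..n} E)) \<le> ?b n"
    using L1 threshold_lower(1)[OF w] D(1,2,3) eventually_quarter_exp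
  proof eventually_elim
    case (elim n)
    then show ?case by (intro rexp_not_core_bound p) auto
  qed
  have "?b \<longlonglongrightarrow> (0 + 3 * 0) + 0 + 0 + 0 + 0 + 0"
    by (intro tendsto_add tendsto_mult tendsto_const fold_error_tendsto[OF w] exp_errors_tendsto D(4))
  then have lim: "?b \<longlonglongrightarrow> 0" by simp
  have "0 \<le> rexp (all_pairs {1..n}) (p n) (\<lambda>E. of_bool (\<not> homomorphic_core {1..n} E))" for n
    using p(1)[of n] p(2)[of n] by (intro rexp_nonneg) auto
  then show ?thesis
    by (intro tendsto_sandwich[OF always_eventually ub tendsto_const lim]) blast
qed

lemma core_prob_tendsto_0:
  fixes p :: "nat \<Rightarrow> real"
  assumes p: "\<And>n. 0 \<le> p n" "\<And>n. p n \<le> 1 / 2"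
    and w: "filterlim (\<lambda>n. real n * p n - ln (real n) - ln (ln (real n))) at_bot sequentially"
  shows "(\<lambda>n. rexp (all_pairs {1..n}) (p n) (\<lambda>E. of_bool (homomorphic_core {1..n} E))) \<longlonglongrightarrow> 0"
proof -
  let ?L = "\<lambda>n. ln (real n)" and ?D = "\<lambda>n. real n * p n"
  let ?b = "\<lambda>n. exp (1 - ?L n / 2) + 2 * exp (1 + (?D n - ?L n - ln (?L n))) + 16 * ?L n * exp (- ?L n)"
  note u = threshold_upper[OF w]
  have "\<forall>\<^sub>F n in sequentially. 3 \<le> n" by (rule eventually_ge_at_top)
  then have ub: "\<forall>\<^sub>F n in sequentially. rexp (all_pairs {1..n}) (p n) (\<lambda>E. of_bool (homomorphic_core {1..n} E)) \<le> ?b n"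
    using u(1,2,3)
  proof eventually_elim
    case (elim n)
    have "p n < 1" using p(2)[of n] by simp
    then obtain \<mu> where \<mu>: "real n * ((1 - p n) * ((1 - p n) ^ (n - 2) + real (n - 2) * p n * (1 - p n) ^ (n - 3))) \<le> \<mu>"
      "rexp (all_pairs {1..n}) (p n) (\<lambda>E. of_bool (homomorphic_core {1..n} E)) \<le> 1 / \<mu> + (1 / (1 - p n)\<^sup>2 - 1)"
      using rexp_core_le[of "{1..n}" "p n"] p(1)[of n] elim(1) by auto
    note \<mu>(2)
    also have "1 / \<mu> + (1 / (1 - p n)\<^sup>2 - 1) \<le> ?b n"
      by (rule expected_low_degree_bound[OF p elim(1) refl elim(4) refl elim(2,3) \<mu>(1)])
    finally show ?case .
  qed
  have "0 \<le> rexp (all_pairs {1..n}) (p n) (\<lambda>E. of_bool (homomorphic_core {1..n} E))" for n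
    using p(1)[of n] p(2)[of n] by (intro rexp_nonneg) auto
  then show ?thesis
    by (intro tendsto_sandwich[OF always_eventually ub tendsto_const u(4)]) blast
qed

theorem theorem1:
  fixes p :: "nat \<Rightarrow> real"
  assumes "\<forall>n. 0 \<le> p n \<and> p n \<le> 1/2"
  shows "(filterlim (\<lambda>n. real n * p n - ln (real n) - ln (ln (real n))) at_top sequentially \<longrightarrow>
           (\<lambda>n. measure_pmf.prob (erdos_renyi n (p n)) {E. homomorphic_core {1..n} E}) \<longlonglongrightarrow> 1)
       \<and> (filterlim (\<lambda>n. real n * p n - ln (real n) - ln (ln (real n))) at_bot sequentially \<longrightarrow>
           (\<lambda>n. measure_pmf.prob (erdos_renyi n (p n)) {E. \<not> homomorphic_core {1..n} E}) \<longlonglongrightarrow> 1)"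
proof (intro conjI impI)
  have p: "0 \<le> p n" "p n \<le> 1 / 2" for n using assms by auto
  have p1: "p n \<le> 1" for n using p(2)[of n] by simp
  {
    assume w: "filterlim (\<lambda>n. real n * p n - ln (real n) - ln (ln (real n))) at_top sequentially"
    have "measure_pmf.prob (erdos_renyi n (p n)) {E. homomorphic_core {1..n} E}
      = 1 - rexp (all_pairs {1..n}) (p n) (\<lambda>E. of_bool (\<not> homomorphic_core {1..n} E))" for n
      using prob_not_erdos_renyi[of n "p n" "homomorphic_core {1..n}"]
        prob_erdos_renyi[OF p(1) p1, of n n "\<lambda>E. \<not> homomorphic_core {1..n} E"] by simp
    then show "(\<lambda>n. measure_pmf.prob (erdos_renyi n (p n)) {E. homomorphic_core {1..n} E}) \<longlonglongrightarrow> 1"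
      using tendsto_diff[OF tendsto_const not_core_prob_tendsto_0[OF p w], of 1] by simp
  next
    assume w: "filterlim (\<lambda>n. real n * p n - ln (real n) - ln (ln (real n))) at_bot sequentially"
    have "measure_pmf.prob (erdos_renyi n (p n)) {E. \<not> homomorphic_core {1..n} E}
      = 1 - rexp (all_pairs {1..n}) (p n) (\<lambda>E. of_bool (homomorphic_core {1..n} E))" for n
      using prob_not_erdos_renyi[of n "p n" "homomorphic_core {1..n}"]
        prob_erdos_renyi[OF p(1) p1, of n n "homomorphic_core {1..n}"] by simp
    then show "(\<lambda>n. measure_pmf.prob (erdos_renyi n (p n)) {E. \<not> homomorphic_core {1..n} E}) \<longlonglongrightarrow> 1"
      using tendsto_diff[OF tendsto_const core_prob_tendsto_0[OF p w], of 1] by simp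
  }
qed

end
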